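(* Let either $\alpha\in[1/2,\infty)\setminus\mathbb{N}$ and $k\in\{0,1,\dots,\lfloor2\alpha+1\rfloor-2\}$, or $\alpha\in(-\infty,-3/2)$ and $k\in\{0,1,\dots,\lceil2|\alpha|-2\rceil-2\}$. Suppose $f$ is given by $$f(x)=(ix)^k\int_{-\pi}^{\pi}e^{-ixt}\,d\mu(t),\quad x\in\mathbb{R},$$ for some $\mu\in M(\mathbb{T})$ such that $\operatorname{supp}(\mu)\cap[-\pi,\pi)\subset[-\pi(1-\varepsilon),\pi(1-\varepsilon)]$ for some fixed $0<\varepsilon<1$. Then $$\lim_{c\to\infty}\mathscr{I}_{\alpha,c}f(x)=f(x),\quad x\in\mathbb{R},$$ with convergence being uniform on compact subsets of $\mathbb{R}$. In the case $k=0$, convergence is uniform on $\mathbb{R}$.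
   Context: $M(\mathbb{T})$ is the space of $2\pi$-periodic complex Borel measures on $\mathbb{R}$ with norm $|\mu|([-\pi,\pi))$ (the dual of the continuous $2\pi$-periodic functions); integrals $\int_{-\pi}^{\pi}\cdot\,d\mu$ are over $[-\pi,\pi)$. For $c>0$ and $\alpha\in\mathbb{R}\setminus\{0,1,2,\dots\}$, the one-dimensional general multiquadric $\phi_{\alpha,c}(x)=(x^2+c^2)^\alpha$ has generalized Fourier transform $$\widehat{\phi}_{\alpha,c}(\xi)=\frac{2^{1+\alpha}}{\Gamma(-\alpha)}\Big(\frac{c}{|\xi|}\Big)^{\alpha+\frac12}K_{\alpha+\frac12}(c|\xi|),\quad \xi\neq 0,$$ where $K_\nu=K_{-\nu}$ is the modified Bessel function of the second kind. Set $$\widehat{L}_{\alpha,c}(\xi)=\frac{\widehat{\phi}_{\alpha,c}(\xi)}{\sum_{j\in\mathbb{Z}}\widehat{\phi}_{\alpha,c}(\xi+2\pi j)},\quad\xi\in\mathbb{R}$$ (extended by continuity to $\xi\in2\pi\mathbb{Z}$). This is in $L_1(\mathbb{R})$, and the fundamental function is $L_{\alpha,c}(x)=\frac1{2\pi}\int_{\mathbb{R}}\widehat{L}_{\alpha,c}(\xi)e^{ix\xi}d\xi$. The cardinal interpolant of $f$ is $\mathscr{I}_{\alpha,c}f(x)=\sum_{j\in\mathbb{Z}}f(j)L_{\alpha,c}(x-j)$, a convergent series for the functions $f$ considered here. *)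

theory Defs
  imports "HOL-Analysis.Analysis"
begin

text \<open>
  A periodic complex measure has infinite total variation unless it is zero, so it is a set
  function on the bounded Borel sets only; its values on other sets carry no information.
  Countable additivity makes it of finite variation on \<open>[-\<pi>, \<pi>)\<close>.
\<close>

definition periodic_complex_measures :: "(real set \<Rightarrow> complex) set" where
  "periodic_complex_measures = {\<mu>.
     (\<forall>A\<in>sets borel. bounded A \<longrightarrow> \<mu> ((\<lambda>t. t + 2 * pi) ` A) = \<mu> A) \<and>
     (\<forall>A :: nat \<Rightarrow> real set. range A \<subseteq> sets borel \<longrightarrow> disjoint_family A \<longrightarrow> bounded (\<Union>n. A n) \<longrightarrow>
        (\<lambda>n. \<mu> (A n)) sums \<mu> (\<Union>n. A n))}"

definition measure_support :: "(real set \<Rightarrow> complex) \<Rightarrow> real set" where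
  "measure_support \<mu> =
     {t. \<forall>U. open U \<longrightarrow> t \<in> U \<longrightarrow> (\<exists>A\<in>sets borel. bounded A \<and> A \<subseteq> U \<and> \<mu> A \<noteq> 0)}"

text \<open>
  The positive part of the Jordan decomposition of a real signed measure on \<open>S\<close>. Since
  \<open>ennreal\<close> sends negative reals to 0 and \<open>B = {}\<close> is admissible, the supremum is that of
  \<open>\<sigma> B\<close> over the Borel sets \<open>B \<subseteq> A\<close>. The negative part is the upper variation of \<open>-\<sigma>\<close>.
\<close>

definition upper_variation :: "real set \<Rightarrow> (real set \<Rightarrow> real) \<Rightarrow> real measure" where
  "upper_variation S \<sigma> = measure_of S {A \<in> sets borel. A \<subseteq> S}
     (\<lambda>A. SUP B\<in>{B \<in> sets borel. B \<subseteq> A}. ennreal (\<sigma> B))"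

definition complex_measure_integral ::
    "(real set \<Rightarrow> complex) \<Rightarrow> real set \<Rightarrow> (real \<Rightarrow> complex) \<Rightarrow> complex" where
  "complex_measure_integral \<mu> S g =
     (integral\<^sup>L (upper_variation S (\<lambda>A. Re (\<mu> A))) g
        - integral\<^sup>L (upper_variation S (\<lambda>A. - Re (\<mu> A))) g)
     + \<i> * (integral\<^sup>L (upper_variation S (\<lambda>A. Im (\<mu> A))) g
        - integral\<^sup>L (upper_variation S (\<lambda>A. - Im (\<mu> A))) g)"

text \<open>
  Modified Bessel function of the second kind, of real order and for \<open>x > 0\<close>, by its
  standard integral representation.
\<close>

definition bessel_K :: "real \<Rightarrow> real \<Rightarrow> real" where
  "bessel_K \<nu> x = (LBINT t:{0..}. exp (- x * cosh t) * cosh (\<nu> * t))"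

text \<open>
  Generalized Fourier transform, away from the origin, of the general multiquadric
  \<open>x \<mapsto> (x\<^sup>2 + c\<^sup>2) powr \<alpha>\<close>.
\<close>

definition phi_hat :: "real \<Rightarrow> real \<Rightarrow> real \<Rightarrow> real" where
  "phi_hat \<alpha> c \<xi> = 2 powr (1 + \<alpha>) / Gamma (- \<alpha>) * (c / \<bar>\<xi>\<bar>) powr (\<alpha> + 1 / 2)
     * bessel_K (\<alpha> + 1 / 2) (c * \<bar>\<xi>\<bar>)"

definition L_hat_quotient :: "real \<Rightarrow> real \<Rightarrow> real \<Rightarrow> real" where
  "L_hat_quotient \<alpha> c \<xi> = phi_hat \<alpha> c \<xi> / (\<Sum>\<^sub>\<infinity>j::int. phi_hat \<alpha> c (\<xi> + 2 * pi * of_int j))"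

definition L_hat :: "real \<Rightarrow> real \<Rightarrow> real \<Rightarrow> real" where
  "L_hat \<alpha> c \<xi> = (if \<exists>j::int. \<xi> = 2 * pi * of_int j then Lim (at \<xi>) (L_hat_quotient \<alpha> c)
     else L_hat_quotient \<alpha> c \<xi>)"

definition fundamental_function :: "real \<Rightarrow> real \<Rightarrow> real \<Rightarrow> complex" where
  "fundamental_function \<alpha> c x =
     1 / (2 * of_real pi) * (LINT \<xi>|lborel. of_real (L_hat \<alpha> c \<xi>) * exp (\<i> * of_real (x * \<xi>)))"

definition cardinal_interpolant :: "real \<Rightarrow> real \<Rightarrow> (real \<Rightarrow> complex) \<Rightarrow> real \<Rightarrow> complex" where
  "cardinal_interpolant \<alpha> c f x =
     (\<Sum>\<^sub>\<infinity>j::int. f (of_int j) * fundamental_function \<alpha> c (x - of_int j))"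

end

theory Submission
  imports Defs
begin

text \<open>
  By Poisson summation, applied under the integral against \<open>\<mu>\<close> and differentiated \<open>k\<close> times,
  the interpolant of \<open>f\<close> at \<open>x\<close> is the integral over \<open>t\<close> of the \<open>k\<close>-th derivative at \<open>- t\<close> of the
  periodization of \<open>L_hat \<xi> * cis (x * \<xi>)\<close>. On \<open>{-pi<..<pi}\<close> this periodization differs from
  \<open>cis (x * \<xi>)\<close> by an expression in the ratios \<open>phi_hat (\<xi> + 2 * pi * m) / phi_hat \<xi>\<close>, \<open>m \<noteq> 0\<close>.

  With \<open>\<nu> = \<alpha> + 1 / 2\<close> and \<open>a = \<bar>\<nu>\<bar>\<close>, \<open>phi_hat\<close> is a constant multiple of
  \<open>\<bar>\<xi>\<bar> powr - (\<nu> + a) * \<Psi> (c * \<xi>)\<close>, where \<open>\<Psi> y\<close> is the integral of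
  \<open>v powr (a - 1) * exp (- v - y\<^sup>2 / (4 * v))\<close> over \<open>v > 0\<close>. Below order \<open>2 * a\<close>, \<open>\<Psi>\<close> is continuously
  differentiable everywhere with derivatives of size at most \<open>exp (- (1 - d) * \<bar>y\<bar>)\<close> for every
  \<open>d > 0\<close>, and \<open>\<Psi> y \<ge> exp (- 2 - \<bar>y\<bar>)\<close>. So the ratios and their first \<open>k\<close> derivatives decay
  exponentially in \<open>c\<close>, uniformly on compact subsets of \<open>{-pi<..<pi}\<close>. They have \<open>k + 1 < 2 * a\<close>
  continuous derivatives; by Bessel's inequality this makes the Fourier coefficients
  \<open>j ^ k * L (x - j)\<close> absolutely summable.
\<close>

section \<open>Functions with bounded iterated derivatives\<close>

text \<open>The quotient of two values of \<Psi> must decay together with its derivatives, but the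
  upper bounds for \<Psi> miss its lower bound by a factor \<open>exp (d * \<bar>y\<bar>)\<close>.
  The bound for N derivatives of a reciprocal contains \<open>p = 2 ^ N - 1\<close> such factors, so
  on \<open>{- A<..<A}\<close> the reciprocal costs \<open>exp ((1 + d * p) * c * A)\<close>,
  against a gain of \<open>exp (- (1 - d) * c * (2 * pi - A))\<close> from the nearest translate. As
  d tends to 0 the balance tends to \<open>2 * (pi - A) * c\<close>, positive exactly for
  \<open>A < pi\<close>. This is where the gap between the support and the ends of the period
  enters; d is chosen after A and N.

  Two intervals are used. For \<open>A < pi\<close> the ratios tend to 0. For A between pi and
  \<open>2 * pi\<close> their bounds may grow with c, but for each fixed c they give smoothness
  across the ends of the period, which the Fourier series needs.

  At the origin the same number limits smoothness twice: \<Psi> is controlled below order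
  \<open>2 * a\<close>, and for positive \<nu> the singularity of \<open>phi_hat\<close> turns into
  a factor \<open>\<bar>t\<bar> powr (2 * a)\<close> of the ratios.\<close>

definition vderiv :: "(real \<Rightarrow> complex) \<Rightarrow> real \<Rightarrow> complex" where
  "vderiv g = (\<lambda>x. vector_derivative g (at x))"

text \<open>A single bound \<open>b\<close> serves all orders up to n, so that products and
  reciprocals become arithmetic on bounds instead of combinatorics of derivatives. Continuity is
  asked of the last derivative only, the lower ones being differentiable.\<close>

primrec jet_bounded :: "nat \<Rightarrow> real set \<Rightarrow> (real \<Rightarrow> real) \<Rightarrow> (real \<Rightarrow> complex) \<Rightarrow> bool" where
  "jet_bounded 0 S b g \<longleftrightarrow> continuous_on S g \<and> (\<forall>x\<in>S. norm (g x) \<le> b x)"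
| "jet_bounded (Suc n) S b g \<longleftrightarrow>
     (\<forall>x\<in>S. g differentiable at x \<and> norm (g x) \<le> b x) \<and> jet_bounded n S b (vderiv g)"

lemma vderiv_eq: "(g has_vector_derivative g') (at x) \<Longrightarrow> vderiv g x = g'"
  by (simp add: vderiv_def vector_derivative_at)

lemma has_vector_derivative_vderiv:
  "g differentiable at x \<Longrightarrow> (g has_vector_derivative vderiv g x) (at x)"
  by (simp add: vderiv_def vector_derivative_works)

lemma has_vector_derivative_cong_open:
  assumes "open S" "\<And>x. x \<in> S \<Longrightarrow> f x = g x" "x \<in> S" "(f has_vector_derivative D) (at x)"
  shows "(g has_vector_derivative D) (at x)"
  using assms has_vector_derivative_transform_within_open by metis

lemma jet_bounded_cong:
  assumes "open S"
  shows "(\<And>x. x \<in> S \<Longrightarrow> f x = g x) \<Longrightarrow> jet_bounded n S b f \<Longrightarrow> jet_bounded n S b g"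
proof (induction n arbitrary: f g)
  case 0
  then show ?case using continuous_on_cong[of S S f g] by auto
next
  case (Suc n)
  have D: "(g has_vector_derivative vderiv f x) (at x)" if "x \<in> S" for x
    by (rule has_vector_derivative_cong_open[OF assms Suc.prems(1) that])
       (use Suc.prems(2) that in \<open>auto intro!: has_vector_derivative_vderiv\<close>)
  have "jet_bounded n S b (vderiv g)"
    by (rule Suc.IH[of "vderiv f"]) (use vderiv_eq[OF D] Suc.prems(2) in auto)
  moreover have "g differentiable at x" if "x \<in> S" for x
    using D[OF that] by (rule differentiableI_vector)
  ultimately show ?case using Suc.prems by auto
qed

text \<open>Lets an explicit \<open>g'\<close> replace \<open>vderiv g\<close>. The two may differ
  off S; since S is open, agreement on S determines the higher derivatives there.\<close>

lemma jet_bounded_SucI: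
  assumes "open S" "\<And>x. x \<in> S \<Longrightarrow> (g has_vector_derivative g' x) (at x)"
    and "\<And>x. x \<in> S \<Longrightarrow> norm (g x) \<le> b x" "jet_bounded n S b g'"
  shows "jet_bounded (Suc n) S b g"
proof -
  have "jet_bounded n S b (vderiv g)"
    by (rule jet_bounded_cong[OF assms(1) _ assms(4)]) (use vderiv_eq[OF assms(2)] in auto)
  then show ?thesis using assms by (auto intro: differentiableI_vector)
qed

lemma jet_bounded_le: "jet_bounded n S b g \<Longrightarrow> x \<in> S \<Longrightarrow> norm (g x) \<le> b x"
  by (cases n) auto

lemma jet_bounded_mono:
  "jet_bounded n S b g \<Longrightarrow> S' \<subseteq> S \<Longrightarrow> (\<And>x. x \<in> S' \<Longrightarrow> b x \<le> b' x) \<Longrightarrow> jet_bounded n S' b' g"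
proof (induction n arbitrary: g)
  case 0
  then show ?case by (force intro: continuous_on_subset)
next
  case (Suc n)
  then show ?case by (simp; force)
qed

lemma jet_bounded_continuous_on: "jet_bounded n S b g \<Longrightarrow> continuous_on S g"
  by (cases n)
     (auto intro!: continuous_at_imp_continuous_on differentiable_imp_continuous_within)

lemma jet_bounded_SucD: "jet_bounded (Suc n) S b g \<Longrightarrow> jet_bounded n S b g"
proof (induction n arbitrary: g)
  case 0
  then show ?case using jet_bounded_continuous_on[OF 0] by auto
next
  case (Suc n)
  then show ?case by (metis jet_bounded.simps(2))
qed

section \<open>Jets of sums, products, rescalings, reciprocals and series\<close>

lemma jet_bounded_add:
  assumes "open S"
  shows "jet_bounded n S b f \<Longrightarrow> jet_bounded n S b' g \<Longrightarrow>
    jet_bounded n S (\<lambda>x. b x + b' x) (\<lambda>x. f x + g x)"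
proof (induction n arbitrary: f g)
  case 0
  then show ?case by (auto intro!: continuous_intros norm_triangle_mono)
next
  case (Suc n)
  show ?case
  proof (rule jet_bounded_SucI[OF assms, where g' = "\<lambda>x. vderiv f x + vderiv g x"])
    show "jet_bounded n S (\<lambda>x. b x + b' x) (\<lambda>x. vderiv f x + vderiv g x)"
      by (rule Suc.IH) (use Suc.prems in auto)
  qed (use Suc.prems in \<open>auto intro!: has_vector_derivative_add has_vector_derivative_vderiv norm_triangle_mono\<close>)
qed

lemma jet_bounded_minus:
  assumes "open S"
  shows "jet_bounded n S b f \<Longrightarrow> jet_bounded n S b (\<lambda>x. - f x)"
proof (induction n arbitrary: f)
  case 0
  then show ?case by (auto intro!: continuous_intros)
next
  case (Suc n)
  show ?case
  proof (rule jet_bounded_SucI[OF assms, where g' = "\<lambda>x. - vderiv f x"])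
  qed (use Suc in \<open>auto intro!: has_vector_derivative_minus has_vector_derivative_vderiv\<close>)
qed

lemma jet_bounded_diff:
  assumes "open S" "jet_bounded n S b f" "jet_bounded n S b' g"
  shows "jet_bounded n S (\<lambda>x. b x + b' x) (\<lambda>x. f x - g x)"
  using jet_bounded_add[OF assms(1,2) jet_bounded_minus[OF assms(1,3)]] by simp

text \<open>The product rule yields two products whose jets are one order shorter, so each order
  doubles the constant.\<close>

lemma jet_bounded_mult:
  assumes "open S"
  shows "jet_bounded n S b f \<Longrightarrow> jet_bounded n S b' g \<Longrightarrow>
    jet_bounded n S (\<lambda>x. 2 ^ n * b x * b' x) (\<lambda>x. f x * g x)"
proof (induction n arbitrary: f g)
  case 0
  then show ?case by (auto intro!: continuous_intros mult_mono' simp: norm_mult)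
next
  case (Suc n)
  have nn: "norm (f x * g x) \<le> b x * b' x" "b x * b' x \<ge> 0" if "x \<in> S" for x
    using jet_bounded_le[OF Suc.prems(1) that] jet_bounded_le[OF Suc.prems(2) that]
    by (auto simp: norm_mult intro!: mult_mono' mult_nonneg_nonneg
             intro: order.trans[OF norm_ge_zero])
  show ?case
  proof (rule jet_bounded_SucI[OF assms, where g' = "\<lambda>x. f x * vderiv g x + vderiv f x * g x"])
    have "jet_bounded n S (\<lambda>x. 2 ^ n * b x * b' x + 2 ^ n * b x * b' x) (\<lambda>x. f x * vderiv g x + vderiv f x * g x)"
      by (intro jet_bounded_add assms Suc.IH jet_bounded_SucD[OF Suc.prems(1)]
           jet_bounded_SucD[OF Suc.prems(2)]) (use Suc.prems in auto)
    then show "jet_bounded n S (\<lambda>x. 2 ^ Suc n * b x * b' x) (\<lambda>x. f x * vderiv g x + vderiv f x * g x)"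
      by (simp add: algebra_simps)
  next
    fix x assume x: "x \<in> S"
    have "b x * b' x \<le> 2 ^ Suc n * (b x * b' x)"
      using nn(2)[OF x] mult_right_mono[of 1 "2 ^ Suc n" "b x * b' x"]
      by (metis mult_1 one_le_power one_le_numeral)
    then show "norm (f x * g x) \<le> 2 ^ Suc n * b x * b' x"
      using nn(1)[OF x] by (simp add: mult.assoc)
    show "((\<lambda>x. f x * g x) has_vector_derivative f x * vderiv g x + vderiv f x * g x) (at x)"
      using Suc.prems x by (auto intro!: has_vector_derivative_mult has_vector_derivative_vderiv)
  qed
qed

lemma jet_bounded_const:
  assumes "open S" "\<And>x. x \<in> S \<Longrightarrow> norm z \<le> b x"
  shows "jet_bounded n S b (\<lambda>_. z)"
proof -
  have 0: "jet_bounded n S b (\<lambda>_. 0)" for n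
  proof (induction n)
    case 0
    then show ?case using assms(2) by (auto intro: order.trans[OF norm_ge_zero])
  next
    case (Suc n)
    show ?case
      by (rule jet_bounded_SucI[OF assms(1) _ _ Suc])
         (use assms(2) in \<open>auto intro: order.trans[OF norm_ge_zero]\<close>)
  qed
  show ?thesis
  proof (cases n)
    case 0
    then show ?thesis using assms by auto
  next
    case (Suc m)
    show ?thesis unfolding Suc
      by (rule jet_bounded_SucI[OF assms(1) _ _ 0]) (use assms in auto)
  qed
qed

lemma jet_bounded_cmult:
  assumes "open S"
  shows "jet_bounded n S b g \<Longrightarrow> jet_bounded n S (\<lambda>x. norm z * b x) (\<lambda>x. z * g x)"
proof (induction n arbitrary: g)
  case 0
  then show ?case by (auto intro!: continuous_intros mult_left_mono simp: norm_mult)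
next
  case (Suc n)
  show ?case
    by (rule jet_bounded_SucI[OF assms, where g' = "\<lambda>x. z * vderiv g x"])
       (use Suc in \<open>auto intro!: has_vector_derivative_mult_right has_vector_derivative_vderiv mult_left_mono
          simp: norm_mult\<close>)
qed

text \<open>The chain rule gives one factor c per order, and \<open>c \<ge> 1\<close> makes
  \<open>c ^ n\<close> dominate the lower orders too.\<close>

lemma jet_bounded_affine:
  assumes "open S" "open T" "c \<ge> 1" "\<And>x. x \<in> S \<Longrightarrow> c * x + d \<in> T"
  shows "jet_bounded n T b g \<Longrightarrow> jet_bounded n S (\<lambda>x. c ^ n * b (c * x + d)) (\<lambda>x. g (c * x + d))"
proof (induction n arbitrary: g)
  case 0
  have "continuous_on S (\<lambda>x. g (c * x + d))"
    by (rule continuous_on_compose2[of T g]) (use 0 assms in \<open>auto intro!: continuous_intros\<close>)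
  then show ?case using 0 assms by auto
next
  case (Suc n)
  have D: "((\<lambda>x. g (c * x + d)) has_vector_derivative (of_real c * vderiv g (c * x + d))) (at x)" if "x \<in> S" for x
  proof -
    have "(g has_vector_derivative vderiv g (c * x + d)) (at (c * x + d))"
      using Suc.prems assms(4)[OF that] by (auto intro: has_vector_derivative_vderiv)
    moreover have "((\<lambda>x. c * x + d) has_vector_derivative c) (at x)"
      by (auto intro!: derivative_eq_intros simp: has_real_derivative_iff_has_vector_derivative[symmetric])
    ultimately have "((g \<circ> (\<lambda>x. c * x + d)) has_vector_derivative c *\<^sub>R vderiv g (c * x + d)) (at x)"
      by (intro vector_diff_chain_at)
    then show ?thesis by (simp add: o_def scaleR_conv_of_real)
  qed
  have IH: "jet_bounded n S (\<lambda>x. c ^ n * b (c * x + d)) (\<lambda>x. vderiv g (c * x + d))"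
    by (rule Suc.IH) (use Suc.prems in auto)
  have nn: "norm (g (c * x + d)) \<le> b (c * x + d)" if "x \<in> S" for x
    using Suc.prems assms(4)[OF that] by auto
  show ?case
  proof (rule jet_bounded_SucI[OF assms(1) D])
    show "jet_bounded n S (\<lambda>x. c ^ Suc n * b (c * x + d)) (\<lambda>x. of_real c * vderiv g (c * x + d))"
      using jet_bounded_cmult[OF assms(1) IH, of "of_real c"] assms(3) by (simp add: mult.assoc)
    fix x assume x: "x \<in> S"
    have "b (c * x + d) \<le> c ^ Suc n * b (c * x + d)"
      using mult_right_mono[of 1 "c ^ Suc n" "b (c * x + d)"] one_le_power[OF assms(3), of "Suc n"]
        order.trans[OF norm_ge_zero nn[OF x]] by simp
    then show "norm (g (c * x + d)) \<le> c ^ Suc n * b (c * x + d)"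
      using nn[OF x] by linarith
  qed
qed

text \<open>The derivative of \<open>1 / g\<close> is \<open>- g' * (1 / g)\<^sup>2\<close>, so a
  bound of the form \<open>U ^ p / l ^ (p + 1)\<close> becomes one with \<open>2 * p + 1\<close> in
  place of p; from p = 0 this leads to \<open>p = 2 ^ n - 1\<close>. K is fixed before S, U, l and g
  because these will depend on c.\<close>

lemma jet_bounded_inverse:
  fixes n :: nat
  shows "\<exists>K\<ge>1. \<forall>S U l g. open S \<longrightarrow> jet_bounded n S U g \<longrightarrow> (\<forall>x\<in>S. 0 < l x \<and> l x \<le> norm (g x)) \<longrightarrow>
    jet_bounded n S (\<lambda>x. K * U x ^ (2 ^ n - 1) / l x ^ (2 ^ n)) (\<lambda>x. inverse (g x))"
proof (induction n)
  case 0
  have "norm (inverse z) \<le> inverse m" if "0 < m" "m \<le> norm z" for m and z :: complex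
    using that by (simp add: norm_inverse le_imp_inverse_le)
  then show ?case
    by (intro exI[of _ "1::real"]) (auto intro!: continuous_intros simp: divide_inverse; fastforce)
next
  case (Suc n)
  then obtain K where K: "K \<ge> 1" "\<And>S U l g. open S \<Longrightarrow> jet_bounded n S U g \<Longrightarrow> (\<forall>x\<in>S. 0 < l x \<and> l x \<le> norm (g x)) \<Longrightarrow>
    jet_bounded n S (\<lambda>x. K * U x ^ (2 ^ n - 1) / l x ^ (2 ^ n)) (\<lambda>x. inverse (g x))" by blast
  define K' where "K' = 4 ^ n * K ^ 2"
  define p where "p = (2::nat) ^ n - 1"
  have p: "2 ^ n = Suc p" "2 ^ Suc n - 1 = Suc (2 * p)" "2 ^ Suc n = Suc (Suc (2 * p))"
    using one_le_power[of "2::nat" n] unfolding p_def power_Suc by linarith+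
  have K': "K' \<ge> 1" using mult_mono[of 1 "4 ^ n" 1 "K\<^sup>2"] one_le_power[OF K(1), of 2]
    unfolding K'_def by simp
  show ?case
  proof (intro exI[of _ K'] conjI K' allI impI)
    fix S :: "real set" and U l :: "real \<Rightarrow> real" and g :: "real \<Rightarrow> complex"
    assume S: "open S" and g: "jet_bounded (Suc n) S U g" and l: "\<forall>x\<in>S. 0 < l x \<and> l x \<le> norm (g x)"
    define V where "V x = K * U x ^ p / l x ^ Suc p" for x
    have i: "jet_bounded n S V (\<lambda>x. inverse (g x))"
      using K(2)[OF S jet_bounded_SucD[OF g] l] unfolding V_def p diff_Suc_1 .
    have "jet_bounded n S (\<lambda>x. 2 ^ n * U x * (2 ^ n * V x * V x)) (\<lambda>x. vderiv g x * (inverse (g x) * inverse (g x)))"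
      by (intro jet_bounded_mult S i) (use g in auto)
    then have "jet_bounded n S (\<lambda>x. 2 ^ n * U x * (2 ^ n * V x * V x)) (\<lambda>x. - (vderiv g x * (inverse (g x) * inverse (g x))))"
      by (rule jet_bounded_minus[OF S])
    moreover have e: "2 ^ n * U x * (2 ^ n * V x * V x) = K' * U x ^ Suc (2 * p) / l x ^ Suc (Suc (2 * p))" for x
    proof -
      have "(2::real) ^ n * 2 ^ n = 4 ^ n" by (simp flip: power_mult_distrib)
      then show ?thesis
        unfolding V_def K'_def power2_eq_square mult_2 power_add power_Suc times_divide_eq_right times_divide_eq_left
        by (simp add: mult.assoc mult.left_commute)
    qed
    ultimately have j: "jet_bounded n S (\<lambda>x. K' * U x ^ Suc (2 * p) / l x ^ Suc (Suc (2 * p)))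
        (\<lambda>x. - (vderiv g x * (inverse (g x) * inverse (g x))))" by simp
    show "jet_bounded (Suc n) S (\<lambda>x. K' * U x ^ (2 ^ Suc n - 1) / l x ^ (2 ^ Suc n)) (\<lambda>x. inverse (g x))"
      unfolding p(3) diff_Suc_1
    proof (rule jet_bounded_SucI[OF S _ _ j])
      fix x assume x: "x \<in> S"
      have g0: "g x \<noteq> 0" using l x by force
      have "(g has_vector_derivative vderiv g x) (at x)"
        using g x by (auto intro: has_vector_derivative_vderiv)
      moreover have "(inverse has_field_derivative - (inverse (g x) * inverse (g x))) (at (g x))"
        using DERIV_inverse'[OF DERIV_ident g0] by simp
      ultimately have "(inverse \<circ> g has_vector_derivative vderiv g x * - (inverse (g x) * inverse (g x))) (at x)"
        by (intro field_vector_diff_chain_at)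
      then show "((\<lambda>x. inverse (g x)) has_vector_derivative - (vderiv g x * (inverse (g x) * inverse (g x)))) (at x)"
        by (simp add: o_def)
      have lx: "0 < l x" "l x \<le> U x" "l x \<le> norm (g x)"
        using l x jet_bounded_le[OF g x] by force+
      have "norm (inverse (g x)) \<le> inverse (l x)"
        using lx by (simp add: norm_inverse le_imp_inverse_le)
      \<comment> \<open>The value itself is brought into the shape of the derivative bound: powers
        of l are inserted and those in the numerator replaced by powers of U, using
        \<open>l x \<le> norm (g x) \<le> U x\<close>.\<close>
      also have "\<dots> = l x ^ Suc (2 * p) / l x ^ Suc (Suc (2 * p))"
        using lx by (simp add: field_simps)
      also have "\<dots> \<le> (K' * U x ^ Suc (2 * p)) / l x ^ Suc (Suc (2 * p))"
      proof (rule divide_right_mono)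
        have "l x ^ Suc (2 * p) \<le> U x ^ Suc (2 * p)" using lx by (intro power_mono) auto
        also have "\<dots> \<le> K' * U x ^ Suc (2 * p)"
          using mult_right_mono[OF K', of "U x ^ Suc (2 * p)"] lx by simp
        finally show "l x ^ Suc (2 * p) \<le> K' * U x ^ Suc (2 * p)" .
      qed (use lx in simp)
      finally show "norm (inverse (g x)) \<le> K' * U x ^ Suc (2 * p) / l x ^ Suc (Suc (2 * p))" .
    qed
  qed
qed

text \<open>The Weierstrass M-test for the series of derivatives at each order. Convexity of S is
  what the theorem on termwise differentiation asks for.\<close>

lemma jet_bounded_suminf:
  assumes S: "open S" "convex S" and B: "summable B"
  shows "(\<And>i. jet_bounded n S (\<lambda>_. B i) (g i)) \<Longrightarrow>
    jet_bounded n S (\<lambda>_. suminf B) (\<lambda>x. \<Sum>i. g i x)"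
proof (induction n arbitrary: g)
  case 0
  have u: "uniform_limit S (\<lambda>m x. \<Sum>i<m. g i x) (\<lambda>x. \<Sum>i. g i x) sequentially"
    by (rule Weierstrass_m_test[OF _ B]) (use 0 in auto)
  have "continuous_on S (\<lambda>x. \<Sum>i. g i x)"
    by (rule uniform_limit_theorem[OF _ u]) (use 0 in \<open>auto intro!: always_eventually continuous_intros\<close>)
  moreover have "norm (\<Sum>i. g i x) \<le> suminf B" if "x \<in> S" for x
    by (rule norm_suminf_le[OF _ B]) (use 0 that in auto)
  ultimately show ?case by auto
next
  case (Suc n)
  have le: "norm (g i x) \<le> B i" "norm (vderiv (g i) x) \<le> B i" if "x \<in> S" for i x
    using Suc.prems[of i] that jet_bounded_le[of n S "\<lambda>_. B i" "vderiv (g i)" x] by auto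
  have IH: "jet_bounded n S (\<lambda>_. suminf B) (\<lambda>x. \<Sum>i. vderiv (g i) x)"
    by (rule Suc.IH) (use Suc.prems in auto)
  have u: "uniform_limit S (\<lambda>m x. \<Sum>i<m. vderiv (g i) x) (\<lambda>x. \<Sum>i. vderiv (g i) x) sequentially"
    by (rule Weierstrass_m_test[OF _ B]) (use le in auto)
  have sm: "summable (\<lambda>i. g i x)" if "x \<in> S" for x
    by (rule summable_comparison_test'[OF B]) (use le that in auto)
  show ?case
  proof (rule jet_bounded_SucI[OF S(1) _ _ IH])
    fix x assume x: "x \<in> S"
    show "norm (\<Sum>i. g i x) \<le> suminf B"
      by (rule norm_suminf_le[OF _ B]) (use le x in auto)
    have "\<exists>G. \<forall>x\<in>S. (\<lambda>n. g n x) sums G x \<and> (G has_derivative (\<lambda>h. h *\<^sub>R (\<Sum>i. vderiv (g i) x))) (at x within S)"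
    proof (rule has_derivative_series[where f = g and f' = "\<lambda>i x h. h *\<^sub>R vderiv (g i) x" and x = x and l = "\<Sum>i. g i x"])
      show "(g i has_derivative (\<lambda>h. h *\<^sub>R vderiv (g i) x)) (at x within S)" if "x \<in> S" for i x
        using Suc.prems[of i] that has_vector_derivative_vderiv[of "g i" x]
        by (auto simp: has_vector_derivative_def intro: has_derivative_at_withinI)
      fix e :: real assume "e > 0"
      then have "\<forall>\<^sub>F m in sequentially. \<forall>x\<in>S. dist (\<Sum>i<m. vderiv (g i) x) (\<Sum>i. vderiv (g i) x) < e"
        using u by (simp add: uniform_limit_iff)
      then show "\<forall>\<^sub>F m in sequentially. \<forall>x\<in>S. \<forall>h. norm ((\<Sum>i<m. h *\<^sub>R vderiv (g i) x) - h *\<^sub>R (\<Sum>i. vderiv (g i) x)) \<le> e * norm h"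
      proof eventually_elim
        case (elim m)
        have "norm ((\<Sum>i<m. h *\<^sub>R vderiv (g i) x) - h *\<^sub>R (\<Sum>i. vderiv (g i) x)) = \<bar>h\<bar> * dist (\<Sum>i<m. vderiv (g i) x) (\<Sum>i. vderiv (g i) x)" for h x
          by (simp add: dist_norm scaleR_right.sum[symmetric] scaleR_diff_right[symmetric])
        then show ?case using elim by (metis abs_ge_zero less_imp_le mult.commute mult_left_mono real_norm_def)
      qed
    qed (use S x sm in \<open>auto intro: summable_sums\<close>)
    then obtain G where G: "\<And>x. x \<in> S \<Longrightarrow> (\<lambda>n. g n x) sums G x"
      "\<And>x. x \<in> S \<Longrightarrow> (G has_derivative (\<lambda>h. h *\<^sub>R (\<Sum>i. vderiv (g i) x))) (at x within S)" by blast
    have "(G has_vector_derivative (\<Sum>i. vderiv (g i) x)) (at x)"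
      using G(2)[OF x] at_within_open[OF x S(1)] by (simp add: has_vector_derivative_def)
    then show "((\<lambda>x. \<Sum>i. g i x) has_vector_derivative (\<Sum>i. vderiv (g i) x)) (at x)"
      by (rule has_vector_derivative_cong_open[OF S(1) _ x, rotated]) (use G(1) in \<open>simp add: sums_iff\<close>)
  qed
qed

lemma jet_bounded_nth:
  "jet_bounded n S b g \<Longrightarrow> m \<le> n \<Longrightarrow> jet_bounded (n - m) S b ((vderiv ^^ m) g)"
proof (induction m arbitrary: n g)
  case (Suc m)
  then obtain n' where n: "n = Suc n'" by (cases n) auto
  have "jet_bounded (n' - m) S b ((vderiv ^^ m) (vderiv g))"
    by (rule Suc.IH) (use Suc.prems n in auto)
  then show ?case using n by (simp only: funpow_Suc_right o_def diff_Suc_Suc)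
qed auto

section \<open>The Bessel function near and away from the origin\<close>

lemma DERIV_integral_dominated:
  fixes f f' :: "real \<Rightarrow> 'a \<Rightarrow> real"
  assumes deriv: "\<And>y v. ((\<lambda>y. f y v) has_real_derivative f' y v) (at y)"
    and bound: "\<And>y v. \<bar>f' y v\<bar> \<le> w v" and w: "integrable M w"
    and f: "\<And>y. integrable M (f y)"
  shows "((\<lambda>y. integral\<^sup>L M (f y)) has_real_derivative integral\<^sup>L M (f' y)) (at y)"
  unfolding has_field_derivative_iff tendsto_at_iff_sequentially
proof (intro allI impI)
  fix X :: "nat \<Rightarrow> real" assume X: "\<forall>i. X i \<in> UNIV - {y}" and lim: "X \<longlonglongrightarrow> y"
  define q where "q i v = (f (X i) v - f y v) / (X i - y)" for i v
  have int_q: "integrable M (q i)" for i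
    unfolding q_def by (intro integrable_divide Bochner_Integration.integrable_diff f)
  have q_lim: "(\<lambda>i. q i v) \<longlonglongrightarrow> f' y v" for v
    using deriv[of v y] X lim
    unfolding has_field_derivative_iff tendsto_at_iff_sequentially q_def o_def by blast
  have "(\<lambda>i. integral\<^sup>L M (q i)) \<longlonglongrightarrow> integral\<^sup>L M (f' y)"
  proof (rule integral_dominated_convergence)
    show "f' y \<in> borel_measurable M"
      by (rule borel_measurable_LIMSEQ_real[OF q_lim]) (use int_q in auto)
    show "q i \<in> borel_measurable M" for i using int_q by auto
    show "integrable M w" by (rule w)
    show "AE v in M. (\<lambda>i. q i v) \<longlonglongrightarrow> f' y v" using q_lim by simp
    show "AE v in M. norm (q i v) \<le> w v" for i
    proof (intro always_eventually allI)
      fix v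
      \<comment> \<open>The mean value inequality turns the bound on the derivative into the same
        bound on all difference quotients, which are then dominated by \<open>w\<close>.\<close>
      have "norm (f (X i) v - f y v) \<le> w v * norm (X i - y)"
        by (rule field_differentiable_bound[of UNIV "\<lambda>y. f y v" "\<lambda>y. f' y v"])
           (use bound deriv in \<open>auto intro: has_field_derivative_at_within\<close>)
      then show "norm (q i v) \<le> w v"
        using X[rule_format, of i] by (simp add: q_def field_simps)
    qed
  qed
  moreover have "integral\<^sup>L M (q i) = (integral\<^sup>L M (f (X i)) - integral\<^sup>L M (f y)) / (X i - y)" for i
    unfolding q_def by (simp add: Bochner_Integration.integral_diff f)
  ultimately show "((\<lambda>z. (integral\<^sup>L M (f z) - integral\<^sup>L M (f y)) / (z - y)) \<circ> X) \<longlonglongrightarrow> integral\<^sup>L M (f' y)"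
    by (simp add: o_def)
qed

lemma isCont_integral_dominated:
  fixes f :: "real \<Rightarrow> 'a \<Rightarrow> real"
  assumes cont: "\<And>v. isCont (\<lambda>y. f y v) y"
    and bound: "\<And>y v. \<bar>f y v\<bar> \<le> w v" and w: "integrable M w"
    and f: "\<And>y. f y \<in> borel_measurable M"
  shows "isCont (\<lambda>y. integral\<^sup>L M (f y)) y"
  unfolding continuous_at_sequentially
proof (intro allI impI)
  fix X :: "nat \<Rightarrow> real" assume X: "X \<longlonglongrightarrow> y"
  have "(\<lambda>i. integral\<^sup>L M (f (X i))) \<longlonglongrightarrow> integral\<^sup>L M (f y)"
  proof (rule integral_dominated_convergence[OF f f w])
    show "AE v in M. (\<lambda>i. f (X i) v) \<longlonglongrightarrow> f y v"
      by (intro always_eventually allI isCont_tendsto_compose[OF cont X])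
  qed (use bound in auto)
  then show "((\<lambda>y. integral\<^sup>L M (f y)) \<circ> X) \<longlonglongrightarrow> integral\<^sup>L M (f y)" by (simp add: o_def)
qed

section \<open>Gamma weights and derivatives of the Gaussian\<close>

lemma integrable_Gamma_weight:
  fixes b d :: real
  assumes "b > 0" "d > 0"
  shows "integrable lborel (\<lambda>v. indicator {0<..} v * (v powr (b - 1) * exp (- d * v)))"
proof -
  have "integrable lborel (\<lambda>t. indicator {0..} t * t powr (b - 1) / exp t)"
  proof (rule integrableI_nonneg)
    show "(\<integral>\<^sup>+ t. ennreal (indicator {0..} t * t powr (b - 1) / exp t) \<partial>lborel) < \<infinity>"
      by (simp flip: Gamma_conv_nn_integral_real[OF assms(1)])
  qed (auto simp: indicator_def)
  then have "integrable lborel (\<lambda>v. indicator {0..} (0 + d * v) * (0 + d * v) powr (b - 1) / exp (0 + d * v))"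
    by (rule lborel_integrable_real_affine) (use assms in simp)
  then have "integrable lborel (\<lambda>v. d powr (1 - b) * (indicator {0..} (0 + d * v) * (0 + d * v) powr (b - 1) / exp (0 + d * v)))"
    by (rule integrable_mult_right)
  then show ?thesis
  proof (rule Bochner_Integration.integrable_cong[THEN iffD1, rotated -1])
    fix v :: real
    show "d powr (1 - b) * (indicator {0..} (0 + d * v) * (0 + d * v) powr (b - 1) / exp (0 + d * v)) =
      indicator {0<..} v * (v powr (b - 1) * exp (- d * v))"
    proof (cases "v > 0")
      case True
      have "d powr (1 - b) * d powr (b - 1) = 1" using assms by (simp flip: powr_add)
      then show ?thesis using True assms
        by (simp add: powr_mult exp_minus field_simps)
    next
      case False
      then have "v = 0 \<or> d * v < 0" using assms by (auto simp: mult_less_0_iff)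
      then show ?thesis using False by auto
    qed
  qed simp
qed

text \<open>Induction along Horner's scheme: half of d pays for the factor s, the other half for the
  remaining polynomial.\<close>

lemma poly_le_exp_square:
  fixes p :: "real poly"
  assumes "d > 0"
  shows "\<exists>C\<ge>0. \<forall>s. \<bar>poly p s\<bar> \<le> C * exp (d * s\<^sup>2)"
  using assms
proof (induction p arbitrary: d)
  case 0
  then show ?case by (auto intro!: exI[of _ 0])
next
  case (pCons a p)
  obtain C where C: "C \<ge> 0" "\<And>s. \<bar>poly p s\<bar> \<le> C * exp (d / 2 * s\<^sup>2)"
    using pCons.IH[of "d / 2"] pCons.prems by auto
  have s: "\<bar>s\<bar> \<le> (1 + 2 / d) * exp (d / 2 * s\<^sup>2)" for s :: real
  proof -
    have "\<bar>s\<bar> * 1 \<le> (\<bar>s\<bar>\<^sup>2 + 1\<^sup>2) / 2" using sum_squares_bound[of "\<bar>s\<bar>" 1] by simp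
    then have "\<bar>s\<bar> \<le> 1 + s\<^sup>2" using zero_le_power2[of s] by simp
    moreover have "1 \<le> exp (d / 2 * s\<^sup>2)" using pCons.prems by simp
    moreover have "s\<^sup>2 \<le> 2 / d * exp (d / 2 * s\<^sup>2)"
    proof -
      have "s\<^sup>2 = 2 / d * (d / 2 * s\<^sup>2)" using pCons.prems by simp
      also have "\<dots> \<le> 2 / d * exp (d / 2 * s\<^sup>2)"
      proof (rule mult_left_mono)
        show "d / 2 * s\<^sup>2 \<le> exp (d / 2 * s\<^sup>2)"
          using exp_ge_add_one_self[of "d / 2 * s\<^sup>2"] by linarith
      qed (use pCons.prems in simp)
      finally show ?thesis .
    qed
    ultimately show ?thesis unfolding distrib_right by linarith
  qed
  have "\<bar>poly (pCons a p) s\<bar> \<le> (\<bar>a\<bar> + (1 + 2 / d) * C) * exp (d * s\<^sup>2)" for s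
  proof -
    have "\<bar>poly (pCons a p) s\<bar> \<le> \<bar>a\<bar> + \<bar>s\<bar> * \<bar>poly p s\<bar>"
      by (simp add: abs_mult[symmetric] abs_triangle_ineq)
    also have "\<dots> \<le> \<bar>a\<bar> * exp (d * s\<^sup>2) + ((1 + 2 / d) * exp (d / 2 * s\<^sup>2)) * (C * exp (d / 2 * s\<^sup>2))"
      using s C pCons.prems by (intro add_mono mult_mono mult_left_mono) (auto simp: mult_le_cancel_left1)
    also have "\<dots> = (\<bar>a\<bar> + (1 + 2 / d) * C) * exp (d * s\<^sup>2)"
    proof -
      have "exp (d / 2 * s\<^sup>2) * exp (d / 2 * s\<^sup>2) = exp (d * s\<^sup>2)"
        by (simp flip: exp_add)
      then show ?thesis by (simp flip: \<open>_ = exp (d * s\<^sup>2)\<close> add: algebra_simps)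
    qed
    finally show ?thesis .
  qed
  moreover have "\<bar>a\<bar> + (1 + 2 / d) * C \<ge> 0" using C pCons.prems by auto
  ultimately show ?case by blast
qed

text \<open>Hermite polynomials up to scaling: multiplied by \<open>exp (- (s\<^sup>2) / 4)\<close>
  they are the successive derivatives of this Gaussian.\<close>

primrec gauss_poly :: "nat \<Rightarrow> real poly" where
  "gauss_poly 0 = 1"
| "gauss_poly (Suc n) = pderiv (gauss_poly n) - [:0, 1/2:] * gauss_poly n"

definition gauss_deriv :: "nat \<Rightarrow> real \<Rightarrow> real" where
  "gauss_deriv n s = poly (gauss_poly n) s * exp (- (s\<^sup>2) / 4)"

lemma DERIV_gauss_deriv: "(gauss_deriv n has_real_derivative gauss_deriv (Suc n) s) (at s)"
  unfolding gauss_deriv_def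
  by (rule derivative_eq_intros refl poly_DERIV | simp)+ (simp add: algebra_simps)

lemma gauss_deriv_le:
  assumes "0 < d"
  shows "\<exists>C\<ge>0. \<forall>s. \<bar>gauss_deriv n s\<bar> \<le> C * exp (- (1 - d) * s\<^sup>2 / 4)"
proof -
  obtain C where C: "C \<ge> 0" "\<And>s. \<bar>poly (gauss_poly n) s\<bar> \<le> C * exp (d / 4 * s\<^sup>2)"
    using poly_le_exp_square[of "d / 4" "gauss_poly n"] assms by auto
  have "\<bar>gauss_deriv n s\<bar> \<le> C * exp (- (1 - d) * s\<^sup>2 / 4)" for s
  proof -
    have "\<bar>gauss_deriv n s\<bar> \<le> C * exp (d / 4 * s\<^sup>2) * exp (- (s\<^sup>2) / 4)"
      unfolding gauss_deriv_def abs_mult using C by (intro mult_mono) auto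
    also have "\<dots> = C * exp (- (1 - d) * s\<^sup>2 / 4)"
      unfolding mult.assoc exp_add[symmetric] by (simp add: algebra_simps add_divide_distrib diff_divide_distrib)
    finally show ?thesis .
  qed
  then show ?thesis using C by blast
qed

text \<open>
  The \<open>n\<close>-th derivative in \<open>y\<close> of \<open>v powr (a - 1) * exp (- v - y\<^sup>2 / (4 * v))\<close>. Its integral is
  \<open>2 * (y / 2) powr a * bessel_K a y\<close> for \<open>n = 0\<close>, and converges for all real \<open>y\<close>, including
  \<open>y = 0\<close>, as long as \<open>n < 2 * a\<close>.
\<close>

definition bessel_integrand :: "real \<Rightarrow> nat \<Rightarrow> real \<Rightarrow> real \<Rightarrow> real" where
  "bessel_integrand a n y v =
     indicator {0<..} v * (v powr (a - 1 - real n / 2) * exp (- v) * gauss_deriv n (y / sqrt v))"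

definition bessel_Psi :: "real \<Rightarrow> nat \<Rightarrow> real \<Rightarrow> real" where
  "bessel_Psi a n y = (LINT v|lborel. bessel_integrand a n y v)"

section \<open>Size and smoothness of \<open>bessel_Psi\<close>\<close>

lemma gauss_deriv_measurable [measurable]: "gauss_deriv n \<in> borel_measurable borel"
  by (intro borel_measurable_continuous_onI continuous_at_imp_continuous_on ballI
      DERIV_isCont[OF DERIV_gauss_deriv])

lemma bessel_integrand_measurable [measurable]:
  "bessel_integrand a n y \<in> borel_measurable borel"
  unfolding bessel_integrand_def by measurable

text \<open>With the bound for \<open>gauss_deriv n\<close> at \<open>y / sqrt v\<close>, the
  exponent is \<open>- v - (1 - d) * y\<^sup>2 / (4 * v)\<close>. The part \<open>- d * v\<close> is
  kept for integrability in v; the rest is at most \<open>- (1 - d) * \<bar>y\<bar>\<close> because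
  \<open>v + y\<^sup>2 / (4 * v) \<ge> \<bar>y\<bar>\<close>.\<close>

lemma bessel_integrand_le:
  assumes "0 < d" "d < 1"
  shows "\<exists>C\<ge>0. \<forall>y v. \<bar>bessel_integrand a n y v\<bar> \<le>
    C * exp (- (1 - d) * \<bar>y\<bar>) * (indicator {0<..} v * (v powr (a - real n / 2 - 1) * exp (- d * v)))"
proof -
  obtain C where C: "C \<ge> 0" "\<And>s. \<bar>gauss_deriv n s\<bar> \<le> C * exp (- (1 - d) * s\<^sup>2 / 4)"
    using gauss_deriv_le[OF assms(1)] by auto
  have "\<bar>bessel_integrand a n y v\<bar> \<le>
    C * exp (- (1 - d) * \<bar>y\<bar>) * (indicator {0<..} v * (v powr (a - real n / 2 - 1) * exp (- d * v)))" for y v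
  proof (cases "v > 0")
    case True
    have "\<bar>y\<bar> \<le> v + y\<^sup>2 / (4 * v)"
    proof -
      have "0 \<le> (2 * v - \<bar>y\<bar>)\<^sup>2" by simp
      also have "\<dots> = 4 * v * (v + y\<^sup>2 / (4 * v) - \<bar>y\<bar>)"
        using True by (simp add: power2_eq_square algebra_simps)
      finally show ?thesis using True by (simp add: zero_le_mult_iff)
    qed
    then have "(1 - d) * \<bar>y\<bar> \<le> (1 - d) * (v + y\<^sup>2 / (4 * v))"
      using assms by (intro mult_left_mono) auto
    then have e: "- v + - (1 - d) * (y / sqrt v)\<^sup>2 / 4 \<le> - (1 - d) * \<bar>y\<bar> + - d * v"
    proof -
      define Y where "Y = y\<^sup>2 / (4 * v)"
      have "- (1 - d) * (y / sqrt v)\<^sup>2 / 4 = - ((1 - d) * Y)"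
        using True by (simp add: power_divide Y_def field_simps)
      then show ?thesis
        using \<open>(1 - d) * \<bar>y\<bar> \<le> _\<close> unfolding Y_def[symmetric] by (simp add: algebra_simps)
    qed
    have "\<bar>bessel_integrand a n y v\<bar> = v powr (a - 1 - real n / 2) * exp (- v) * \<bar>gauss_deriv n (y / sqrt v)\<bar>"
      using True by (simp add: bessel_integrand_def abs_mult)
    also have "\<dots> \<le> v powr (a - 1 - real n / 2) * exp (- v) * (C * exp (- (1 - d) * (y / sqrt v)\<^sup>2 / 4))"
      by (intro mult_left_mono C) auto
    also have "\<dots> = C * v powr (a - 1 - real n / 2) * exp (- v + - (1 - d) * (y / sqrt v)\<^sup>2 / 4)"
      unfolding exp_add by (simp add: mult_ac)
    also have "\<dots> \<le> C * v powr (a - 1 - real n / 2) * exp (- (1 - d) * \<bar>y\<bar> + - d * v)"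
      using e C by (intro mult_left_mono) auto
    also have "\<dots> = C * exp (- (1 - d) * \<bar>y\<bar>) * (indicator {0<..} v * (v powr (a - real n / 2 - 1) * exp (- d * v)))"
    proof -
      have "a - 1 - real n / 2 = a - real n / 2 - 1" by simp
      then show ?thesis unfolding exp_add using True by (simp only: mult_ac indicator_simps greaterThan_iff mult_1)
    qed
    finally show ?thesis .
  qed (simp add: bessel_integrand_def)
  then show ?thesis using C by blast
qed

lemma integrable_bessel_integrand:
  assumes "real n < 2 * a"
  shows "integrable lborel (bessel_integrand a n y)"
proof -
  obtain C where C: "C \<ge> 0" "\<And>y v. \<bar>bessel_integrand a n y v\<bar> \<le>
    C * exp (- (1 - 1/2) * \<bar>y\<bar>) * (indicator {0<..} v * (v powr (a - real n / 2 - 1) * exp (- (1/2) * v)))"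
    using bessel_integrand_le[of "1/2" a n] by auto
  have "integrable lborel (\<lambda>v. indicator {0<..} v * (v powr (a - real n / 2 - 1) * exp (- (1/2) * v)) :: real)"
    by (rule integrable_Gamma_weight) (use assms in auto)
  then have "integrable lborel (\<lambda>v. C * exp (- (1 - 1/2) * \<bar>y\<bar>) * (indicator {0<..} v * (v powr (a - real n / 2 - 1) * exp (- (1/2) * v))) :: real)"
    by (rule integrable_mult_right)
  then show ?thesis
  proof (rule Bochner_Integration.integrable_bound)
    show "AE v in lborel. norm (bessel_integrand a n y v) \<le> norm (C * exp (- (1 - 1/2) * \<bar>y\<bar>) * (indicator {0<..} v * (v powr (a - real n / 2 - 1) * exp (- (1/2) * v))))"
      using C(2) by (intro always_eventually allI) (smt (verit, best) real_norm_def)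
  qed simp
qed

lemma bessel_Psi_le:
  assumes "real n < 2 * a" "0 < d" "d < 1"
  shows "\<exists>C\<ge>0. \<forall>y. \<bar>bessel_Psi a n y\<bar> \<le> C * exp (- (1 - d) * \<bar>y\<bar>)"
proof -
  define W where "W v = indicator {0<..} v * (v powr (a - real n / 2 - 1) * exp (- d * v))" for v :: real
  obtain C where C: "C \<ge> 0" "\<And>y v. \<bar>bessel_integrand a n y v\<bar> \<le> C * exp (- (1 - d) * \<bar>y\<bar>) * W v"
    using bessel_integrand_le[OF assms(2,3)] unfolding W_def by blast
  have W: "integrable lborel W" unfolding W_def
    by (rule integrable_Gamma_weight) (use assms in auto)
  have "\<bar>bessel_Psi a n y\<bar> \<le> C * integral\<^sup>L lborel W * exp (- (1 - d) * \<bar>y\<bar>)" for y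
  proof -
    have "\<bar>bessel_Psi a n y\<bar> \<le> (LINT v|lborel. C * exp (- (1 - d) * \<bar>y\<bar>) * W v)"
      unfolding bessel_Psi_def unfolding real_norm_def[symmetric]
      by (rule Bochner_Integration.integral_norm_bound_integral)
         (use C(2) W integrable_bessel_integrand[OF assms(1)] in auto)
    then show ?thesis using W by (simp add: mult_ac)
  qed
  moreover have "integral\<^sup>L lborel W \<ge> 0" unfolding W_def by (intro integral_nonneg_AE) auto
  ultimately show ?thesis using C by (metis mult_nonneg_nonneg)
qed

text \<open>Each derivative in y brings a factor \<open>1 / sqrt v\<close> and so lowers the
  exponent of v by 1/2. Integrability of the dominating weight at v = 0 is what limits the order to
  \<open>n < 2 * a\<close>.\<close>

lemma DERIV_bessel_integrand:
  "((\<lambda>y. bessel_integrand a n y v) has_real_derivative bessel_integrand a (Suc n) y v) (at y)"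
proof (cases "v > 0")
  case True
  have "v powr (a - 1 - real n / 2) * (1 / sqrt v) = v powr (a - 1 - real (Suc n) / 2)"
  proof -
    have "1 / sqrt v = v powr - (1 / 2)" unfolding powr_minus powr_half_sqrt[OF less_imp_le[OF True]] by (simp add: inverse_eq_divide)
    then show ?thesis by (simp flip: powr_add add: algebra_simps add_divide_distrib)
  qed
  moreover have "((\<lambda>y. gauss_deriv n (y / sqrt v)) has_real_derivative gauss_deriv (Suc n) (y / sqrt v) * (1 / sqrt v)) (at y)"
    by (rule DERIV_chain'[OF _ DERIV_gauss_deriv]) (rule DERIV_cdivide[OF DERIV_ident])
  from DERIV_cmult[OF this, of "v powr (a - 1 - real n / 2) * exp (- v)"]
  have "((\<lambda>y. bessel_integrand a n y v) has_real_derivative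
      (v powr (a - 1 - real n / 2) * exp (- v)) * (gauss_deriv (Suc n) (y / sqrt v) * (1 / sqrt v))) (at y)"
    using True by (simp add: bessel_integrand_def)
  moreover have "(v powr (a - 1 - real n / 2) * exp (- v)) * (gauss_deriv (Suc n) (y / sqrt v) * (1 / sqrt v)) =
      (v powr (a - 1 - real n / 2) * (1 / sqrt v)) * exp (- v) * gauss_deriv (Suc n) (y / sqrt v)"
    by (simp only: mult_ac)
  ultimately show ?thesis using True
    unfolding bessel_integrand_def by (simp only: indicator_simps greaterThan_iff mult_1 if_True)
qed (simp add: bessel_integrand_def)

lemma bessel_integrand_dominated:
  assumes "real n < 2 * a"
  shows "\<exists>w. integrable lborel w \<and> (\<forall>y v. \<bar>bessel_integrand a n y v\<bar> \<le> w v)"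
proof -
  define W where "W v = indicator {0<..} v * (v powr (a - real n / 2 - 1) * exp (- (1/2) * v))" for v :: real
  obtain C where C: "C \<ge> 0" "\<And>y v. \<bar>bessel_integrand a n y v\<bar> \<le> C * exp (- (1 - 1/2) * \<bar>y\<bar>) * W v"
    using bessel_integrand_le[of "1/2" a n] unfolding W_def by auto
  have "\<bar>bessel_integrand a n y v\<bar> \<le> C * W v" for y v
  proof -
    have "C * exp (- (1 - 1/2) * \<bar>y\<bar>) * W v \<le> C * 1 * W v"
      using C by (intro mult_mono) (auto simp: W_def)
    then show ?thesis using C(2)[of y v] by simp
  qed
  moreover have "integrable lborel W" unfolding W_def
    by (rule integrable_Gamma_weight) (use assms in auto)
  ultimately show ?thesis by (intro exI[of _ "\<lambda>v. C * W v"]) auto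
qed

lemma DERIV_bessel_Psi:
  assumes "real (Suc n) < 2 * a"
  shows "(bessel_Psi a n has_real_derivative bessel_Psi a (Suc n) y) (at y)"
proof -
  obtain w where "integrable lborel w" "\<And>y v. \<bar>bessel_integrand a (Suc n) y v\<bar> \<le> w v"
    using bessel_integrand_dominated[OF assms] by auto
  then show ?thesis
    unfolding bessel_Psi_def[abs_def] using DERIV_bessel_integrand assms
    by (intro DERIV_integral_dominated[where w = w] integrable_bessel_integrand) auto
qed

lemma isCont_bessel_Psi:
  assumes "real n < 2 * a"
  shows "isCont (bessel_Psi a n) y"
proof -
  obtain w where "integrable lborel w" "\<And>y v. \<bar>bessel_integrand a n y v\<bar> \<le> w v"
    using bessel_integrand_dominated[OF assms] by auto
  then show ?thesis
    unfolding bessel_Psi_def[abs_def]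
    by (intro isCont_integral_dominated[where w = w] DERIV_isCont[OF DERIV_bessel_integrand]) auto
qed

lemma jet_bounded_bessel_Psi:
  assumes "real N < 2 * a" "0 < d" "d < 1"
  shows "\<exists>C\<ge>1. jet_bounded N UNIV (\<lambda>y. C * exp (- (1 - d) * \<bar>y\<bar>)) (\<lambda>y. of_real (bessel_Psi a 0 y))"
proof -
  have "\<forall>n. \<exists>C\<ge>0. n \<le> N \<longrightarrow> (\<forall>y. \<bar>bessel_Psi a n y\<bar> \<le> C * exp (- (1 - d) * \<bar>y\<bar>))"
  proof
    fix n show "\<exists>C\<ge>0. n \<le> N \<longrightarrow> (\<forall>y. \<bar>bessel_Psi a n y\<bar> \<le> C * exp (- (1 - d) * \<bar>y\<bar>))"
      using bessel_Psi_le[of n a d] assms by (cases "n \<le> N") auto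
  qed
  then obtain C where C: "\<And>n. C n \<ge> 0" "\<And>n y. n \<le> N \<Longrightarrow> \<bar>bessel_Psi a n y\<bar> \<le> C n * exp (- (1 - d) * \<bar>y\<bar>)"
    by metis
  define B where "B = 1 + (\<Sum>n\<le>N. C n)"
  have B: "\<bar>bessel_Psi a n y\<bar> \<le> B * exp (- (1 - d) * \<bar>y\<bar>)" if "n \<le> N" for n y
  proof -
    have "C n \<le> B" unfolding B_def using member_le_sum[of n "{..N}" C] C(1) that by auto
    then have "C n * exp (- (1 - d) * \<bar>y\<bar>) \<le> B * exp (- (1 - d) * \<bar>y\<bar>)" by (intro mult_right_mono) auto
    then show ?thesis using C(2)[OF that, of y] by linarith
  qed
  have "jet_bounded m UNIV (\<lambda>y. B * exp (- (1 - d) * \<bar>y\<bar>)) (\<lambda>y. of_real (bessel_Psi a n y))" if "m + n \<le> N" for m n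
    using that
  proof (induction m arbitrary: n)
    case 0
    then have "real n < 2 * a" using assms by (simp add: le_less_trans[of "real n" "real N"])
    then show ?case using B[of n] 0 isCont_bessel_Psi
      by (auto intro!: continuous_at_imp_continuous_on continuous_of_real)
  next
    case (Suc m)
    have "real (Suc n) \<le> real N" using Suc.prems by linarith
    then have "real (Suc n) < 2 * a" using assms by linarith
    then have "((\<lambda>y. complex_of_real (bessel_Psi a n y)) has_vector_derivative complex_of_real (bessel_Psi a (Suc n) y)) (at y)" for y
      by (intro has_vector_derivative_of_real) (use DERIV_bessel_Psi has_real_derivative_iff_has_vector_derivative in blast)
    then show ?case
      by (rule jet_bounded_SucI[OF open_UNIV]) (use B[of n] Suc in auto)
  qed
  from this[of N 0] show ?thesis
    by (intro exI[of _ B]) (auto simp: B_def intro: sum_nonneg C)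
qed

text \<open>Only an interval of length 1 just to the right of the saddle point
  \<open>v = \<bar>y\<bar> / 2\<close> is kept. With \<open>u = v - \<bar>y\<bar> / 2\<close> the
  exponent \<open>v + y\<^sup>2 / (4 * v)\<close> equals
  \<open>\<bar>y\<bar> + u\<^sup>2 / v\<close>, and \<open>1 \<le> u \<le> 2\<close> gives
  \<open>u\<^sup>2 / v \<le> 2\<close>. Starting at \<open>u = 1\<close> ensures
  \<open>v \<ge> 1\<close>, so the power of v is at least 1 for \<open>a \<ge> 1\<close>.\<close>

lemma bessel_Psi_ge:
  assumes "1 \<le> a"
  shows "exp (- 2 - \<bar>y\<bar>) \<le> bessel_Psi a 0 y"
proof -
  define I where "I = {\<bar>y\<bar> / 2 + 1..\<bar>y\<bar> / 2 + 2}"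
  have "exp (- 2 - \<bar>y\<bar>) = (LINT v|lborel. indicator I v * exp (- 2 - \<bar>y\<bar>))"
    by (simp add: I_def)
  also have "\<dots> \<le> bessel_Psi a 0 y"
    unfolding bessel_Psi_def
  proof (rule integral_mono)
    show "integrable lborel (\<lambda>v. indicator I v * exp (- 2 - \<bar>y\<bar>))"
      by (simp add: I_def)
    show "integrable lborel (bessel_integrand a 0 y)"
      by (rule integrable_bessel_integrand) (use assms in simp)
    fix v
    show "indicator I v * exp (- 2 - \<bar>y\<bar>) \<le> bessel_integrand a 0 y v"
    proof (cases "v \<in> I")
      case True
      define u where "u = v - \<bar>y\<bar> / 2"
      have u: "1 \<le> u" "u \<le> 2" "v = u + \<bar>y\<bar> / 2" and v: "1 \<le> v"
        using True by (auto simp: I_def u_def)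
      have "u\<^sup>2 \<le> 2 * u" using u by (simp add: power2_eq_square mult_right_mono)
      also have "\<dots> \<le> 2 * v" using u by simp
      finally have "v * v + (\<bar>y\<bar> / 2)\<^sup>2 \<le> (2 + \<bar>y\<bar>) * v"
        unfolding u_def by (simp add: power2_eq_square algebra_simps)
      then have "v + y\<^sup>2 / (4 * v) \<le> 2 + \<bar>y\<bar>"
        using v by (simp add: field_simps power2_eq_square)
      then have "exp (- 2 - \<bar>y\<bar>) \<le> exp (- v + - ((y / sqrt v)\<^sup>2) / 4)"
        using v by (simp add: power_divide field_simps)
      also have "\<dots> = 1 * (exp (- v) * exp (- ((y / sqrt v)\<^sup>2) / 4))" by (simp add: exp_add[symmetric])
      also have "\<dots> \<le> v powr (a - 1) * (exp (- v) * exp (- ((y / sqrt v)\<^sup>2) / 4))"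
        using v assms by (intro mult_right_mono ge_one_powr_ge_zero) auto
      finally show ?thesis using True v
        by (simp add: bessel_integrand_def gauss_deriv_def)
    qed (simp add: bessel_integrand_def gauss_deriv_def)
  qed
  finally show ?thesis .
qed

section \<open>Identification of \<open>bessel_Psi\<close> with the Bessel function\<close>

lemma integral_lborel_even:
  fixes g :: "real \<Rightarrow> real"
  assumes "\<And>t. g t \<ge> 0" "integrable lborel g"
  shows "(LINT t|lborel. g t) = (LBINT t:{0..}. g t + g (- t))"
proof -
  have g': "integrable lborel (\<lambda>t. g (- t))"
    using lborel_integrable_real_affine[OF assms(2), of "-1" 0] by simp
  have i: "set_integrable lborel A g" "set_integrable lborel A (\<lambda>t. g (- t))" if "A \<in> sets borel" for A
    unfolding set_integrable_def by (intro integrable_mult_indicator assms g'; use that in simp)+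
  have "(LINT t|lborel. g t) = (LINT t|lborel. indicator {0..} t *\<^sub>R g t + indicator {..<0} t *\<^sub>R g t)"
    by (intro Bochner_Integration.integral_cong) (auto simp: indicator_def)
  also have "\<dots> = (LBINT t:{0..}. g t) + (LBINT t:{..<0}. g t)"
    unfolding set_lebesgue_integral_def
    by (rule Bochner_Integration.integral_add) (use i(1)[of "{0..}"] i(1)[of "{..<0}"] in \<open>auto simp: set_integrable_def\<close>)
  also have "(LBINT t:{..<0}. g t) = (LBINT t:{0<..}. g (- t))"
    unfolding set_lebesgue_integral_def
    by (subst lborel_integral_real_affine[of "-1" _ 0]) (auto intro!: Bochner_Integration.integral_cong simp: indicator_def)
  also have "\<dots> = (LBINT t:{0..}. g (- t))"
    unfolding set_lebesgue_integral_def
    by (rule integral_cong_AE) (use AE_lborel_singleton[of 0] g' in \<open>auto simp: indicator_def intro!: borel_measurable_times\<close>)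
  also have "(LBINT t:{0..}. g t) + (LBINT t:{0..}. g (- t)) = (LBINT t:{0..}. g t + g (- t))"
    by (rule set_integral_add(2)[symmetric]) (auto intro: i)
  finally show ?thesis .
qed

text \<open>The substitution \<open>t = ln (2 * v / y)\<close> turns
  \<open>v + y\<^sup>2 / (4 * v)\<close> into \<open>y * cosh t\<close> and the power of v into a
  multiple of \<open>exp (a * t)\<close>. Folding the line onto the half-line replaces this
  exponential by \<open>2 * cosh (a * t)\<close>.\<close>

lemma bessel_Psi_eq_bessel_K:
  assumes a: "a > 0" and y: "y > 0"
  shows "bessel_Psi a 0 y = 2 * (y / 2) powr a * bessel_K a y"
proof -
  define f where "f t = exp (a * t - y * cosh t)" for t
  define g where "g v = ln (2 * v / y)" for v
  have fg: "f (g v) * (1 / v) = (2 / y) powr a * (v powr (a - 1 - real 0 / 2) * exp (- v) * gauss_deriv 0 (y / sqrt v))" if "v > 0" for v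
  proof -
    have c: "cosh (g v) = (2 * v / y + y / (2 * v)) / 2"
      using that y by (simp add: g_def cosh_ln_real field_simps)
    have "f (g v) = exp (a * g v) * exp (- v) * exp (- (y\<^sup>2 / (4 * v)))"
      unfolding f_def c exp_add[symmetric] using y that
      by (simp add: field_simps power2_eq_square)
    moreover have "exp (a * g v) = (2 / y) powr a * v powr a"
      using y that by (simp add: g_def powr_def exp_add[symmetric] ln_mult ln_div algebra_simps)
    moreover have "v powr (a - 1) = v powr a * (1 / v)" using that by (simp add: powr_diff)
    ultimately show ?thesis using that
      by (simp add: gauss_deriv_def power_divide)
  qed
  have int: "set_integrable lborel (einterval 0 \<infinity>) (\<lambda>v. f (g v) * (1 / v))"
  proof -
    have "integrable lborel (\<lambda>v. (2 / y) powr a * bessel_integrand a 0 y v)"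
      by (intro integrable_mult_right integrable_bessel_integrand) (use a in simp)
    then show ?thesis unfolding set_integrable_def
      by (rule Bochner_Integration.integrable_cong[THEN iffD1, rotated -1])
         (auto simp: fg[simplified] bessel_integrand_def einterval_def zero_ereal_def indicator_def)
  qed
  have lim0: "((ereal \<circ> g \<circ> real_of_ereal) \<longlongrightarrow> - \<infinity>) (at_right 0)"
  proof -
    have "filterlim (\<lambda>v. ln (2 / y * v)) at_bot (at_right 0)"
    proof (rule filterlim_compose[OF ln_at_0])
      show "filterlim (\<lambda>v. 2 / y * v) (at_right 0) (at_right 0)"
        using y filterlim_times_pos[of "\<lambda>v. v" 0 "at_right 0" "2 / y" 0] by (simp add: filterlim_ident mult.commute)
    qed
    then have "((\<lambda>v. ereal (g v)) \<longlongrightarrow> - \<infinity>) (at_right 0)"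
      by (simp add: g_def tendsto_MInfty filterlim_at_bot_dense)
    then show ?thesis
      by (simp add: zero_ereal_def at_right_ereal filterlim_filtermap o_def)
  qed
  have limoo: "((ereal \<circ> g \<circ> real_of_ereal) \<longlongrightarrow> \<infinity>) (at_left \<infinity>)"
  proof -
    have "filterlim (\<lambda>v. ln (2 / y * v)) at_top at_top"
      by (rule filterlim_compose[OF ln_at_top], rule filterlim_tendsto_pos_mult_at_top[OF tendsto_const _ filterlim_ident])
         (use y in simp)
    then have "((\<lambda>v. ereal (g v)) \<longlongrightarrow> \<infinity>) at_top"
      by (simp add: g_def tendsto_PInfty filterlim_at_top_dense)
    then show ?thesis
      by (simp add: at_left_PInf filterlim_filtermap o_def)
  qed
  have d: "DERIV g v :> 1 / v" if "v > 0" for v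
    unfolding g_def using that y by (auto intro!: derivative_eq_intros simp: field_simps)
  have cf: "isCont f t" for t
    unfolding f_def by (intro continuous_intros)
  note sub = interval_integral_substitution_nonneg[of 0 \<infinity> g "\<lambda>v. 1 / v" f "-\<infinity>" \<infinity>, OF _ _ _ _ _ _ lim0 limoo int]
  have f_int: "set_integrable lborel (einterval (-\<infinity>) \<infinity>) f"
    by (rule sub(1)) (use cf in \<open>auto simp: zero_ereal_def f_def intro!: d continuous_intros\<close>)
  have f_eq: "(LBINT t=-\<infinity>..\<infinity>. f t) = (LBINT v=0..\<infinity>. f (g v) * (1 / v))"
    by (rule sub(2)) (use cf in \<open>auto simp: zero_ereal_def f_def intro!: d continuous_intros\<close>)
  have "(LBINT v=0..\<infinity>. f (g v) * (1 / v)) = (2 / y) powr a * bessel_Psi a 0 y"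
  proof -
    have "(LBINT v=0..\<infinity>. f (g v) * (1 / v)) = (LINT v|lborel. (2 / y) powr a * bessel_integrand a 0 y v)"
      unfolding interval_lebesgue_integral_def set_lebesgue_integral_def
      by (subst if_P, simp, rule Bochner_Integration.integral_cong)
         (auto simp: fg[simplified] bessel_integrand_def einterval_def zero_ereal_def indicator_def)
    then show ?thesis unfolding bessel_Psi_def by simp
  qed
  moreover have "(LBINT t=-\<infinity>..\<infinity>. f t) = (LINT t|lborel. f t)"
    by (simp add: interval_lebesgue_integral_def set_lebesgue_integral_def)
  moreover have "(LINT t|lborel. f t) = (LBINT t:{0..}. f t + f (- t))"
    by (rule integral_lborel_even) (use f_int in \<open>auto simp: f_def set_integrable_def\<close>)
  moreover have "\<dots> = (LBINT t:{0..}. 2 * (exp (- y * cosh t) * cosh (a * t)))"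
    by (intro arg_cong[where f = "set_lebesgue_integral lborel {0..}"] ext)
       (simp add: f_def cosh_field_def exp_add[symmetric] field_simps)
  moreover have "\<dots> = 2 * bessel_K a y"
    unfolding bessel_K_def set_lebesgue_integral_def
    by (subst integral_mult_right_zero[symmetric]) (simp add: mult.left_commute)
  ultimately have "(2 / y) powr a * bessel_Psi a 0 y = 2 * bessel_K a y"
    using f_eq by linarith
  moreover have "(y / 2) powr a * (2 / y) powr a = 1"
    using y by (simp flip: powr_mult)
  ultimately show ?thesis
    by (metis (no_types, opaque_lifting) mult.assoc mult.commute mult_1)
qed

section \<open>Ratios of translates of the generalized Fourier transform\<close>

text \<open>One-sided powers are closed under differentiation up to constants, whereas
  differentiating \<open>\<bar>x\<bar> powr s\<close> brings in a sign. At 0 the difference quotient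
  is at most \<open>\<bar>h\<bar> powr (s - 1)\<close>, which vanishes in the limit because
  \<open>1 < s\<close>.\<close>

lemma DERIV_max_powr:
  fixes s \<sigma> x :: real
  assumes s: "1 < s" and \<sigma>: "\<bar>\<sigma>\<bar> = 1"
  shows "((\<lambda>x. max 0 (\<sigma> * x) powr s) has_real_derivative \<sigma> * s * max 0 (\<sigma> * x) powr (s - 1)) (at x)"
proof -
  consider "\<sigma> * x > 0" | "\<sigma> * x < 0" | "x = 0" 
  proof (cases "\<sigma> * x" "0::real" rule: linorder_cases)
    case equal
    then show ?thesis using \<sigma> that(3) by auto
  qed (use that in auto)
  then show ?thesis
  proof cases
    case 1
    have "((\<lambda>x. (\<sigma> * x) powr s) has_real_derivative \<sigma> * s * (\<sigma> * x) powr (s - 1)) (at x)"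
      using 1 by (auto intro!: derivative_eq_intros)
    then show ?thesis
    proof (rule has_field_derivative_transform_within_open[where S = "{x. 0 < \<sigma> * x}", THEN DERIV_cong])
      show "open {x. 0 < \<sigma> * x}" by (intro open_Collect_less continuous_intros)
    qed (use 1 in auto)
  next
    case 2
    have "((\<lambda>x. 0) has_real_derivative 0) (at x)" by simp
    then show ?thesis
    proof (rule has_field_derivative_transform_within_open[where S = "{x. \<sigma> * x < 0}", THEN DERIV_cong])
      show "open {x. \<sigma> * x < 0}" by (intro open_Collect_less continuous_intros)
    qed (use 2 s in auto)
  next
    case 3
    have "((\<lambda>h. max 0 (\<sigma> * h) powr s / h) \<longlongrightarrow> 0) (at 0)"
    proof (rule Lim_null_comparison)
      have "continuous_on UNIV (\<lambda>h::real. \<bar>h\<bar> powr (s - 1))"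
        by (intro continuous_on_powr' continuous_intros) (use s in auto)
      then have "isCont (\<lambda>h::real. \<bar>h\<bar> powr (s - 1)) 0"
        by (simp add: continuous_on_eq_continuous_at)
      then show "((\<lambda>h::real. \<bar>h\<bar> powr (s - 1)) \<longlongrightarrow> 0) (at 0)"
        using s by (simp add: isCont_def)
      have "norm (max 0 (\<sigma> * h) powr s / h) \<le> \<bar>h\<bar> powr (s - 1)" if "h \<noteq> 0" for h
      proof -
        have "max 0 (\<sigma> * h) \<le> \<bar>\<sigma>\<bar> * \<bar>h\<bar>" by (metis abs_ge_self abs_ge_zero abs_mult max.bounded_iff)
        then have "max 0 (\<sigma> * h) powr s \<le> \<bar>h\<bar> powr s"
          using s \<sigma> by (intro powr_mono2) auto
        then have "max 0 (\<sigma> * h) powr s / \<bar>h\<bar> \<le> \<bar>h\<bar> powr s / \<bar>h\<bar>"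
          by (intro divide_right_mono) auto
        then show ?thesis using that by (simp add: powr_diff)
      qed
      then show "\<forall>\<^sub>F h in at 0. norm (max 0 (\<sigma> * h) powr s / h) \<le> \<bar>h\<bar> powr (s - 1)"
        by (rule eventually_mono[OF eventually_neq_at_within[of 0]])
    qed
    then show ?thesis using 3 s by (simp add: has_field_derivative_iff)
  qed
qed

lemma has_vector_derivative_complex_of_real:
  "(f has_real_derivative d) (at x) \<Longrightarrow>
   ((\<lambda>x. complex_of_real (f x)) has_vector_derivative complex_of_real d) (at x)"
  by (rule has_vector_derivative_of_real) (simp add: has_real_derivative_iff_has_vector_derivative)

lemma jet_bounded_max_powr:
  assumes \<sigma>: "\<bar>\<sigma>\<bar> = 1"
  shows "real n < s \<Longrightarrow> \<exists>C\<ge>0. jet_bounded n {- A<..<A} (\<lambda>_. C) (\<lambda>x. of_real (max 0 (\<sigma> * x) powr s))"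
proof (induction n arbitrary: s)
  case 0
  have "continuous_on {- A<..<A} (\<lambda>x. max 0 (\<sigma> * x) powr s)"
    by (intro continuous_on_powr' continuous_intros) (use 0 in auto)
  moreover have "max 0 (\<sigma> * x) powr s \<le> A powr s" if "x \<in> {- A<..<A}" for x
  proof (rule powr_mono2)
    have "\<bar>\<sigma> * x\<bar> = \<bar>x\<bar>" using \<sigma> by (simp add: abs_mult)
    then show "max 0 (\<sigma> * x) \<le> A" using that by auto
  qed (use 0 in auto)
  ultimately show ?case
    by (intro exI[of _ "A powr s"]) (auto intro!: continuous_on_of_real)
next
  case (Suc n)
  then obtain C where C: "C \<ge> 0" "jet_bounded n {- A<..<A} (\<lambda>_. C) (\<lambda>x. of_real (max 0 (\<sigma> * x) powr (s - 1)))"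
  proof -
    have "real n < s - 1" using Suc.prems by simp
    from Suc.IH[OF this] show ?thesis using that by blast
  qed
  define D where "D = s * C + A powr s"
  have D: "D \<ge> 0" "s * C \<le> D" "A powr s \<le> D" using C Suc.prems unfolding D_def by auto
  have "jet_bounded n {- A<..<A} (\<lambda>_. norm (complex_of_real (\<sigma> * s)) * C) (\<lambda>x. of_real (\<sigma> * s) * of_real (max 0 (\<sigma> * x) powr (s - 1)))"
    by (rule jet_bounded_cmult[OF _ C(2)]) simp
  moreover have "norm (complex_of_real (\<sigma> * s)) = s" using \<sigma> Suc.prems by (simp add: norm_mult)
  ultimately have "jet_bounded n {- A<..<A} (\<lambda>_. D) (\<lambda>x. of_real (\<sigma> * s * max 0 (\<sigma> * x) powr (s - 1)))"
    using D jet_bounded_mono[of n "{- A<..<A}" "\<lambda>_. s * C" _ "{- A<..<A}" "\<lambda>_. D"] by simp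
  then have "jet_bounded (Suc n) {- A<..<A} (\<lambda>_. D) (\<lambda>x. of_real (max 0 (\<sigma> * x) powr s))"
  proof (rule jet_bounded_SucI[rotated -1])
    fix x :: real
    show "((\<lambda>x. complex_of_real (max 0 (\<sigma> * x) powr s)) has_vector_derivative of_real (\<sigma> * s * max 0 (\<sigma> * x) powr (s - 1))) (at x)"
      by (intro has_vector_derivative_complex_of_real DERIV_max_powr) (use Suc.prems \<sigma> in auto)
    assume x: "x \<in> {- A<..<A}"
    have "\<bar>\<sigma> * x\<bar> = \<bar>x\<bar>" using \<sigma> by (simp add: abs_mult)
    then have "max 0 (\<sigma> * x) powr s \<le> A powr s" using x Suc.prems by (intro powr_mono2) auto
    then show "norm (complex_of_real (max 0 (\<sigma> * x) powr s)) \<le> D" using D by simp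
  qed simp
  then show ?case using D by blast
qed

lemma jet_bounded_abs_powr:
  assumes "real n < s"
  shows "\<exists>C\<ge>0. jet_bounded n {- A<..<A} (\<lambda>_. C) (\<lambda>x. of_real (\<bar>x\<bar> powr s))"
proof -
  obtain C1 C2 where C: "C1 \<ge> 0" "C2 \<ge> 0" "jet_bounded n {- A<..<A} (\<lambda>_. C1) (\<lambda>x. of_real (max 0 (1 * x) powr s))"
    "jet_bounded n {- A<..<A} (\<lambda>_. C2) (\<lambda>x. of_real (max 0 (- 1 * x) powr s))"
    using jet_bounded_max_powr[of 1 n s A] jet_bounded_max_powr[of "-1" n s A] assms by auto
  have s: "s > 0" using assms by (rule le_less_trans[rotated]) simp
  have "jet_bounded n {- A<..<A} (\<lambda>_. C1 + C2) (\<lambda>x. of_real (\<bar>x\<bar> powr s))"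
  proof (rule jet_bounded_cong[OF _ _ jet_bounded_add[OF _ C(3,4)]])
    fix x :: real
    show "complex_of_real (max 0 (1 * x) powr s) + of_real (max 0 (- 1 * x) powr s) = of_real (\<bar>x\<bar> powr s)"
      using s by (cases "x \<ge> 0") (auto simp: max_def)
  qed auto
  then show ?thesis using C by (intro exI[of _ "C1 + C2"]) auto
qed

text \<open>Powers with nonpositive exponent decrease away from the origin, so one constant serves
  the whole half-line. This makes the later bounds uniform over all nonzero translates.\<close>

lemma jet_bounded_powr_far:
  assumes \<rho>: "\<rho> > 0" and \<sigma>: "\<bar>\<sigma>\<bar> = 1"
  shows "s \<le> 0 \<Longrightarrow> \<exists>C\<ge>0. jet_bounded n {x. \<rho> < \<sigma> * x} (\<lambda>_. C) (\<lambda>x. of_real ((\<sigma> * x) powr s))"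
proof (induction n arbitrary: s)
  case 0
  have "continuous_on {x. \<rho> < \<sigma> * x} (\<lambda>x. (\<sigma> * x) powr s)"
    by (intro continuous_intros) (use \<rho> in auto)
  moreover have "(\<sigma> * x) powr s \<le> \<rho> powr s" if "x \<in> {x. \<rho> < \<sigma> * x}" for x
    by (rule powr_mono2') (use 0 that \<rho> in auto)
  ultimately show ?case
    by (intro exI[of _ "\<rho> powr s"]) (auto intro!: continuous_on_of_real)
next
  case (Suc n)
  define S where "S = {x. \<rho> < \<sigma> * x}"
  have S: "open S" unfolding S_def by (intro open_Collect_less continuous_intros)
  obtain C where C: "C \<ge> 0" "jet_bounded n S (\<lambda>_. C) (\<lambda>x. of_real ((\<sigma> * x) powr (s - 1)))"
    using Suc.IH[of "s - 1"] Suc.prems unfolding S_def by auto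
  define D where "D = \<bar>s\<bar> * C + \<rho> powr s"
  have D: "D \<ge> 0" "\<bar>s\<bar> * C \<le> D" "\<rho> powr s \<le> D" using C unfolding D_def by auto
  have "jet_bounded n S (\<lambda>_. norm (complex_of_real (\<sigma> * s)) * C) (\<lambda>x. of_real (\<sigma> * s) * of_real ((\<sigma> * x) powr (s - 1)))"
    by (rule jet_bounded_cmult[OF S C(2)])
  moreover have "norm (complex_of_real (\<sigma> * s)) = \<bar>s\<bar>" using \<sigma> by (simp add: norm_mult)
  ultimately have "jet_bounded n S (\<lambda>_. D) (\<lambda>x. of_real (\<sigma> * s * (\<sigma> * x) powr (s - 1)))"
    using D jet_bounded_mono[of n S "\<lambda>_. \<bar>s\<bar> * C" _ S "\<lambda>_. D"] by simp
  then have "jet_bounded (Suc n) S (\<lambda>_. D) (\<lambda>x. of_real ((\<sigma> * x) powr s))"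
  proof (rule jet_bounded_SucI[rotated -1])
    fix x assume x: "x \<in> S"
    then have x': "0 < \<sigma> * x" "\<rho> \<le> \<sigma> * x" using \<rho> by (auto simp: S_def)
    then have "((\<lambda>x. (\<sigma> * x) powr s) has_real_derivative \<sigma> * s * (\<sigma> * x) powr (s - 1)) (at x)"
      by (auto intro!: derivative_eq_intros)
    then show "((\<lambda>x. complex_of_real ((\<sigma> * x) powr s)) has_vector_derivative of_real (\<sigma> * s * (\<sigma> * x) powr (s - 1))) (at x)"
      by (rule has_vector_derivative_complex_of_real)
    have "(\<sigma> * x) powr s \<le> \<rho> powr s" using x' \<rho> Suc.prems by (intro powr_mono2') auto
    then show "norm (complex_of_real ((\<sigma> * x) powr s)) \<le> D" using D by simp
  qed (rule S)
  then show ?case using D unfolding S_def by blast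
qed

lemma jet_bounded_Un:
  assumes "open S" "open T"
  shows "jet_bounded n S b g \<Longrightarrow> jet_bounded n T b g \<Longrightarrow> jet_bounded n (S \<union> T) b g"
  using assms by (induction n arbitrary: g) (auto intro: continuous_on_open_Un)

lemma jet_bounded_shift:
  assumes "open S" "open T" "\<And>x. x \<in> S \<Longrightarrow> x + d \<in> T" "jet_bounded n T b g"
  shows "jet_bounded n S (\<lambda>x. b (x + d)) (\<lambda>x. g (x + d))"
  using jet_bounded_affine[OF assms(1,2), of 1 d n b g] assms(3,4) by simp

lemma jet_bounded_abs_powr_far:
  assumes \<rho>: "\<rho> > 0" and s: "s \<le> 0"
  shows "\<exists>C\<ge>0. jet_bounded n {x. \<rho> < \<bar>x\<bar>} (\<lambda>_. C) (\<lambda>x. of_real (\<bar>x\<bar> powr s))"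
proof -
  have *: "\<exists>C\<ge>0. jet_bounded n {x. \<rho> < \<sigma> * x} (\<lambda>_. C) (\<lambda>x. of_real (\<bar>x\<bar> powr s))" if \<sigma>: "\<bar>\<sigma>\<bar> = 1" for \<sigma>
  proof -
    have o: "open {x. \<rho> < \<sigma> * x}" by (intro open_Collect_less continuous_intros)
    obtain C where C: "C \<ge> 0" "jet_bounded n {x. \<rho> < \<sigma> * x} (\<lambda>_. C) (\<lambda>x. of_real ((\<sigma> * x) powr s))"
      using jet_bounded_powr_far[OF \<rho> \<sigma> s] by blast
    have "(\<sigma> * x) powr s = \<bar>x\<bar> powr s" if "\<rho> < \<sigma> * x" for x
    proof -
      have "0 < \<sigma> * x" using that \<rho> by linarith
      then have "\<sigma> * x = \<bar>\<sigma> * x\<bar>" by simp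
      also have "\<dots> = \<bar>x\<bar>" unfolding abs_mult \<sigma> by simp
      finally show ?thesis by simp
    qed
    then have "jet_bounded n {x. \<rho> < \<sigma> * x} (\<lambda>_. C) (\<lambda>x. of_real (\<bar>x\<bar> powr s))"
      by (intro jet_bounded_cong[OF o _ C(2)]) simp
    then show ?thesis using C(1) by blast
  qed
  obtain C1 C2 where C: "C1 \<ge> 0" "C2 \<ge> 0"
    "jet_bounded n {x. \<rho> < 1 * x} (\<lambda>_. C1) (\<lambda>x. of_real (\<bar>x\<bar> powr s))"
    "jet_bounded n {x. \<rho> < - 1 * x} (\<lambda>_. C2) (\<lambda>x. of_real (\<bar>x\<bar> powr s))"
    using *[of 1] *[of "- 1"] by auto
  have "{x. \<rho> < \<bar>x\<bar>} = {x. \<rho> < 1 * x} \<union> {x. \<rho> < - 1 * x}" using \<rho> by auto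
  moreover have "jet_bounded n ({x. \<rho> < 1 * x} \<union> {x. \<rho> < - 1 * x}) (\<lambda>_. C1 + C2) (\<lambda>x. of_real (\<bar>x\<bar> powr s))"
    by (intro jet_bounded_Un open_Collect_less continuous_intros;
        rule jet_bounded_mono[OF C(3)] jet_bounded_mono[OF C(4)]; use C(1,2) in simp)
  ultimately show ?thesis using C(1,2) by (intro exI[of _ "C1 + C2"]) simp
qed

text \<open>For nonzero t and suitable a and q this is
  \<open>phi_hat (t + 2 * pi * m) / phi_hat t\<close>, written so that it is also right at t = 0.
  Since \<open>0 powr 0 = 0\<close>, the case q = 0 needs its own branch to stay continuous there;
  for q > 0 the factor \<open>\<bar>t\<bar> powr q\<close> vanishes at 0, as the limit of the ratio
  does, and m = 0 must be set to 1.\<close>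

definition period_ratio :: "real \<Rightarrow> real \<Rightarrow> real \<Rightarrow> int \<Rightarrow> real \<Rightarrow> real" where
  "period_ratio a q c m t = (if m = 0 then 1 else
     (if q = 0 then 1 else \<bar>t\<bar> powr q) * \<bar>t + 2 * pi * m\<bar> powr (- q) *
     (bessel_Psi a 0 (c * (t + 2 * pi * m)) / bessel_Psi a 0 (c * t)))"

text \<open>On the interval the shifted argument has size at least
  \<open>2 * pi * \<bar>m\<bar> - A\<close>, which gives the decay; the reciprocal of
  \<open>bessel_Psi\<close> at \<open>c * t\<close> costs the term with \<open>1 + d * p\<close>.
  Rescaling by c costs \<open>c ^ N\<close> in the numerator and \<open>c ^ (N * p)\<close> in the
  reciprocal. M depends on neither c nor m.\<close>

lemma jet_bounded_period_ratio:
  fixes N :: nat and a q A d :: real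
  defines "p \<equiv> 2 ^ N - 1 :: nat"
  assumes a: "1 \<le> a" "real N < 2 * a" and q: "q = 0 \<or> real N < q" and A: "0 < A" "A < 2 * pi"
    and d: "0 < d" "d < 1"
  shows "\<exists>M\<ge>0. \<forall>c\<ge>1. \<forall>m. m \<noteq> 0 \<longrightarrow> jet_bounded N {- A<..<A}
    (\<lambda>_. M * c ^ (N * Suc p) * exp (- (c * ((1 - d) * (2 * pi * \<bar>real_of_int m\<bar> - A) - (1 + d * p) * A))))
    (\<lambda>t. of_real (period_ratio a q c m t))"
proof -
  define S where "S = {- A<..<A}"
  have S: "open S" by (simp add: S_def)
  have q0: "q \<ge> 0" using q by (auto intro: less_imp_le le_less_trans[of 0 "real N" q])
  obtain C where C: "C \<ge> 1" "jet_bounded N UNIV (\<lambda>y. C * exp (- (1 - d) * \<bar>y\<bar>)) (\<lambda>y. of_real (bessel_Psi a 0 y))"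
    using jet_bounded_bessel_Psi[of N a d] a d by auto
  obtain K where K: "K \<ge> 1" "\<And>S U l g. open S \<Longrightarrow> jet_bounded N S U g \<Longrightarrow> (\<forall>x\<in>S. 0 < l x \<and> l x \<le> norm (g x)) \<Longrightarrow>
    jet_bounded N S (\<lambda>x. K * U x ^ (2 ^ N - 1) / l x ^ (2 ^ N)) (\<lambda>x. inverse (g x))"
    using jet_bounded_inverse[of N] by blast
  have p: "2 ^ N = Suc p" unfolding p_def by simp
  obtain C1 where C1: "C1 \<ge> 0" "jet_bounded N S (\<lambda>_. C1) (\<lambda>t. of_real (if q = 0 then 1 else \<bar>t\<bar> powr q))"
  proof (cases "q = 0")
    case True
    show ?thesis by (rule that[of 1]) (use True S in \<open>auto intro: jet_bounded_const\<close>)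
  next
    case False
    then show ?thesis using jet_bounded_abs_powr[of N q A] q that unfolding S_def by auto
  qed
  obtain C2 where C2: "C2 \<ge> 0" "jet_bounded N {x. 2 * pi - A < \<bar>x\<bar>} (\<lambda>_. C2) (\<lambda>x. of_real (\<bar>x\<bar> powr - q))"
    using jet_bounded_abs_powr_far[of "2 * pi - A" "- q" N] A q0 by auto
  have far: "2 * pi - A < \<bar>t + 2 * pi * of_int m\<bar>" if "t \<in> S" "m \<noteq> 0" for t m
  proof -
    have "1 \<le> \<bar>real_of_int m\<bar>" using that(2) by linarith
    then have "2 * pi * 1 \<le> 2 * pi * \<bar>real_of_int m\<bar>" by (intro mult_left_mono) auto
    also have "\<dots> = \<bar>2 * pi * of_int m\<bar>" by (simp add: abs_mult)
    finally have "2 * pi \<le> \<bar>2 * pi * of_int m\<bar>" by simp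
    moreover have "\<bar>t\<bar> < A" using that(1) by (auto simp: S_def)
    ultimately show ?thesis by linarith
  qed
  have pw: "jet_bounded N S (\<lambda>_. C2) (\<lambda>t. of_real (\<bar>t + 2 * pi * of_int m\<bar> powr - q))" if m: "m \<noteq> 0" for m
  proof (rule jet_bounded_shift[OF S _ _ C2(2)])
    show "open {x. 2 * pi - A < \<bar>x\<bar>}" by (intro open_Collect_less continuous_intros)
    show "t + 2 * pi * of_int m \<in> {x. 2 * pi - A < \<bar>x\<bar>}" if "t \<in> S" for t
      using far[OF that m] by (rule CollectI)
  qed
  define M where "M = 2 ^ N * (2 ^ N * C1 * C2) * (2 ^ N * C * (K * C ^ p * exp (2 * Suc p)))"
  have M: "M \<ge> 0" using C C1 C2 K by (simp add: M_def)
  show ?thesis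
  proof (intro exI[of _ M] conjI M allI impI)
    fix c :: real and m :: int assume c: "1 \<le> c" and m: "m \<noteq> 0"
    define E1 where "E1 = exp (- (1 - d) * (c * (2 * pi * \<bar>real_of_int m\<bar> - A)))"
    define E2 where "E2 = exp ((1 + d * p) * (c * A))"
    have shift: "jet_bounded N S (\<lambda>_. c ^ N * (C * E1)) (\<lambda>t. of_real (bessel_Psi a 0 (c * t + c * (2 * pi * m))))"
    proof (rule jet_bounded_mono[OF jet_bounded_affine[OF S open_UNIV c _ C(2)]])
      fix t assume t: "t \<in> S"
      have "c * (2 * pi * \<bar>real_of_int m\<bar> - A) \<le> c * \<bar>t + 2 * pi * m\<bar>"
      proof (rule mult_left_mono)
        have "\<bar>2 * pi * real_of_int m\<bar> \<le> \<bar>t + 2 * pi * m\<bar> + \<bar>t\<bar>" by linarith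
        then show "2 * pi * \<bar>real_of_int m\<bar> - A \<le> \<bar>t + 2 * pi * m\<bar>"
          using t by (auto simp: S_def abs_mult)
      qed (use c in simp)
      also have "\<dots> = \<bar>c * t + c * (2 * pi * m)\<bar>" using c by (simp add: abs_mult flip: distrib_left)
      finally have "exp (- (1 - d) * \<bar>c * t + c * (2 * pi * m)\<bar>) \<le> E1"
        unfolding E1_def using d by (simp add: mult_left_mono)
      then show "c ^ N * (C * exp (- (1 - d) * \<bar>c * t + c * (2 * pi * m)\<bar>)) \<le> c ^ N * (C * E1)"
        using C c by (intro mult_left_mono) auto
    qed auto
    have base: "jet_bounded N S (\<lambda>t. c ^ N * (C * exp (- (1 - d) * \<bar>c * t + 0\<bar>))) (\<lambda>t. of_real (bessel_Psi a 0 (c * t + 0)))"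
      by (rule jet_bounded_affine[OF S open_UNIV c _ C(2)]) simp
    have inv: "jet_bounded N S (\<lambda>_. K * C ^ p * exp (2 * Suc p) * c ^ (N * p) * E2) (\<lambda>t. inverse (of_real (bessel_Psi a 0 (c * t + 0))))"
    proof (rule jet_bounded_mono[OF K(2)[OF S base, where l = "\<lambda>t. exp (- 2 - \<bar>c * t + 0\<bar>)"]])
      show "\<forall>t\<in>S. 0 < exp (- 2 - \<bar>c * t + 0\<bar>) \<and> exp (- 2 - \<bar>c * t + 0\<bar>) \<le> norm (complex_of_real (bessel_Psi a 0 (c * t + 0)))"
        unfolding norm_of_real using order.trans[OF bessel_Psi_ge[OF a(1)] abs_ge_self] by simp
      fix t assume t: "t \<in> S"
      define y where "y = c * \<bar>t\<bar>"
      have y: "\<bar>c * t + 0\<bar> = y" "y \<le> c * A" using c t by (auto simp: y_def abs_mult S_def intro!: mult_left_mono)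
      have "K * (c ^ N * (C * exp (- (1 - d) * y))) ^ p / exp (- 2 - y) ^ Suc p =
          K * C ^ p * c ^ (N * p) * (exp (- (1 - d) * y) ^ p / exp (- 2 - y) ^ Suc p)"
        by (simp add: power_mult_distrib power_mult mult_ac)
      \<comment> \<open>There are p upper bounds against \<open>Suc p\<close> lower bounds, and
        \<open>Suc p - (1 - d) * p = 1 + d * p\<close>.\<close>
      also have "exp (- (1 - d) * y) ^ p / exp (- 2 - y) ^ Suc p = exp (2 * Suc p) * exp ((1 + d * p) * y)"
        unfolding exp_of_nat_mult[symmetric] exp_diff[symmetric] exp_add[symmetric]
        by (simp add: algebra_simps)
      also have "K * C ^ p * c ^ (N * p) * (exp (2 * Suc p) * exp ((1 + d * p) * y)) \<le>
          K * C ^ p * c ^ (N * p) * (exp (2 * Suc p) * E2)"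
      proof (intro mult_left_mono)
        show "exp ((1 + d * p) * y) \<le> E2"
          unfolding E2_def exp_le_cancel_iff by (rule mult_left_mono[OF y(2)]) (use d in simp)
      qed (use K C c in auto)
      finally show "K * (c ^ N * (C * exp (- (1 - d) * \<bar>c * t + 0\<bar>))) ^ (2 ^ N - 1) / exp (- 2 - \<bar>c * t + 0\<bar>) ^ 2 ^ N
          \<le> K * C ^ p * exp (2 * Suc p) * c ^ (N * p) * E2"
        unfolding y(1) p diff_Suc_1 by (simp only: mult_ac)
    qed auto
    have "jet_bounded N S (\<lambda>_. 2 ^ N * (2 ^ N * C1 * C2) * (2 ^ N * (c ^ N * (C * E1)) * (K * C ^ p * exp (2 * Suc p) * c ^ (N * p) * E2)))
      (\<lambda>t. (of_real (if q = 0 then 1 else \<bar>t\<bar> powr q) * of_real (\<bar>t + 2 * pi * of_int m\<bar> powr - q)) *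
        (of_real (bessel_Psi a 0 (c * t + c * (2 * pi * m))) * inverse (of_real (bessel_Psi a 0 (c * t + 0)))))"
      by (intro jet_bounded_mult S C1(2) pw m shift inv)
    moreover have "2 ^ N * (2 ^ N * C1 * C2) * (2 ^ N * (c ^ N * (C * E1)) * (K * C ^ p * exp (2 * Suc p) * c ^ (N * p) * E2))
      = M * c ^ (N * Suc p) * (E1 * E2)"
      unfolding M_def mult_Suc_right power_add by (simp only: mult_ac)
    moreover have "E1 * E2 = exp (- (c * ((1 - d) * (2 * pi * \<bar>real_of_int m\<bar> - A) - (1 + d * p) * A)))"
      unfolding E1_def E2_def exp_add[symmetric] by (simp add: algebra_simps)
    ultimately have "jet_bounded N S (\<lambda>_. M * c ^ (N * Suc p) * exp (- (c * ((1 - d) * (2 * pi * \<bar>real_of_int m\<bar> - A) - (1 + d * p) * A))))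
      (\<lambda>t. (of_real (if q = 0 then 1 else \<bar>t\<bar> powr q) * of_real (\<bar>t + 2 * pi * of_int m\<bar> powr - q)) *
        (of_real (bessel_Psi a 0 (c * t + c * (2 * pi * m))) * inverse (of_real (bessel_Psi a 0 (c * t + 0)))))"
      by (simp only:)
    then show "jet_bounded N {- A<..<A} (\<lambda>_. M * c ^ (N * Suc p) * exp (- (c * ((1 - d) * (2 * pi * \<bar>real_of_int m\<bar> - A) - (1 + d * p) * A))))
      (\<lambda>t. of_real (period_ratio a q c m t))"
      unfolding S_def[symmetric]
      by (rule jet_bounded_cong[OF S, rotated])
         (simp only: m period_ratio_def divide_inverse distrib_left of_real_inverse of_real_mult if_False add_0_right)
  qed
qed

text \<open>\<open>int_decode\<close> lists the integers as 0, -1, 1, -2, 2 and so on, so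
  \<open>int_decode (Suc n)\<close> runs through the nonzero ones and grows like half the
  index.\<close>

lemma abs_int_decode_Suc_ge: "(real n + 1) / 2 \<le> \<bar>real_of_int (int_decode (Suc n))\<bar>"
proof (cases "even n")
  case True
  then obtain k where "n = 2 * k" by (rule evenE)
  then show ?thesis by (simp add: int_decode_def sum_decode_def)
next
  case False
  then obtain k where "n = 2 * k + 1" by (rule oddE)
  then show ?thesis by (simp add: int_decode_def sum_decode_def)
qed

lemma int_decode_Suc_neq_0: "int_decode (Suc n) \<noteq> 0"
  using abs_int_decode_Suc_ge[of n] by auto

lemma int_decode_0: "int_decode 0 = 0"
  by (simp add: int_decode_def sum_decode_def)

lemma summable_exp_int_decode: "summable (\<lambda>n. exp (1 - \<bar>real_of_int (int_decode (Suc n))\<bar>))"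
proof (rule summable_comparison_test')
  show "summable (\<lambda>n. exp (1 / 2) * exp (- 1 / 2 :: real) ^ n)"
    by (intro summable_mult summable_geometric) simp
  show "norm (exp (1 - \<bar>real_of_int (int_decode (Suc n))\<bar>)) \<le> exp (1 / 2) * exp (- 1 / 2 :: real) ^ n" for n
  proof -
    have "1 - \<bar>real_of_int (int_decode (Suc n))\<bar> \<le> 1 / 2 + real n * (- 1 / 2)"
      using abs_int_decode_Suc_ge[of n] by (simp add: field_simps)
    then show ?thesis
      unfolding exp_of_nat_mult[symmetric] exp_add[symmetric] by simp
  qed
qed

text \<open>The rate of the nearest translates is separated from the summation. Beyond them each
  further step in \<open>\<bar>m\<bar>\<close> gains \<open>exp (- c * 2 * pi * (1 - d))\<close>,
  which is at most \<open>exp (- 1)\<close> because \<open>c \<ge> 1\<close> and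
  \<open>d \<le> 1 / 2\<close>; this leaves a series that does not depend on c.\<close>

lemma jet_bounded_period_ratio_summable:
  fixes N :: nat and a q A d :: real
  defines "p \<equiv> 2 ^ N - 1 :: nat"
  assumes a: "1 \<le> a" "real N < 2 * a" and q: "q = 0 \<or> real N < q" and A: "0 < A" "A < 2 * pi"
    and d: "0 < d" "d \<le> 1 / 2"
  shows "\<exists>M\<ge>0. \<forall>c\<ge>1. \<forall>n. jet_bounded N {- A<..<A}
    (\<lambda>_. M * c ^ (N * Suc p) * exp (- (c * (2 * pi * (1 - d) - (2 - d + d * p) * A))) *
      exp (1 - \<bar>real_of_int (int_decode (Suc n))\<bar>))
    (\<lambda>t. of_real (period_ratio a q c (int_decode (Suc n)) t))"
proof -
  obtain M where M: "M \<ge> 0" and J: "\<And>c m. c \<ge> 1 \<Longrightarrow> m \<noteq> 0 \<Longrightarrow> jet_bounded N {- A<..<A}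
    (\<lambda>_. M * c ^ (N * Suc p) * exp (- (c * ((1 - d) * (2 * pi * \<bar>real_of_int m\<bar> - A) - (1 + d * p) * A))))
    (\<lambda>t. of_real (period_ratio a q c m t))"
    using jet_bounded_period_ratio[OF a q A, of d] d unfolding p_def by auto
  show ?thesis
  proof (intro exI[of _ M] conjI M allI impI)
    fix c :: real and n assume c: "1 \<le> c"
    define m where "m = \<bar>real_of_int (int_decode (Suc n))\<bar>"
    have "\<bar>int_decode (Suc n)\<bar> \<ge> 1" using int_decode_Suc_neq_0[of n] by linarith
    then have m: "m \<ge> 1" unfolding m_def by linarith
    have "1 * (m - 1) \<le> (c * (2 * pi * (1 - d))) * (m - 1)"
    proof (rule mult_right_mono)
      have "1 * (2 * 2 * (1 / 2)) \<le> c * (2 * pi * (1 - d))"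
        using c d pi_ge_two by (intro mult_mono) auto
      then show "1 \<le> c * (2 * pi * (1 - d))" by simp
    qed (use m in simp)
    then have "- (c * ((1 - d) * (2 * pi * m - A) - (1 + d * p) * A)) \<le>
      - (c * (2 * pi * (1 - d) - (2 - d + d * p) * A)) + (1 - m)"
      by (simp add: algebra_simps)
    then have le: "exp (- (c * ((1 - d) * (2 * pi * m - A) - (1 + d * p) * A))) \<le>
      exp (- (c * (2 * pi * (1 - d) - (2 - d + d * p) * A))) * exp (1 - m)"
      unfolding exp_add[symmetric] by simp
    show "jet_bounded N {- A<..<A}
    (\<lambda>_. M * c ^ (N * Suc p) * exp (- (c * (2 * pi * (1 - d) - (2 - d + d * p) * A))) *
      exp (1 - \<bar>real_of_int (int_decode (Suc n))\<bar>))
    (\<lambda>t. of_real (period_ratio a q c (int_decode (Suc n)) t))"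
      using J[OF c int_decode_Suc_neq_0[of n]]
    proof (rule jet_bounded_mono)
      show "M * c ^ (N * Suc p) * exp (- (c * ((1 - d) * (2 * pi * \<bar>real_of_int (int_decode (Suc n))\<bar> - A) - (1 + d * p) * A)))
        \<le> M * c ^ (N * Suc p) * exp (- (c * (2 * pi * (1 - d) - (2 - d + d * p) * A))) *
          exp (1 - \<bar>real_of_int (int_decode (Suc n))\<bar>)"
        unfolding m_def[symmetric] mult.assoc[of _ "exp _" "exp _"]
        by (rule mult_left_mono[OF le]) (use M c in auto)
    qed simp
  qed
qed

section \<open>\<open>phi_hat\<close> in terms of \<open>bessel_Psi\<close>\<close>

lemma bessel_Psi_pos: "1 \<le> a \<Longrightarrow> 0 < bessel_Psi a 0 y"
  using bessel_Psi_ge[of a y] by (rule less_le_trans[OF exp_gt_zero])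

lemma bessel_Psi_abs: "bessel_Psi a 0 \<bar>y\<bar> = bessel_Psi a 0 y"
  by (simp add: bessel_Psi_def bessel_integrand_def gauss_deriv_def power_divide)

text \<open>Since the Bessel function is even in its order, the absolute value of the order can be
  used for both signs. The singularity at the origin is thereby isolated: its exponent is
  \<open>- 2 * (\<alpha> + 1 / 2)\<close> if the order is positive and 0 if it is negative.\<close>

lemma phi_hat_eq_bessel_Psi:
  assumes c: "c > 0" and \<xi>: "\<xi> \<noteq> 0" and \<nu>: "\<alpha> + 1 / 2 \<noteq> 0"
  shows "phi_hat \<alpha> c \<xi> = (2 powr (1 + \<alpha>) / Gamma (- \<alpha>) * c powr (\<alpha> + 1 / 2 - \<bar>\<alpha> + 1 / 2\<bar>) * 2 powr \<bar>\<alpha> + 1 / 2\<bar> / 2) *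
    (\<bar>\<xi>\<bar> powr - (\<alpha> + 1 / 2 + \<bar>\<alpha> + 1 / 2\<bar>) * bessel_Psi \<bar>\<alpha> + 1 / 2\<bar> 0 (c * \<xi>))"
proof -
  define a where "a = \<bar>\<alpha> + 1 / 2\<bar>"
  have a: "a > 0" using \<nu> by (simp add: a_def)
  define y where "y = c * \<bar>\<xi>\<bar>"
  have y: "y > 0" using c \<xi> by (simp add: y_def)
  have "bessel_K (\<alpha> + 1 / 2) y = bessel_K a y"
  proof -
    have "bessel_K (- \<nu>) y = bessel_K \<nu> y" for \<nu> by (simp add: bessel_K_def)
    then show ?thesis unfolding a_def abs_if by metis
  qed
  moreover have "bessel_Psi a 0 (c * \<xi>) = 2 * (y / 2) powr a * bessel_K a y"
    using bessel_Psi_eq_bessel_K[OF a y] bessel_Psi_abs[of a "c * \<xi>"] c by (simp add: y_def abs_mult)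
  moreover have "(c / \<bar>\<xi>\<bar>) powr (\<alpha> + 1 / 2) = c powr (\<alpha> + 1 / 2 - a) * 2 powr a / 2 * (\<bar>\<xi>\<bar> powr - (\<alpha> + 1 / 2 + a) * (2 * (y / 2) powr a))"
  proof -
    have y_powr: "(y / 2) powr a = c powr a * \<bar>\<xi>\<bar> powr a / 2 powr a"
      using c \<xi> by (simp add: y_def powr_divide powr_mult)
    have c_div: "(c / \<bar>\<xi>\<bar>) powr (\<alpha> + 1 / 2) = c powr (\<alpha> + 1 / 2) / \<bar>\<xi>\<bar> powr (\<alpha> + 1 / 2)"
      using c by (simp add: powr_divide)
    have cancel: "C / X = C / Ca * T / 2 * (1 / (X * Z) * (2 * (Ca * Z / T)))"
      if "X \<noteq> 0" "Z \<noteq> 0" "Ca \<noteq> 0" "T \<noteq> 0" for C X Z Ca T :: real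
      using that by (simp add: field_simps)
    show ?thesis
      unfolding y_powr c_div powr_minus_divide powr_add[of _ "\<alpha> + 1 / 2" a] powr_diff[of _ "\<alpha> + 1 / 2" a]
      by (rule cancel) (use c \<xi> in auto)
  qed
  ultimately show ?thesis
    unfolding phi_hat_def a_def[symmetric] y_def[symmetric] by (simp add: mult_ac)
qed

section \<open>Absolutely convergent Fourier series\<close>

lemma has_vector_derivative_cis_affine:
  "((\<lambda>t. cis (x * t + y)) has_vector_derivative \<i> * of_real x * cis (x * t + y)) (at t within S)"
proof -
  have "((\<lambda>t. x * t + y) has_derivative (\<lambda>h. x * h)) (at t within S)" by (auto intro!: derivative_eq_intros)
  from has_derivative_cis[OF this] show ?thesis
    by (simp add: has_vector_derivative_def scaleR_conv_of_real mult_ac)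
qed

lemma has_vector_derivative_cis_int:
  "((\<lambda>t. cis (of_int j * t)) has_vector_derivative \<i> * of_int j * cis (of_int j * t)) (at t within S)"
  using has_vector_derivative_cis_affine[of "of_int j" 0] by simp

text \<open>The complex form of the difference quotient, which can be divided by another one and
  shifted in its argument.\<close>

lemma has_vector_derivative_at_iff_tendsto:
  fixes p :: "real \<Rightarrow> complex"
  shows "(p has_vector_derivative d) (at t) \<longleftrightarrow> ((\<lambda>s. (p s - p t) / of_real (s - t)) \<longlongrightarrow> d) (at t)"
proof -
  have "norm ((p s - p t) / of_real (s - t) - d) = norm ((p s - (p t + (s - t) *\<^sub>R d)) /\<^sub>R norm (s - t))" if "s \<noteq> t" for s
  proof -
    have "(p s - p t) / of_real (s - t) - d = (p s - (p t + (s - t) *\<^sub>R d)) / of_real (s - t)"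
      using that by (simp add: divide_simps scaleR_conv_of_real del: of_real_diff)
    then show ?thesis by (simp add: norm_divide divide_inverse norm_mult norm_inverse mult.commute del: of_real_diff flip: of_real_inverse)
  qed
  then have "((\<lambda>s. (p s - p t) / of_real (s - t) - d) \<longlongrightarrow> 0) (at t) \<longleftrightarrow>
    ((\<lambda>s. (p s - (p t + (s - t) *\<^sub>R d)) /\<^sub>R norm (s - t)) \<longlongrightarrow> 0) (at t)"
    unfolding tendsto_norm_zero_iff[symmetric, where f = "\<lambda>s. (p s - p t) / of_real (s - t) - d"]
      tendsto_norm_zero_iff[symmetric, where f = "\<lambda>s. (p s - (p t + (s - t) *\<^sub>R d)) /\<^sub>R norm (s - t)"]
    by (intro filterlim_cong refl eventually_mono[OF eventually_neq_at_within[of t]]) auto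
  then show ?thesis
    unfolding has_vector_derivative_def has_derivative_within
    by (simp add: bounded_linear_scaleR_left LIM_zero_iff diff_diff_eq inverse_eq_divide del: of_real_diff)
qed

lemma continuous_on_cis_int [continuous_intros]: "continuous_on S (\<lambda>t. cis (of_int j * t))"
  by (rule continuous_on_vector_derivative) (rule has_vector_derivative_cis_int)

lemma cis_int_pi: "cis (of_int j * pi) = cis (of_int j * - pi)"
proof -
  have "cis (of_int j * pi) = cis (of_int j * - pi + 2 * pi * of_int j)" by (simp add: algebra_simps)
  also have "\<dots> = cis (of_int j * - pi)"
    unfolding cis_mult[symmetric] using cis_multiple_2pi[of "of_int j"] by simp
  finally show ?thesis .
qed

section \<open>Fourier coefficients: orthogonality, Bessel's inequality, summability\<close>

definition fcoeff :: "(real \<Rightarrow> complex) \<Rightarrow> int \<Rightarrow> complex" where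
  "fcoeff p j = integral {-pi..pi} (\<lambda>t. p t * cis (- of_int j * t)) / (2 * of_real pi)"

lemma has_integral_cis_int:
  "((\<lambda>t. cis (of_int j * t)) has_integral (if j = 0 then 2 * of_real pi else 0)) {-pi..pi}"
proof (cases "j = 0")
  case True
  then show ?thesis using has_integral_const_real[of "1::complex" "-pi" pi] by (simp add: scaleR_conv_of_real)
next
  case False
  have "((\<lambda>t. cis (of_int j * t)) has_integral
      (cis (of_int j * pi) / (\<i> * of_int j) - cis (of_int j * - pi) / (\<i> * of_int j))) {-pi..pi}"
  proof (rule fundamental_theorem_of_calculus)
    fix t
    have "((\<lambda>t. cis (of_int j * t) / (\<i> * of_int j)) has_vector_derivative
        (\<i> * of_int j * cis (of_int j * t)) / (\<i> * of_int j)) (at t within {-pi..pi})"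
      by (intro has_vector_derivative_divide has_vector_derivative_cis_int)
    then show "((\<lambda>t. cis (of_int j * t) / (\<i> * of_int j)) has_vector_derivative cis (of_int j * t)) (at t within {-pi..pi})"
      using False by simp
  qed simp
  moreover have "cis (of_int j * pi) = cis (of_int j * - pi)"
    by (rule cis_int_pi)
  ultimately show ?thesis using False by simp
qed

lemma has_integral_fcoeff:
  assumes "continuous_on {-pi..pi} p"
  shows "((\<lambda>t. p t * cis (- of_int j * t)) has_integral 2 * of_real pi * fcoeff p j) {-pi..pi}"
proof -
  have "continuous_on {-pi..pi} (\<lambda>t. p t * cis (of_int (- j) * t))"
    by (intro continuous_intros assms)
  then have "(\<lambda>t. p t * cis (- of_int j * t)) integrable_on {-pi..pi}"
    by (intro integrable_continuous_real) simp
  then show ?thesis by (simp add: fcoeff_def has_integral_iff)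
qed

text \<open>The integral of \<open>(norm (p t - s t))\<^sup>2\<close> is nonnegative for the partial
  sum s. Both cross terms and the square of s integrate to \<open>2 * pi * A\<close>, so one copy of
  it is left to subtract.\<close>

lemma fcoeff_bessel:
  assumes p: "continuous_on {-pi..pi} p" and F: "finite F"
  shows "(\<Sum>j\<in>F. (norm (fcoeff p j))\<^sup>2) \<le> integral {-pi..pi} (\<lambda>t. (norm (p t))\<^sup>2) / (2 * pi)"
proof -
  define a where "a = fcoeff p"
  define s where "s t = (\<Sum>j\<in>F. a j * cis (of_int j * t))" for t
  define A where "A = (\<Sum>j\<in>F. (norm (a j))\<^sup>2)"
  have cs: "cnj (s t) = (\<Sum>j\<in>F. cnj (a j) * cis (- of_int j * t))" for t
    by (simp add: s_def cis_cnj)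
  have A: "(\<Sum>j\<in>F. a j * cnj (a j)) = of_real A"
    by (simp add: A_def complex_norm_square[symmetric])
  have 1: "((\<lambda>t. p t * cnj (s t)) has_integral 2 * of_real pi * of_real A) {-pi..pi}"
  proof -
    have "((\<lambda>t. \<Sum>j\<in>F. cnj (a j) * (p t * cis (- of_int j * t))) has_integral
        (\<Sum>j\<in>F. cnj (a j) * (2 * of_real pi * a j))) {-pi..pi}"
      unfolding a_def by (intro has_integral_sum F has_integral_mult_right has_integral_fcoeff p)
    then show ?thesis by (simp add: cs sum_distrib_left A[symmetric] mult_ac)
  qed
  have 2: "((\<lambda>t. s t * cnj (p t)) has_integral 2 * of_real pi * of_real A) {-pi..pi}"
    using has_integral_cnj[THEN iffD2, OF 1] by (simp add: o_def mult.commute)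
  have 3: "((\<lambda>t. s t * cnj (s t)) has_integral 2 * of_real pi * of_real A) {-pi..pi}"
  proof -
    have "((\<lambda>t. \<Sum>j\<in>F. \<Sum>l\<in>F. a j * cnj (a l) * cis (of_int (j - l) * t)) has_integral
        (\<Sum>j\<in>F. \<Sum>l\<in>F. a j * cnj (a l) * (if j - l = 0 then 2 * of_real pi else 0))) {-pi..pi}"
      by (intro has_integral_sum F has_integral_mult_right has_integral_cis_int)
    moreover have "(\<Sum>j\<in>F. \<Sum>l\<in>F. a j * cnj (a l) * cis (of_int (j - l) * t)) = s t * cnj (s t)" for t
      unfolding cs unfolding s_def sum_product
      by (intro sum.cong refl) (simp add: mult_ac cis_mult algebra_simps)
    moreover have "(\<Sum>j\<in>F. \<Sum>l\<in>F. a j * cnj (a l) * (if j - l = 0 then 2 * of_real pi else 0)) = 2 * of_real pi * of_real A"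
      unfolding A[symmetric] sum_distrib_left
    proof (intro sum.cong refl)
      fix j assume "j \<in> F"
      then show "(\<Sum>l\<in>F. a j * cnj (a l) * (if j - l = 0 then 2 * complex_of_real pi else 0)) = 2 * of_real pi * (a j * cnj (a j))"
        using F sum.delta[of F j "\<lambda>l. a j * cnj (a l) * (2 * of_real pi)"]
        by (simp add: if_distrib[of "\<lambda>x. _ * x"] mult_ac cong: if_cong)
    qed
    ultimately show ?thesis by simp
  qed
  define P where "P = integral {-pi..pi} (\<lambda>t. (norm (p t))\<^sup>2)"
  have "((\<lambda>t. (norm (p t))\<^sup>2) has_integral P) {-pi..pi}"
    unfolding P_def by (intro integrable_integral integrable_continuous_real continuous_intros p)
  then have 4: "((\<lambda>t. p t * cnj (p t)) has_integral of_real P) {-pi..pi}"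
    unfolding complex_norm_square[symmetric] by (rule has_integral_of_real)
  have "((\<lambda>t. p t * cnj (p t) - p t * cnj (s t) - s t * cnj (p t) + s t * cnj (s t)) has_integral
     of_real P - 2 * of_real pi * of_real A - 2 * of_real pi * of_real A + 2 * of_real pi * of_real A) {-pi..pi}"
    by (intro has_integral_add has_integral_diff 1 2 3 4)
  moreover have "p t * cnj (p t) - p t * cnj (s t) - s t * cnj (p t) + s t * cnj (s t) = of_real ((norm (p t - s t))\<^sup>2)" for t
    unfolding complex_norm_square by (simp add: algebra_simps)
  ultimately have "((\<lambda>t. complex_of_real ((norm (p t - s t))\<^sup>2)) has_integral of_real (P - 2 * pi * A)) {-pi..pi}"
    by (simp add: mult_ac)
  from has_integral_linear[OF this bounded_linear_Re]
  have "((\<lambda>t. (norm (p t - s t))\<^sup>2) has_integral (P - 2 * pi * A)) {-pi..pi}"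
    by (simp only: o_def Re_complex_of_real)
  then have "0 \<le> P - 2 * pi * A" by (rule has_integral_nonneg) simp
  then show ?thesis by (simp add: P_def A_def a_def field_simps)
qed

lemma fcoeff_square_summable:
  assumes "continuous_on {-pi..pi} p"
  shows "(\<lambda>j. (norm (fcoeff p j))\<^sup>2) summable_on UNIV"
  by (rule nonneg_bdd_above_summable_on) (use fcoeff_bessel[OF assms] in \<open>auto intro!: bdd_aboveI2\<close>)

text \<open>A Riemann-Lebesgue lemma: injectivity of h makes the squared coefficients along h a
  subsum of those in Bessel's inequality.\<close>

lemma fcoeff_tendsto_0:
  assumes p: "continuous_on {-pi..pi} p" and h: "inj (h :: nat \<Rightarrow> int)"
  shows "(\<lambda>n. fcoeff p (h n)) \<longlonglongrightarrow> 0"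
proof -
  have "summable (\<lambda>n. (norm (fcoeff p (h n)))\<^sup>2)"
  proof (rule summableI_nonneg_bounded)
    fix n
    have "(\<Sum>i<n. (norm (fcoeff p (h i)))\<^sup>2) = (\<Sum>j\<in>h ` {..<n}. (norm (fcoeff p j))\<^sup>2)"
      using h by (subst sum.reindex) (auto intro: inj_on_subset)
    also have "\<dots> \<le> integral {-pi..pi} (\<lambda>t. (norm (p t))\<^sup>2) / (2 * pi)"
      by (rule fcoeff_bessel[OF p]) simp
    finally show "(\<Sum>i<n. (norm (fcoeff p (h i)))\<^sup>2) \<le> integral {-pi..pi} (\<lambda>t. (norm (p t))\<^sup>2) / (2 * pi)" .
  qed simp
  then have "(\<lambda>n. (norm (fcoeff p (h n)))\<^sup>2) \<longlonglongrightarrow> 0" by (rule summable_LIMSEQ_zero)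
  then show ?thesis by (simp add: tendsto_norm_zero_iff)
qed

lemma inverse_square_summable_on_int: "(\<lambda>j::int. 1 / (of_int j)\<^sup>2 :: real) summable_on UNIV"
proof -
  have n: "(\<lambda>n::nat. 1 / (of_nat n)\<^sup>2 :: real) summable_on UNIV"
    using inverse_power_summable[of 2, where 'a = real]
    by (subst summable_on_UNIV_nonneg_real_iff) (auto simp: field_simps)
  have "(\<lambda>j::int. 1 / (of_int j)\<^sup>2 :: real) summable_on (range int)"
    using n by (subst summable_on_reindex) (auto simp: o_def)
  moreover have "(\<lambda>j::int. 1 / (of_int j)\<^sup>2 :: real) summable_on (range (\<lambda>n. - int n))"
    using n by (subst summable_on_reindex) (auto simp: o_def inj_on_def)
  ultimately have "(\<lambda>j::int. 1 / (of_int j)\<^sup>2 :: real) summable_on (range int \<union> range (\<lambda>n. - int n))"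
    by (rule summable_on_union)
  moreover have "range int \<union> range (\<lambda>n. - int n) = UNIV"
  proof -
    have "x \<in> range int \<union> range (\<lambda>n. - int n)" for x by (cases x rule: int_cases2) auto
    then show ?thesis by blast
  qed
  ultimately show ?thesis by simp
qed

text \<open>Integration by parts; the boundary terms cancel because p and the exponentials both
  agree at the two ends.\<close>

lemma fcoeff_deriv:
  assumes p: "\<And>t. t \<in> {-pi..pi} \<Longrightarrow> (p has_vector_derivative p' t) (at t)"
    and p': "continuous_on {-pi..pi} p'" and ends: "p (-pi) = p pi"
  shows "fcoeff p' j = \<i> * of_int j * fcoeff p j"
proof -
  have pc: "continuous_on {-pi..pi} p"
    by (rule continuous_on_vector_derivative) (use p in \<open>auto intro: has_vector_derivative_at_within\<close>)
  have "((\<lambda>t. p t * (\<i> * of_int (- j) * cis (of_int (- j) * t)) + p' t * cis (of_int (- j) * t)) has_integral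
      (p pi * cis (of_int (- j) * pi) - p (- pi) * cis (of_int (- j) * - pi))) {-pi..pi}"
  proof (rule fundamental_theorem_of_calculus)
    fix t assume "t \<in> {-pi..pi}"
    then show "((\<lambda>t. p t * cis (of_int (- j) * t)) has_vector_derivative
        p t * (\<i> * of_int (- j) * cis (of_int (- j) * t)) + p' t * cis (of_int (- j) * t)) (at t within {-pi..pi})"
      by (intro has_vector_derivative_mult has_vector_derivative_cis_int has_vector_derivative_at_within[OF p])
  qed simp
  moreover have "cis (of_int (- j) * pi) = cis (of_int (- j) * - pi)"
    by (rule cis_int_pi)
  ultimately have "((\<lambda>t. p t * (\<i> * of_int (- j) * cis (of_int (- j) * t)) + p' t * cis (of_int (- j) * t)) has_integral 0) {-pi..pi}"
    using ends by simp
  moreover have "((\<lambda>t. (\<i> * of_int (- j)) * (p t * cis (- of_int j * t)) + p' t * cis (- of_int j * t)) has_integral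
      ((\<i> * of_int (- j)) * (2 * of_real pi * fcoeff p j) + 2 * of_real pi * fcoeff p' j)) {-pi..pi}"
    by (intro has_integral_add has_integral_mult_right has_integral_fcoeff pc p')
  ultimately have "(\<i> * of_int (- j)) * (2 * of_real pi * fcoeff p j) + 2 * of_real pi * fcoeff p' j = 0"
    by (intro has_integral_unique[of _ _ "{-pi..pi}"]) (auto simp: mult_ac)
  then have "2 * of_real pi * fcoeff p' j = 2 * of_real pi * (\<i> * of_int j * fcoeff p j)"
    by (simp add: algebra_simps)
  then show ?thesis by simp
qed

text \<open>Away from j = 0 a coefficient of p is one of \<open>p'\<close> divided by j in absolute
  value. The product with \<open>1 / \<bar>j\<bar>\<close> is bounded by a sum of squares, both
  summable.\<close>

lemma fcoeff_summable:
  assumes p: "\<And>t. t \<in> {-pi..pi} \<Longrightarrow> (p has_vector_derivative p' t) (at t)"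
    and p': "continuous_on {-pi..pi} p'" and ends: "p (-pi) = p pi"
  shows "(\<lambda>j. norm (fcoeff p j)) summable_on UNIV"
proof -
  have s: "(\<lambda>j. (norm (fcoeff p' j))\<^sup>2 + 1 / (of_int j)\<^sup>2) summable_on (UNIV - {0})"
    by (rule summable_on_subset_banach[of _ UNIV])
       (intro summable_on_add fcoeff_square_summable p' inverse_square_summable_on_int, simp)
  have "(\<lambda>j. norm (fcoeff p j)) summable_on (UNIV - {0})"
  proof (rule summable_on_comparison_test[OF s])
    fix j :: int assume "j \<in> UNIV - {0}"
    then have j: "\<bar>real_of_int j\<bar> > 0" by simp
    have "norm (fcoeff p j) = norm (fcoeff p' j) * (1 / \<bar>real_of_int j\<bar>)"
      using j fcoeff_deriv[OF p p' ends, of j] by (simp add: norm_mult)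
    also have "\<dots> \<le> ((norm (fcoeff p' j))\<^sup>2 + (1 / \<bar>real_of_int j\<bar>)\<^sup>2) / 2"
      using sum_squares_bound[of "norm (fcoeff p' j)" "1 / \<bar>real_of_int j\<bar>"] by (simp add: mult_ac)
    also have "\<dots> \<le> (norm (fcoeff p' j))\<^sup>2 + 1 / (of_int j)\<^sup>2"
    proof -
      have "(x + y) / 2 \<le> x + y" if "x \<ge> 0" "y \<ge> 0" for x y :: real using that by simp
      from this[of "(norm (fcoeff p' j))\<^sup>2" "(1 / \<bar>real_of_int j\<bar>)\<^sup>2"]
      show ?thesis by (simp add: power_divide)
    qed
    finally show "norm (fcoeff p j) \<le> (norm (fcoeff p' j))\<^sup>2 + 1 / (of_int j)\<^sup>2" .
  qed simp
  moreover have "(\<lambda>j. norm (fcoeff p j)) summable_on {0}" by (rule summable_on_finite) simp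
  ultimately have "(\<lambda>j. norm (fcoeff p j)) summable_on ((UNIV - {0}) \<union> {0})"
    by (rule summable_on_union)
  then show ?thesis by simp
qed

section \<open>Pointwise sums of Fourier series\<close>

lemma filterlim_int_intervals:
  "filterlim (\<lambda>n. {- int n..int n}) (finite_subsets_at_top UNIV) sequentially"
  unfolding filterlim_finite_subsets_at_top
proof safe
  fix X :: "int set" assume X: "finite X"
  define m where "m = nat (\<Sum>x\<in>X. \<bar>x\<bar>)"
  have "x \<in> {- int n..int n}" if "x \<in> X" "n \<ge> m" for x n
  proof -
    have "\<bar>x\<bar> \<le> (\<Sum>x\<in>X. \<bar>x\<bar>)" using X that by (intro member_le_sum) auto
    then show ?thesis using that unfolding m_def by auto
  qed
  then show "\<forall>\<^sub>F n in sequentially. finite {- int n..int n} \<and> X \<subseteq> {- int n..int n} \<and> {- int n..int n} \<subseteq> UNIV"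
    unfolding eventually_sequentially by (intro exI[of _ m]) blast
qed

lemma telescope_int:
  fixes H :: "int \<Rightarrow> complex"
  shows "(\<Sum>j\<in>{- int n..int n}. H (j - 1) - H j) = H (- int n - 1) - H (int n)"
proof (induction n)
  case (Suc n)
  have e: "{- int (Suc n)..int (Suc n)} = insert (- int n - 1) (insert (int n + 1) {- int n..int n})"
    by auto
  have "(\<Sum>j\<in>{- int (Suc n)..int (Suc n)}. H (j - 1) - H j) =
    (H (- int n - 1 - 1) - H (- int n - 1)) + ((H (int n) - H (int n + 1)) + (\<Sum>j\<in>{- int n..int n}. H (j - 1) - H j))"
    unfolding e by simp
  moreover have "- int (Suc n) - 1 = - int n - 1 - 1" "int (Suc n) = int n + 1" by simp_all
  ultimately show ?case unfolding Suc by (simp only:) simp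
qed simp

text \<open>
  Division of \<open>p - p t0\<close> by \<open>cis - cis t0\<close> leaves a continuous function \<open>g\<close>, so the symmetric partial
  sums of the Fourier series of \<open>p - p t0\<close> at \<open>t0\<close> telescope to two coefficients of \<open>g\<close>.
\<close>

lemma fourier_series_eq:
  assumes p: "\<And>t. t \<in> {-pi..pi} \<Longrightarrow> (p has_vector_derivative p' t) (at t)"
    and p': "continuous_on {-pi..pi} p'" and ends: "p (-pi) = p pi"
    and t0: "-pi < t0" "t0 < pi"
  shows "(\<Sum>\<^sub>\<infinity>j. fcoeff p j * cis (of_int j * t0)) = p t0"
proof -
  have pc: "continuous_on {-pi..pi} p"
    by (rule continuous_on_vector_derivative) (use p in \<open>auto intro: has_vector_derivative_at_within\<close>)
  \<comment> \<open>At \<open>t0\<close> the value is the quotient of the two derivatives, obtained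
    as the limit by dividing numerator and denominator by \<open>t - t0\<close>.\<close>
  define g where "g t = (if t = t0 then p' t0 / (\<i> * cis t0) else (p t - p t0) / (cis t - cis t0))" for t
  \<comment> \<open>As \<open>t0\<close> is interior, every point of the closed period, both ends
    included, is at distance less than \<open>2 * pi\<close> from it.\<close>
  have neq: "cis t \<noteq> cis t0" if "t \<in> {-pi..pi}" "t \<noteq> t0" for t
  proof
    assume "cis t = cis t0"
    then have "sin t = sin t0 \<and> cos t = cos t0" by (simp add: complex_eq_iff)
    then obtain n :: int where "t = t0 + 2 * pi * n" using sin_cos_eq_iff by blast
    moreover have "\<bar>t - t0\<bar> < 2 * pi" using that t0 by auto
    ultimately have "\<bar>real_of_int n\<bar> < 1" by (simp add: abs_mult)
    then have "n = 0" by linarith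
    then show False using \<open>t = t0 + _\<close> that by simp
  qed
  have q: "((\<lambda>t. (cis t - cis t0) / of_real (t - t0)) \<longlongrightarrow> \<i> * cis t0) (at t0)"
      "((\<lambda>t. (p t - p t0) / of_real (t - t0)) \<longlongrightarrow> p' t0) (at t0)"
    using has_vector_derivative_cis_int[of 1 t0 UNIV] p[of t0] t0
    by (simp_all add: has_vector_derivative_at_iff_tendsto)
  have lim: "((\<lambda>t. ((p t - p t0) / of_real (t - t0)) / ((cis t - cis t0) / of_real (t - t0))) \<longlongrightarrow> p' t0 / (\<i> * cis t0)) (at t0)"
    by (rule tendsto_divide[OF q(2,1)]) simp
  have "isCont g t0"
    unfolding isCont_def
  proof (rule Lim_transform_eventually)
    show "((\<lambda>t. ((p t - p t0) / of_real (t - t0)) / ((cis t - cis t0) / of_real (t - t0))) \<longlongrightarrow> g t0) (at t0)"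
      using lim by (simp add: g_def)
    show "\<forall>\<^sub>F t in at t0. ((p t - p t0) / of_real (t - t0)) / ((cis t - cis t0) / of_real (t - t0)) = g t"
      by (rule eventually_mono[OF eventually_neq_at_within[of t0]]) (simp add: g_def)
  qed
  moreover have "continuous (at t within {-pi..pi}) g" if t: "t \<in> {-pi..pi}" "t \<noteq> t0" for t
  proof -
    have "continuous (at t within {-pi..pi}) (\<lambda>t. (p t - p t0) / (cis t - cis t0))"
      using pc t neq[OF t] unfolding continuous_on_eq_continuous_within
      by (intro continuous_intros continuous_on_imp_continuous_within[of "{-pi..pi}" cis]) (auto intro: continuous_intros)
    then show ?thesis
      by (rule continuous_transform_within[of _ _ _ "dist t t0"]) (use t in \<open>auto simp: g_def dist_commute\<close>)
  qed
  ultimately have gc: "continuous_on {-pi..pi} g"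
    unfolding continuous_on_eq_continuous_within using continuous_at_imp_continuous_at_within[of t0 g] by blast
  have pg: "p t = p t0 + g t * (cis t - cis t0)" if "t \<in> {-pi..pi}" for t
    using neq[OF that] by (simp add: g_def)
  have coeff: "fcoeff p j = (if j = 0 then p t0 else 0) + (fcoeff g (j - 1) - cis t0 * fcoeff g j)" for j
  proof -
    have A: "((\<lambda>t. p t0 * cis (of_int (- j) * t) + (g t * cis (- of_int (j - 1) * t) - cis t0 * (g t * cis (- of_int j * t)))) has_integral
       p t0 * (if - j = 0 then 2 * of_real pi else 0) + (2 * of_real pi * fcoeff g (j - 1) - cis t0 * (2 * of_real pi * fcoeff g j))) {-pi..pi}"
      by (intro has_integral_add has_integral_diff has_integral_mult_right has_integral_cis_int has_integral_fcoeff gc)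
    have B: "p t0 * cis (of_int (- j) * t) + (g t * cis (- of_int (j - 1) * t) - cis t0 * (g t * cis (- of_int j * t))) = p t * cis (- of_int j * t)"
      if "t \<in> {-pi..pi}" for t
    proof -
      have "cis (- of_int (j - 1) * t) = cis t * cis (- of_int j * t)"
        by (simp add: cis_mult algebra_simps)
      then show ?thesis by (simp add: pg[OF that] algebra_simps)
    qed
    from has_integral_unique[OF has_integral_fcoeff[OF pc] has_integral_eq[OF B A]]
    have "2 * of_real pi * fcoeff p j = 2 * of_real pi * ((if j = 0 then p t0 else 0) + (fcoeff g (j - 1) - cis t0 * fcoeff g j))"
      by (cases "j = 0") (simp_all add: ring_distribs mult_ac)
    then show ?thesis by (subst (asm) mult_cancel_left) simp
  qed
  \<comment> \<open>The index \<open>j + 1\<close> absorbs the factor \<open>cis t0\<close>, so that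
    both coefficients of \<open>g\<close> become values of one function at neighbouring
    integers.\<close>
  define H where "H j = fcoeff g j * cis (of_int (j + 1) * t0)" for j
  have term_eq: "fcoeff p j * cis (of_int j * t0) = (if j = 0 then p t0 else 0) + (H (j - 1) - H j)" for j
  proof -
    have "cis (of_int (j + 1) * t0) = cis t0 * cis (of_int j * t0)"
      by (simp add: cis_mult distrib_right add.commute)
    then have "H j = cis t0 * fcoeff g j * cis (of_int j * t0)" by (simp add: H_def)
    moreover have "H (j - 1) = fcoeff g (j - 1) * cis (of_int j * t0)" by (simp add: H_def)
    ultimately show ?thesis by (simp add: coeff[of j] ring_distribs)
  qed
  have "(\<Sum>j\<in>{- int n..int n}. fcoeff p j * cis (of_int j * t0)) = p t0 + (H (- int n - 1) - H (int n))" for n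
    unfolding term_eq sum.distrib telescope_int by simp
  moreover have "(\<lambda>n. p t0 + (H (- int n - 1) - H (int n))) \<longlonglongrightarrow> p t0 + (0 - 0)"
  proof (intro tendsto_intros)
    have H0: "(\<lambda>n. H (h n)) \<longlonglongrightarrow> 0" if "inj h" for h :: "nat \<Rightarrow> int"
    proof (rule Lim_null_comparison)
      show "\<forall>\<^sub>F n in sequentially. norm (H (h n)) \<le> norm (fcoeff g (h n))"
        by (simp add: H_def norm_mult)
      show "(\<lambda>n. norm (fcoeff g (h n))) \<longlonglongrightarrow> 0"
        using tendsto_norm[OF fcoeff_tendsto_0[OF gc that]] by simp
    qed
    show "(\<lambda>n. H (- int n - 1)) \<longlonglongrightarrow> 0" by (rule H0) (simp add: inj_def)
    show "(\<lambda>n. H (int n)) \<longlonglongrightarrow> 0" by (rule H0) simp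
  qed
  ultimately have lim1: "(\<lambda>n. \<Sum>j\<in>{- int n..int n}. fcoeff p j * cis (of_int j * t0)) \<longlonglongrightarrow> p t0"
    by simp
  \<comment> \<open>Telescoping only yields the limit of symmetric partial sums; absolute
    summability identifies it with the unordered sum.\<close>
  have "(\<lambda>j. fcoeff p j * cis (of_int j * t0)) summable_on UNIV"
    by (rule abs_summable_summable) (use fcoeff_summable[OF p p' ends] in \<open>simp add: norm_mult\<close>)
  then have "((\<lambda>F. \<Sum>j\<in>F. fcoeff p j * cis (of_int j * t0)) \<longlongrightarrow> (\<Sum>\<^sub>\<infinity>j. fcoeff p j * cis (of_int j * t0))) (finite_subsets_at_top UNIV)"
    by (rule infsum_tendsto)
  from filterlim_compose[OF this filterlim_int_intervals] lim1 show ?thesis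
    by (rule LIMSEQ_unique)
qed

section \<open>Variations of countably additive set functions\<close>

text \<open>The additivity clause of \<open>periodic_complex_measures\<close>, with a general
  codomain so that it passes to real and imaginary parts.\<close>

definition bounded_countably_additive :: "(real set \<Rightarrow> 'a :: real_normed_vector) \<Rightarrow> bool" where
  "bounded_countably_additive \<sigma> \<longleftrightarrow>
     (\<forall>A :: nat \<Rightarrow> real set. range A \<subseteq> sets borel \<longrightarrow> disjoint_family A \<longrightarrow> bounded (\<Union>n. A n) \<longrightarrow>
        (\<lambda>n. \<sigma> (A n)) sums \<sigma> (\<Union>n. A n))"

context
  fixes \<sigma> :: "real set \<Rightarrow> 'a :: real_normed_vector"
  assumes ca: "bounded_countably_additive \<sigma>"
begin

lemma countably_additive_sums:
  fixes A :: "nat \<Rightarrow> real set"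
  assumes "\<And>n. A n \<in> sets borel" "disjoint_family A" "bounded (\<Union>n. A n)"
  shows "(\<lambda>n. \<sigma> (A n)) sums \<sigma> (\<Union>n. A n)"
  using ca assms unfolding bounded_countably_additive_def by blast

lemma countably_additive_empty: "\<sigma> {} = 0"
proof -
  \<comment> \<open>A constant series can converge only if its terms are 0.\<close>
  have "(\<lambda>n::nat. \<sigma> {}) sums \<sigma> (\<Union>n::nat. {})"
    by (rule countably_additive_sums) (auto simp: disjoint_family_on_def)
  from summable_LIMSEQ_zero[OF sums_summable[OF this]] show ?thesis by (simp add: LIMSEQ_const_iff)
qed

lemma countably_additive_Un:
  assumes "A \<in> sets borel" "B \<in> sets borel" "A \<inter> B = {}" "bounded A" "bounded B"
  shows "\<sigma> (A \<union> B) = \<sigma> A + \<sigma> B"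
proof -
  have "(\<lambda>n. \<sigma> (binaryset A B n)) sums \<sigma> (\<Union>n. binaryset A B n)"
    by (rule countably_additive_sums)
       (use assms in \<open>auto simp: binaryset_def disjoint_family_on_def UN_binaryset_eq bounded_Un\<close>)
  moreover have "(\<lambda>n. \<sigma> (binaryset A B n)) sums (\<sigma> A + \<sigma> B)"
    by (rule binaryset_sums) (rule countably_additive_empty)
  ultimately show ?thesis by (simp add: UN_binaryset_eq sums_unique2)
qed

lemma countably_additive_Diff:
  assumes "A \<in> sets borel" "B \<in> sets borel" "B \<subseteq> A" "bounded A"
  shows "\<sigma> A = \<sigma> B + \<sigma> (A - B)"
proof -
  have "\<sigma> (B \<union> (A - B)) = \<sigma> B + \<sigma> (A - B)"
    by (rule countably_additive_Un) (use assms in \<open>auto intro: bounded_subset\<close>)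
  moreover have "B \<union> (A - B) = A" using assms by blast
  ultimately show ?thesis by simp
qed

text \<open>Values may cancel, so vanishing is assumed for all Borel subsets; it is applied to the
  disjoint pieces of the union.\<close>

lemma countably_additive_eq_0_Un:
  fixes A :: "nat \<Rightarrow> real set"
  assumes "\<And>n B. B \<in> sets borel \<Longrightarrow> B \<subseteq> A n \<Longrightarrow> \<sigma> B = 0" "\<And>n. A n \<in> sets borel" "bounded (\<Union>n. A n)"
  shows "\<sigma> (\<Union>n. A n) = 0"
proof -
  have "range (disjointed A) \<subseteq> sets borel" by (rule sets.range_disjointed_sets) (use assms in auto)
  then have "(\<lambda>n. \<sigma> (disjointed A n)) sums \<sigma> (\<Union>n. disjointed A n)"
    by (intro countably_additive_sums disjoint_family_disjointed)
       (use assms in \<open>auto simp: UN_disjointed_eq\<close>)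
  moreover have "\<sigma> (disjointed A n) = 0" for n
    using assms(1)[of "disjointed A n" n] \<open>range (disjointed A) \<subseteq> _\<close> disjointed_subset[of A n] by blast
  ultimately show ?thesis by (simp add: UN_disjointed_eq sums_iff)
qed

end

text \<open>If the values on subsets of S were unbounded, one could repeatedly cut a set into two,
  keep a part on which they are still unbounded and discard a part of value at least 1 in absolute
  value. The discarded parts are disjoint, and the series of their values would converge with terms
  not tending to 0.\<close>

lemma countably_additive_bounded:
  fixes \<sigma> :: "real set \<Rightarrow> real"
  assumes ca: "bounded_countably_additive \<sigma>" and S: "S \<in> sets borel" "bounded S"
  shows "\<exists>C. \<forall>B\<in>sets borel. B \<subseteq> S \<longrightarrow> \<bar>\<sigma> B\<bar> \<le> C"
proof (rule ccontr)
  define P where "P A \<longleftrightarrow> A \<in> sets borel \<and> A \<subseteq> S \<and> (\<forall>C. \<exists>B\<in>sets borel. B \<subseteq> A \<and> \<bar>\<sigma> B\<bar> > C)" for A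
  assume "\<not> ?thesis"
  then have PS: "P S" unfolding P_def using S by (auto simp: not_le)
  have step: "\<exists>A'. P A' \<and> A' \<subseteq> A \<and> \<bar>\<sigma> (A - A')\<bar> \<ge> 1" if A: "P A" for A
  proof -
    have bA: "bounded A" and mA: "A \<in> sets borel" using A S bounded_subset unfolding P_def by auto
    \<comment> \<open>The margin makes both B and \<open>A - B\<close> have value at least 1 in
      absolute value, so either may be discarded, and boundedness on both would give it on
      A.\<close>
    obtain B where B: "B \<in> sets borel" "B \<subseteq> A" "\<bar>\<sigma> B\<bar> > \<bar>\<sigma> A\<bar> + 1"
      using A unfolding P_def by blast
    have d: "\<sigma> A = \<sigma> B + \<sigma> (A - B)" by (rule countably_additive_Diff[OF ca mA B(1,2) bA])
    have AB: "A - B \<in> sets borel" "A - (A - B) = B" using B mA by auto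
    have "P B \<or> P (A - B)"
    proof (rule ccontr)
      assume n: "\<not> (P B \<or> P (A - B))"
      have bdd: "\<exists>C. \<forall>D\<in>sets borel. D \<subseteq> X \<longrightarrow> \<bar>\<sigma> D\<bar> \<le> C" if "X \<in> sets borel" "X \<subseteq> S" "\<not> P X" for X
        using that by (simp add: P_def not_less)
      have "A \<subseteq> S" using A P_def by auto
      then have "B \<subseteq> S" "A - B \<subseteq> S" using B by auto
      then obtain C1 C2 where C: "\<And>D. D \<in> sets borel \<Longrightarrow> D \<subseteq> B \<Longrightarrow> \<bar>\<sigma> D\<bar> \<le> C1"
        "\<And>D. D \<in> sets borel \<Longrightarrow> D \<subseteq> A - B \<Longrightarrow> \<bar>\<sigma> D\<bar> \<le> C2"
        using bdd[of B] bdd[of "A - B"] n B(1) AB(1) by meson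
      obtain D where D: "D \<in> sets borel" "D \<subseteq> A" "\<bar>\<sigma> D\<bar> > C1 + C2"
        using A unfolding P_def by blast
      have "\<sigma> D = \<sigma> (D \<inter> B) + \<sigma> (D - (D \<inter> B))"
        by (rule countably_additive_Diff[OF ca]) (use D B bA in \<open>auto intro: bounded_subset\<close>)
      moreover have "\<bar>\<sigma> (D \<inter> B)\<bar> \<le> C1" by (rule C) (use D B in auto)
      moreover have "\<bar>\<sigma> (D - (D \<inter> B))\<bar> \<le> C2" by (rule C) (use D B in auto)
      ultimately show False using D by linarith
    qed
    then show ?thesis
    proof
      assume "P B"
      moreover have "\<bar>\<sigma> (A - B)\<bar> \<ge> 1" using d B by linarith
      ultimately show ?thesis using B by blast
    next
      assume "P (A - B)"
      moreover have "\<bar>\<sigma> B\<bar> \<ge> 1" using B by linarith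
      ultimately show ?thesis using AB(2) by (intro exI[of _ "A - B"]) auto
    qed
  qed
  have "\<exists>f. \<forall>n::nat. P (f n) \<and> (f (Suc n) \<subseteq> f n \<and> \<bar>\<sigma> (f n - f (Suc n))\<bar> \<ge> 1)"
    by (rule dependent_nat_choice) (use PS step in auto)
  then obtain f where f: "\<And>n. P (f n)" "\<And>n. f (Suc n) \<subseteq> f n" "\<And>n. \<bar>\<sigma> (f n - f (Suc n))\<bar> \<ge> 1" by blast
  have dec: "f n \<subseteq> f m" if "m \<le> n" for m n
    using lift_Suc_antimono_le[of f] f(2) that by blast
  have disj: "(f m - f (Suc m)) \<inter> (f n - f (Suc n)) = {}" if "m < n" for m n
    using dec[of "Suc m" n] that by auto
  have "disjoint_family (\<lambda>n. f n - f (Suc n))"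
  unfolding disjoint_family_on_def
  proof (intro ballI impI)
    fix m n :: nat assume "m \<noteq> n"
    then show "(f m - f (Suc m)) \<inter> (f n - f (Suc n)) = {}"
      using disj[of m n] disj[of n m] by (cases "m < n") auto
  qed
  then have "(\<lambda>n. \<sigma> (f n - f (Suc n))) sums \<sigma> (\<Union>n. f n - f (Suc n))"
  proof (rule countably_additive_sums[OF ca, rotated])
    show "f n - f (Suc n) \<in> sets borel" for n using f(1) unfolding P_def by blast
    have "(\<Union>n. f n - f (Suc n)) \<subseteq> S" using f(1) unfolding P_def by blast
    then show "bounded (\<Union>n. f n - f (Suc n))" using S(2) bounded_subset by blast
  qed
  then have "(\<lambda>n. \<sigma> (f n - f (Suc n))) \<longlonglongrightarrow> 0"
    using sums_summable summable_LIMSEQ_zero by blast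
  then have "(\<lambda>n. \<bar>\<sigma> (f n - f (Suc n))\<bar>) \<longlonglongrightarrow> 0" by (rule tendsto_rabs_zero)
  then have "1 \<le> (0::real)" by (rule LIMSEQ_le_const) (use f(3) in auto)
  then show False by simp
qed

text \<open>\<open>ennreal\<close> sends negative numbers to 0 and is therefore only subadditive,
  which is the direction wanted.\<close>

lemma ennreal_sums_le_suminf:
  assumes "x sums s"
  shows "ennreal s \<le> (\<Sum>n. ennreal (x n))"
proof -
  have add: "ennreal (a + b) \<le> ennreal a + ennreal b" for a b :: real
  proof -
    have "ennreal (a + b) \<le> ennreal (max 0 a + max 0 b)" by (rule ennreal_leI) auto
    also have "\<dots> = ennreal (max 0 a) + ennreal (max 0 b)" by (rule ennreal_plus) auto
    also have "\<dots> = ennreal a + ennreal b" by (simp add: max_def ennreal_neg)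
    finally show ?thesis .
  qed
  have part: "ennreal (\<Sum>i<n. x i) \<le> (\<Sum>i<n. ennreal (x i))" for n
  proof (induction n)
    case (Suc n)
    then show ?case using add[of "\<Sum>i<n. x i" "x n"] by (simp add: order.trans[OF _ add_right_mono])
  qed simp
  have "(\<lambda>n. ennreal (\<Sum>i<n. x i)) \<longlonglongrightarrow> ennreal s"
    using assms by (intro tendsto_ennrealI) (simp add: sums_def)
  then show ?thesis
    by (rule LIMSEQ_le_const2) (use part in \<open>auto intro!: exI[of _ 0] order.trans[OF part] sum_le_suminf\<close>)
qed

section \<open>The positive part of the Jordan decomposition\<close>

context
  fixes \<sigma> :: "real set \<Rightarrow> real" and S :: "real set"
  assumes ca: "bounded_countably_additive \<sigma>" and S: "S \<in> sets borel" "bounded S"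
begin

lemma sigma_algebra_borel_subsets: "sigma_algebra S {A \<in> sets borel. A \<subseteq> S}"
proof -
  have "{A \<in> sets borel. A \<subseteq> S} = sets (restrict_space borel S)"
    using S by (auto simp: sets_restrict_space_iff)
  then show ?thesis using sets.sigma_algebra_axioms[of "restrict_space borel S"] by (simp add: space_restrict_space)
qed

text \<open>For subsets C of A and D of B the union competes in the supremum for
  \<open>A \<union> B\<close>. If one of the two values is negative, it counts as 0 and the other
  set competes alone.\<close>

lemma upper_variation_sup_superadditive:
  defines "V \<equiv> \<lambda>A. SUP B\<in>{B \<in> sets borel. B \<subseteq> A}. ennreal (\<sigma> B)"
  assumes "A \<inter> B = {}" "A \<union> B \<subseteq> S"
  shows "V A + V B \<le> V (A \<union> B)"
proof -
  have "ennreal (\<sigma> C) + ennreal (\<sigma> D) \<le> V (A \<union> B)" if C: "C \<in> sets borel" "C \<subseteq> A" and D: "D \<in> sets borel" "D \<subseteq> B" for C D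
  proof -
    consider "\<sigma> C < 0" | "\<sigma> D < 0" | "\<sigma> C \<ge> 0" "\<sigma> D \<ge> 0" by linarith
    then show ?thesis
    proof cases
      case 1
      then show ?thesis unfolding V_def using D by (auto simp: ennreal_neg intro!: SUP_upper)
    next
      case 2
      then show ?thesis unfolding V_def using C by (auto simp: ennreal_neg intro!: SUP_upper)
    next
      case 3
      have "bounded C" "bounded D" by (rule bounded_subset[OF S(2)]; use C D assms in blast)+
      then have "\<sigma> (C \<union> D) = \<sigma> C + \<sigma> D"
        by (intro countably_additive_Un[OF ca]) (use C D assms in auto)
      then have "ennreal (\<sigma> C) + ennreal (\<sigma> D) = ennreal (\<sigma> (C \<union> D))" using 3 by (simp add: ennreal_plus)
      also have "\<dots> \<le> V (A \<union> B)" unfolding V_def using C D by (intro SUP_upper) auto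
      finally show ?thesis .
    qed
  qed
  then have "(SUP C\<in>{C \<in> sets borel. C \<subseteq> A}. SUP D\<in>{D \<in> sets borel. D \<subseteq> B}. ennreal (\<sigma> C) + ennreal (\<sigma> D)) \<le> V (A \<union> B)"
    by (intro SUP_least) auto
  moreover have ne: "{D \<in> sets borel. D \<subseteq> X} \<noteq> {}" for X :: "real set" by auto
  ultimately show ?thesis
    unfolding V_def by (simp add: ennreal_SUP_add_right[symmetric, OF ne] ennreal_SUP_add_left[symmetric, OF ne])
qed

text \<open>The lower bound for the union follows from finite superadditivity and monotonicity, the
  upper bound by cutting each competitor B into the pieces \<open>B \<inter> A i\<close>.\<close>

lemma upper_variation_countably_additive:
  "countably_additive {A \<in> sets borel. A \<subseteq> S} (\<lambda>A. SUP B\<in>{B \<in> sets borel. B \<subseteq> A}. ennreal (\<sigma> B))"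
proof (rule countably_additiveI)
  define V where "V A = (SUP B\<in>{B \<in> sets borel. B \<subseteq> A}. ennreal (\<sigma> B))" for A
  fix A :: "nat \<Rightarrow> real set"
  assume A: "range A \<subseteq> {A \<in> sets borel. A \<subseteq> S}" "disjoint_family A"
    "(\<Union>i. A i) \<in> {A \<in> sets borel. A \<subseteq> S}"
  have mono: "V C \<le> V D" if "C \<subseteq> D" for C D
    unfolding V_def using that by (intro SUP_subset_mono) auto
  have "(\<Sum>i. V (A i)) \<le> V (\<Union>i. A i)"
  proof (rule suminf_le_const)
    fix N
    have "(\<Sum>i<N. V (A i)) \<le> V (\<Union>i<N. A i)"
    proof (induction N)
      case (Suc N)
      have "(\<Sum>i<Suc N. V (A i)) \<le> V (\<Union>i<N. A i) + V (A N)"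
        using Suc by (simp add: add_right_mono)
      also have "\<dots> \<le> V ((\<Union>i<N. A i) \<union> A N)"
        unfolding V_def
      proof (rule upper_variation_sup_superadditive)
        show "(\<Union>i<N. A i) \<inter> A N = {}"
        proof -
          have "A i \<inter> A N = {}" if "i < N" for i using A(2) that by (simp add: disjoint_family_on_def)
          then show ?thesis by blast
        qed
      qed (use A in auto)
      also have "(\<Union>i<N. A i) \<union> A N = (\<Union>i<Suc N. A i)" by (auto simp: lessThan_Suc)
      finally show ?case .
    qed simp
    also have "\<dots> \<le> V (\<Union>i. A i)" by (rule mono) auto
    finally show "(\<Sum>i<N. V (A i)) \<le> V (\<Union>i. A i)" .
  qed simp
  moreover have "V (\<Union>i. A i) \<le> (\<Sum>i. V (A i))"
    unfolding V_def[of "\<Union>i. A i"]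
  proof (rule SUP_least)
    fix B assume B: "B \<in> {B \<in> sets borel. B \<subseteq> (\<Union>i. A i)}"
    have e: "(\<Union>i. B \<inter> A i) = B" using B by auto
    have bB: "bounded B" by (rule bounded_subset[OF S(2)]) (use B A in blast)
    have "(\<lambda>i. \<sigma> (B \<inter> A i)) sums \<sigma> (\<Union>i. B \<inter> A i)"
    proof (rule countably_additive_sums[OF ca])
      show "B \<inter> A n \<in> sets borel" for n using A B by auto
      show "disjoint_family (\<lambda>i. B \<inter> A i)" using A(2) by (auto simp: disjoint_family_on_def)
    qed (simp only: e bB)
    then have "ennreal (\<sigma> B) \<le> (\<Sum>i. ennreal (\<sigma> (B \<inter> A i)))"
      unfolding e by (rule ennreal_sums_le_suminf)
    also have "\<dots> \<le> (\<Sum>i. V (A i))"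
      unfolding V_def using A B by (intro suminf_le SUP_upper) auto
    finally show "ennreal (\<sigma> B) \<le> (\<Sum>i. V (A i))" .
  qed
  ultimately show "(\<Sum>i. SUP B\<in>{B \<in> sets borel. B \<subseteq> A i}. ennreal (\<sigma> B)) = (SUP B\<in>{B \<in> sets borel. B \<subseteq> (\<Union>i. A i)}. ennreal (\<sigma> B))"
    unfolding V_def by (rule antisym)
qed

lemma sets_upper_variation: "sets (upper_variation S \<sigma>) = sets (restrict_space borel S)"
proof -
  have "sets (upper_variation S \<sigma>) = {A \<in> sets borel. A \<subseteq> S}"
    unfolding upper_variation_def
    by (subst sets_measure_of) (auto simp: sigma_algebra.sigma_sets_eq[OF sigma_algebra_borel_subsets])
  then show ?thesis using S by (auto simp: sets_restrict_space_iff)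
qed

lemma space_upper_variation: "space (upper_variation S \<sigma>) = S"
  unfolding upper_variation_def by (subst space_measure_of) auto

lemma emeasure_upper_variation:
  assumes "A \<in> sets borel" "A \<subseteq> S"
  shows "emeasure (upper_variation S \<sigma>) A = (SUP B\<in>{B \<in> sets borel. B \<subseteq> A}. ennreal (\<sigma> B))"
  unfolding upper_variation_def
proof (rule emeasure_measure_of_sigma[OF sigma_algebra_borel_subsets])
  have "{B. B \<in> sets borel \<and> B \<subseteq> {}} = {{} :: real set}" by auto
  then show "positive {A \<in> sets borel. A \<subseteq> S} (\<lambda>A. SUP B\<in>{B \<in> sets borel. B \<subseteq> A}. ennreal (\<sigma> B))"
    by (simp add: positive_def countably_additive_empty[OF ca])
qed (use assms upper_variation_countably_additive in auto)

lemma finite_measure_upper_variation: "finite_measure (upper_variation S \<sigma>)"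
proof (rule finite_measureI)
  obtain C where C: "\<And>B. B \<in> sets borel \<Longrightarrow> B \<subseteq> S \<Longrightarrow> \<bar>\<sigma> B\<bar> \<le> C"
    using countably_additive_bounded[OF ca S] by blast
  have "emeasure (upper_variation S \<sigma>) S \<le> ennreal C"
    unfolding emeasure_upper_variation[OF S(1) order.refl]
    by (rule SUP_least) (use C in \<open>auto intro!: ennreal_leI dest: abs_le_D1\<close>)
  then show "emeasure (upper_variation S \<sigma>) (space (upper_variation S \<sigma>)) \<noteq> \<infinity>"
    by (auto simp: space_upper_variation top_unique)
qed

lemma AE_upper_variation:
  assumes J: "J \<in> sets borel" and z: "\<And>B. B \<in> sets borel \<Longrightarrow> B \<subseteq> S - J \<Longrightarrow> \<sigma> B = 0"
  shows "AE t in upper_variation S \<sigma>. t \<in> J"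
proof (rule AE_I)
  have "emeasure (upper_variation S \<sigma>) (S - J) = (SUP B\<in>{B \<in> sets borel. B \<subseteq> S - J}. ennreal (\<sigma> B))"
    by (rule emeasure_upper_variation) (use S J in auto)
  also have "\<dots> \<le> 0" by (rule SUP_least) (use z in auto)
  finally show "emeasure (upper_variation S \<sigma>) (S - J) = 0" by simp
  show "S - J \<in> sets (upper_variation S \<sigma>)"
    using S J by (simp add: sets_upper_variation sets_restrict_space_iff)
qed (auto simp: space_upper_variation)

end

text \<open>The complement of the support is covered by open sets without mass. By Lindelof
  countably many suffice, which brings countable additivity into play.\<close>

lemma measure_eq_0_outside_support:
  assumes ca: "bounded_countably_additive \<mu>" and A: "A \<in> sets borel" "bounded A" "A \<inter> measure_support \<mu> = {}"
  shows "\<mu> A = 0"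
proof -
  define F where "F = {U. open U \<and> (\<forall>B\<in>sets borel. bounded B \<longrightarrow> B \<subseteq> U \<longrightarrow> \<mu> B = 0)}"
  have F: "\<exists>U\<in>F. t \<in> U" if "t \<in> A" for t
  proof -
    have "t \<notin> measure_support \<mu>" using that A(3) by blast
    then obtain U where "open U" "t \<in> U" "\<forall>B\<in>sets borel. \<not> (bounded B \<and> B \<subseteq> U \<and> \<mu> B \<noteq> 0)"
      by (auto simp: measure_support_def)
    then show ?thesis by (intro bexI[of _ U]) (auto simp: F_def)
  qed
  obtain F' where F': "F' \<subseteq> F" "countable F'" "\<Union>F' = \<Union>F"
    by (rule Lindelof[of F]) (auto simp: F_def)
  show ?thesis
  proof (cases "F' = {}")
    case True
    then have "\<Union>F = {}" using F' by simp
    then have "A = {}" using F by auto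
    then show ?thesis using countably_additive_empty[OF ca] by simp
  next
    case False
    define U where "U = from_nat_into F'"
    have U: "U n \<in> F" for n using from_nat_into[OF False] F' unfolding U_def by auto
    have "A = (\<Union>n. A \<inter> U n)"
    proof -
      have "(\<Union>n. U n) = \<Union>F'" unfolding U_def using range_from_nat_into[OF False F'(2)] by simp
      then have "A \<subseteq> (\<Union>n. U n)" using F F'(3) by auto
      then show ?thesis by auto
    qed
    moreover have "\<mu> (\<Union>n. A \<inter> U n) = 0"
    proof (rule countably_additive_eq_0_Un[OF ca])
      fix n B assume B: "B \<in> sets borel" "B \<subseteq> A \<inter> U n"
      then have "bounded B" using A(2) by (auto intro: bounded_subset)
      then show "\<mu> B = 0" using U[of n] B unfolding F_def by blast
    qed (use U A in \<open>auto simp: F_def calculation[symmetric]\<close>)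
    ultimately show ?thesis by simp
  qed
qed

lemma bounded_countably_additive_Re_Im:
  assumes "bounded_countably_additive \<mu>"
  shows "bounded_countably_additive (\<lambda>A. Re (\<mu> A))" "bounded_countably_additive (\<lambda>A. - Re (\<mu> A))"
    "bounded_countably_additive (\<lambda>A. Im (\<mu> A))" "bounded_countably_additive (\<lambda>A. - Im (\<mu> A))"
  using assms unfolding bounded_countably_additive_def
  by (auto intro!: sums_minus sums_Re sums_Im)

section \<open>Periodization\<close>

text \<open>The half-open periods partition the line, and the bounds \<open>B\<close> allow sum and
  integral to be exchanged. \<open>F\<close> is left unspecified at the multiples of
  \<open>2 * pi\<close>, a null set, because \<open>L_hat\<close> is a limit there.\<close>

lemma integral_unfold_periods:
  fixes F :: "real \<Rightarrow> complex" and H :: "nat \<Rightarrow> real \<Rightarrow> complex"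
  assumes H: "\<And>n. continuous_on {-pi..pi} (H n)"
    and B: "\<And>n t. t \<in> {-pi..pi} \<Longrightarrow> norm (H n t) \<le> B n" "summable B"
    and FH: "\<And>n t. - pi \<le> t \<Longrightarrow> t < pi \<Longrightarrow> t \<noteq> 0 \<Longrightarrow> F (t + 2 * pi * of_int (int_decode n)) = H n t"
  shows "(LINT \<xi>|lborel. F \<xi>) = integral {-pi..pi} (\<lambda>t. \<Sum>n. H n t)"
proof -
  define \<tau> where "\<tau> n = 2 * pi * real_of_int (int_decode n)" for n
  define h where "h n t = indicator {-pi..<pi} t *\<^sub>R H n t" for n t
  define f where "f n \<xi> = indicator {-pi..<pi} (\<xi> - \<tau> n) *\<^sub>R F \<xi>" for n \<xi>
  have hm [measurable]: "h n \<in> borel_measurable borel" for n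
    unfolding h_def by (rule borel_measurable_continuous_on_indicator)
       (auto intro: continuous_on_subset[OF H])
  have B0: "0 \<le> B n" for n using B(1)[of 0 n] by (auto intro: order.trans[OF norm_ge_zero])
  have h_le: "norm (h n t) \<le> indicator {-pi..pi} t * B n" for n t
    using B(1)[of t n] B0[of n] by (auto simp: h_def indicator_def)
  have h_int: "integrable lborel (h n)" for n
    by (rule Bochner_Integration.integrable_bound[of _ "\<lambda>t. indicator {-pi..pi} t * B n"])
       (use h_le order.trans[OF h_le abs_ge_self] in auto)
  \<comment> \<open>Outside one point each piece is a translate of \<open>h n\<close>; this gives
    measurability without any assumption on \<open>F\<close> at that point.\<close>
  have f_eq: "f n \<xi> = (if \<xi> = \<tau> n then F (\<tau> n) else h n (\<xi> - \<tau> n))" for n \<xi>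
    using FH[of "\<xi> - \<tau> n" n] by (auto simp: f_def h_def \<tau>_def indicator_def)
  have fm [measurable]: "f n \<in> borel_measurable borel" for n
    unfolding f_eq[abs_def] by measurable
  have hs_int: "integrable lborel (\<lambda>\<xi>. h n (\<xi> - \<tau> n))" for n
    using lborel_integrable_real_affine[OF h_int[of n], of 1 "- \<tau> n"] by (simp add: add.commute[of "- \<tau> n"])
  have fae: "AE \<xi> in lborel. f n \<xi> = h n (\<xi> - \<tau> n)" for n
    using AE_lborel_singleton[of "\<tau> n"] by eventually_elim (simp add: f_eq)
  have f_int: "integrable lborel (f n)" for n
    using integrable_cong_AE[of "f n" lborel "\<lambda>\<xi>. h n (\<xi> - \<tau> n)"] fae hs_int[of n] by auto
  have int_f: "integral\<^sup>L lborel (f n) = integral\<^sup>L lborel (h n)" for n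
  proof -
    have "integral\<^sup>L lborel (f n) = (LINT \<xi>|lborel. h n (\<xi> - \<tau> n))"
      using fae by (intro integral_cong_AE) auto
    also have "\<dots> = integral\<^sup>L lborel (h n)"
      using lborel_integral_real_affine[of 1 "h n" "- \<tau> n"] by (simp add: add.commute[of "- \<tau> n"])
    finally show ?thesis .
  qed
  have norm_int_h: "(LINT t|lborel. norm (h n t)) \<le> 2 * pi * B n" for n
  proof -
    have "(LINT t|lborel. norm (h n t)) \<le> (LINT t|lborel. indicator {-pi..pi} t * B n)"
      using h_le h_int by (intro integral_mono) auto
    then show ?thesis by simp
  qed
  have norm_int_f: "(LINT t|lborel. norm (f n t)) = (LINT t|lborel. norm (h n t))" for n
  proof -
    have "(LINT t|lborel. norm (f n t)) = (LINT \<xi>|lborel. norm (h n (\<xi> - \<tau> n)))"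
      using fae[of n] by (intro integral_cong_AE) (auto elim: eventually_mono)
    also have "\<dots> = (LINT t|lborel. norm (h n t))"
      using lborel_integral_real_affine[of 1 "\<lambda>t. norm (h n t)" "- \<tau> n"] by (simp add: add.commute[of "- \<tau> n"])
    finally show ?thesis .
  qed
  have sum_h: "summable (\<lambda>n. LINT t|lborel. norm (h n t))"
    by (rule summable_comparison_test'[OF summable_mult[OF B(2), of "2 * pi"]])
       (use norm_int_h in auto)
  \<comment> \<open>Every \<xi> lies in exactly one half-open period. The second conjunct stands
    below the implication and is released afterwards by taking \<open>Suc n\<close> for i.\<close>
  have "\<exists>n. \<forall>i. i \<noteq> n \<longrightarrow> f i \<xi> = 0 \<and> f n \<xi> = F \<xi>" for \<xi>
  proof -
    define m where "m = \<lfloor>(\<xi> + pi) / (2 * pi)\<rfloor>"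
    have iff: "- pi \<le> \<xi> - 2 * pi * of_int j \<and> \<xi> - 2 * pi * of_int j < pi \<longleftrightarrow> j = m" for j :: int
    proof -
      have "- pi \<le> \<xi> - 2 * pi * of_int j \<and> \<xi> - 2 * pi * of_int j < pi \<longleftrightarrow>
        of_int j \<le> (\<xi> + pi) / (2 * pi) \<and> (\<xi> + pi) / (2 * pi) < of_int j + 1"
        by (simp add: field_simps)
      then show ?thesis unfolding m_def by (simp add: floor_eq_iff[symmetric] eq_commute)
    qed
    have "f i \<xi> = (if int_decode i = m then F \<xi> else 0)" for i
      using iff[of "int_decode i"] by (simp add: f_def \<tau>_def indicator_def)
    moreover have "int_decode i = m \<longleftrightarrow> i = int_encode m" for i by auto
    ultimately show ?thesis by (intro exI[of _ "int_encode m"]) auto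
  qed
  then obtain N where N: "\<And>\<xi> i. i \<noteq> N \<xi> \<Longrightarrow> f i \<xi> = 0" "\<And>\<xi>. f (N \<xi>) \<xi> = F \<xi>"
    by (metis n_not_Suc_n)
  have F_sum: "(\<Sum>n. f n \<xi>) = F \<xi>" for \<xi>
    using suminf_finite[of "{N \<xi>}" "\<lambda>n. f n \<xi>"] N by simp
  have f_summ: "summable (\<lambda>n. norm (f n \<xi>))" for \<xi>
    by (rule summable_finite[of "{N \<xi>}"]) (use N in auto)
  have h_summ: "summable (\<lambda>n. norm (h n t))" for t
  proof (rule summable_comparison_test'[OF B(2)])
    fix n
    have "norm (h n t) \<le> B n"
    proof -
      have "indicator {-pi..pi} t * B n \<le> 1 * B n"
        by (intro mult_right_mono indicator_le_1 B0)
      then show ?thesis using h_le[of n t] by linarith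
    qed
    then show "norm (norm (h n t)) \<le> B n" by simp
  qed
  have c: "continuous_on {-pi..pi} (\<lambda>t. \<Sum>n. H n t)"
  proof (rule uniform_limit_theorem)
    show "uniform_limit {-pi..pi} (\<lambda>n t. \<Sum>i<n. H i t) (\<lambda>t. \<Sum>n. H n t) sequentially"
      by (rule Weierstrass_m_test[OF B(1) B(2)])
  qed (auto intro!: always_eventually continuous_on_sum H)
  have "(LINT \<xi>|lborel. F \<xi>) = (LINT \<xi>|lborel. (\<Sum>n. f n \<xi>))" by (simp add: F_sum)
  also have "\<dots> = (\<Sum>n. integral\<^sup>L lborel (f n))"
    by (rule integral_suminf) (use f_int f_summ sum_h norm_int_f in auto)
  also have "\<dots> = (\<Sum>n. integral\<^sup>L lborel (h n))" by (simp only: int_f)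
  also have "\<dots> = (LINT t|lborel. (\<Sum>n. h n t))"
    by (rule integral_suminf[symmetric]) (use h_int h_summ sum_h in auto)
  also have "\<dots> = (LBINT t:{-pi..pi}. (\<Sum>n. H n t))"
    unfolding set_lebesgue_integral_def
  proof (rule integral_cong_AE)
    show "(\<lambda>t. indicator {-pi..pi} t *\<^sub>R (\<Sum>n. H n t)) \<in> borel_measurable lborel"
      using borel_measurable_continuous_on_indicator[OF _ c] by simp
    show "AE t in lborel. (\<Sum>n. h n t) = indicator {-pi..pi} t *\<^sub>R (\<Sum>n. H n t)"
      using AE_lborel_singleton[of pi] by eventually_elim (auto simp: h_def indicator_def)
  qed measurable
  also have "\<dots> = integral {-pi..pi} (\<lambda>t. \<Sum>n. H n t)"
  proof (rule set_borel_integral_eq_integral)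
    show "set_integrable lborel {-pi..pi} (\<lambda>t. \<Sum>n. H n t)"
      unfolding set_integrable_def by (rule borel_integrable_compact[OF _ c]) simp
  qed
  finally show ?thesis .
qed

lemma jet_bounded_cis:
  assumes "open S"
  shows "jet_bounded N S (\<lambda>_. (1 + \<bar>x\<bar>) ^ N) (\<lambda>t. cis (x * t + y))"
proof (induction N)
  case 0
  show ?case by (auto intro!: continuous_intros)
next
  case (Suc N)
  have "jet_bounded N S (\<lambda>_. norm (\<i> * complex_of_real x) * (1 + \<bar>x\<bar>) ^ N) (\<lambda>t. \<i> * of_real x * cis (x * t + y))"
    by (rule jet_bounded_cmult[OF assms Suc])
  then have "jet_bounded N S (\<lambda>_. (1 + \<bar>x\<bar>) ^ Suc N) (\<lambda>t. \<i> * of_real x * cis (x * t + y))"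
    by (rule jet_bounded_mono) (auto simp: norm_mult intro!: mult_right_mono)
  then show ?case
  proof (rule jet_bounded_SucI[OF assms, rotated -1])
    fix t
    show "((\<lambda>t. cis (x * t + y)) has_vector_derivative \<i> * of_real x * cis (x * t + y)) (at t)"
      by (rule has_vector_derivative_cis_affine)
    have "1 \<le> (1 + \<bar>x\<bar>) ^ Suc N" by (rule one_le_power) simp
    then show "norm (cis (x * t + y)) \<le> (1 + \<bar>x\<bar>) ^ Suc N" by simp
  qed
qed

text \<open>
  \<open>\<rho> n t\<close> stands for \<open>phi_hat (t + 2\<pi>m) / phi_hat t\<close> with \<open>m = int_decode (Suc n)\<close>, which runs over
  the nonzero integers. So this is the \<open>2\<pi>\<close>-periodization of \<open>L_hat \<xi> * cis (x * \<xi>)\<close>.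
\<close>

definition periodization :: "(nat \<Rightarrow> real \<Rightarrow> real) \<Rightarrow> real \<Rightarrow> real \<Rightarrow> complex" where
  "periodization \<rho> x t =
     (cis (x * t) + (\<Sum>n. of_real (\<rho> n t) * cis (x * (t + 2 * pi * of_int (int_decode (Suc n)))))) *
     inverse (1 + (\<Sum>n. of_real (\<rho> n t)))"

text \<open>Subtracting \<open>cis (x * t)\<close> cancels the unshifted term: what remains is the
  sum of \<open>\<rho> n t * (e n t - cis (x * t))\<close> over the denominator, whence the factor
  \<open>suminf B\<close>. The denominator is at least 1 because the ratios are nonnegative. The
  phases of the translates do not affect the bounds, so x enters only through N derivatives of
  \<open>cis\<close>.\<close>

lemma jet_bounded_periodization_diff:
  "\<exists>K\<ge>0. \<forall>S \<rho> B x. open S \<longrightarrow> convex S \<longrightarrow>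
     (\<forall>n. jet_bounded N S (\<lambda>_. B n) (\<lambda>t. of_real (\<rho> n t))) \<longrightarrow> summable B \<longrightarrow>
     (\<forall>n. \<forall>t\<in>S. 0 \<le> \<rho> n t) \<longrightarrow>
     jet_bounded N S (\<lambda>_. K * suminf B * (1 + suminf B) ^ (2 ^ N - 1) * (1 + \<bar>x\<bar>) ^ N)
       (\<lambda>t. periodization \<rho> x t - cis (x * t))"
proof -
  obtain K where K: "K \<ge> 1" "\<And>S U l g. open S \<Longrightarrow> jet_bounded N S U g \<Longrightarrow> (\<forall>x\<in>S. 0 < l x \<and> l x \<le> norm (g x)) \<Longrightarrow>
    jet_bounded N S (\<lambda>x. K * U x ^ (2 ^ N - 1) / l x ^ (2 ^ N)) (\<lambda>x. inverse (g x))"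
    using jet_bounded_inverse[of N] by blast
  define K' where "K' = 2 ^ N * (2 ^ N * 2) * K"
  show ?thesis
  proof (intro exI[of _ K'] conjI allI impI)
    show "K' \<ge> 0" using K by (simp add: K'_def)
    fix S and \<rho> :: "nat \<Rightarrow> real \<Rightarrow> real" and B x
    assume S: "open S" "convex S" and J: "\<forall>n. jet_bounded N S (\<lambda>_. B n) (\<lambda>t. of_real (\<rho> n t))"
      and B: "summable B" and pos: "\<forall>n. \<forall>t\<in>S. 0 \<le> \<rho> n t"
    define e where "e n t = cis (x * t + x * (2 * pi * of_int (int_decode (Suc n))))" for n t
    define D where "D t = 1 + (\<Sum>n. complex_of_real (\<rho> n t))" for t
    define T where "T t = (\<Sum>n. of_real (\<rho> n t) * (e n t - cis (x * t + 0)))" for t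
    have le: "norm (complex_of_real (\<rho> n t)) \<le> B n" if "t \<in> S" for n t
      using jet_bounded_le[OF J[rule_format] that] by simp
    have summ: "summable (\<lambda>n. complex_of_real (\<rho> n t))" if "t \<in> S" for t
      by (rule summable_comparison_test'[OF B]) (use le[OF that] in auto)
    have summe: "summable (\<lambda>n. complex_of_real (\<rho> n t) * e n t)" if "t \<in> S" for t
      by (rule summable_comparison_test'[OF B]) (use le[OF that] in \<open>auto simp: norm_mult e_def\<close>)
    have jT: "jet_bounded N S (\<lambda>_. \<Sum>n. 2 ^ N * B n * ((1 + \<bar>x\<bar>) ^ N + (1 + \<bar>x\<bar>) ^ N)) T"
      unfolding T_def[abs_def]
    proof (rule jet_bounded_suminf[OF S])
      show "summable (\<lambda>n. 2 ^ N * B n * ((1 + \<bar>x\<bar>) ^ N + (1 + \<bar>x\<bar>) ^ N))"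
        by (intro summable_mult summable_mult2 B)
      show "jet_bounded N S (\<lambda>_. 2 ^ N * B n * ((1 + \<bar>x\<bar>) ^ N + (1 + \<bar>x\<bar>) ^ N)) (\<lambda>t. of_real (\<rho> n t) * (e n t - cis (x * t + 0)))" for n
        unfolding e_def using J by (intro jet_bounded_mult jet_bounded_diff jet_bounded_cis S) auto
    qed
    have sT: "(\<Sum>n. 2 ^ N * B n * ((1 + \<bar>x\<bar>) ^ N + (1 + \<bar>x\<bar>) ^ N)) = 2 ^ N * 2 * suminf B * (1 + \<bar>x\<bar>) ^ N"
    proof -
      have "(\<Sum>n. 2 ^ N * B n * ((1 + \<bar>x\<bar>) ^ N + (1 + \<bar>x\<bar>) ^ N)) = (\<Sum>n. (2 ^ N * 2 * (1 + \<bar>x\<bar>) ^ N) * B n)"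
        by (intro arg_cong[where f = suminf] ext) (simp add: mult_ac)
      also have "\<dots> = (2 ^ N * 2 * (1 + \<bar>x\<bar>) ^ N) * suminf B" by (rule suminf_mult[OF B])
      finally show ?thesis by (simp only: mult_ac)
    qed
    have jD: "jet_bounded N S (\<lambda>_. 1 + suminf B) D"
      unfolding D_def[abs_def]
      by (intro jet_bounded_add jet_bounded_const jet_bounded_suminf S B) (use J in auto)
    have D_eq: "D t = of_real (1 + (\<Sum>n. \<rho> n t))" and D_ge: "1 \<le> norm (D t)" if "t \<in> S" for t
    proof -
      have s: "summable (\<lambda>n. \<rho> n t)" by (rule summable_comparison_test'[OF B]) (use le[OF that] in auto)
      show eq: "D t = of_real (1 + (\<Sum>n. \<rho> n t))"
        unfolding D_def by (simp add: suminf_of_real[OF s])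
      have "0 \<le> (\<Sum>n. \<rho> n t)" using s pos that by (intro suminf_nonneg) auto
      then show "1 \<le> norm (D t)" unfolding eq norm_of_real by simp
    qed
    have jI: "jet_bounded N S (\<lambda>_. K * (1 + suminf B) ^ (2 ^ N - 1) / 1 ^ (2 ^ N)) (\<lambda>t. inverse (D t))"
      by (rule K(2)[OF S(1) jD]) (use D_ge in auto)
    have "jet_bounded N S (\<lambda>_. 2 ^ N * (2 ^ N * 2 * suminf B * (1 + \<bar>x\<bar>) ^ N) * (K * (1 + suminf B) ^ (2 ^ N - 1) / 1 ^ (2 ^ N))) (\<lambda>t. T t * inverse (D t))"
      using jet_bounded_mult[OF S(1) jT jI] unfolding sT .
    moreover have "2 ^ N * (2 ^ N * 2 * suminf B * (1 + \<bar>x\<bar>) ^ N) * (K * (1 + suminf B) ^ (2 ^ N - 1) / 1 ^ (2 ^ N)) =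
      K' * suminf B * (1 + suminf B) ^ (2 ^ N - 1) * (1 + \<bar>x\<bar>) ^ N"
      unfolding K'_def power_one div_by_1 by (simp only: mult_ac)
    ultimately have "jet_bounded N S (\<lambda>_. K' * suminf B * (1 + suminf B) ^ (2 ^ N - 1) * (1 + \<bar>x\<bar>) ^ N) (\<lambda>t. T t * inverse (D t))"
      by (simp only:)
    then show "jet_bounded N S (\<lambda>_. K' * suminf B * (1 + suminf B) ^ (2 ^ N - 1) * (1 + \<bar>x\<bar>) ^ N)
       (\<lambda>t. periodization \<rho> x t - cis (x * t))"
    proof (rule jet_bounded_cong[OF S(1), rotated])
      fix t assume t: "t \<in> S"
      have "D t \<noteq> 0" using D_ge[OF t] by auto
      have "T t = (\<Sum>n. of_real (\<rho> n t) * e n t - of_real (\<rho> n t) * cis (x * t))"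
        unfolding T_def by (simp add: right_diff_distrib)
      also have "\<dots> = (\<Sum>n. of_real (\<rho> n t) * e n t) - (\<Sum>n. of_real (\<rho> n t) * cis (x * t))"
        by (rule suminf_diff[symmetric, OF summe[OF t] summable_mult2[OF summ[OF t]]])
      also have "(\<Sum>n. of_real (\<rho> n t) * cis (x * t)) = (D t - 1) * cis (x * t)"
        unfolding D_def by (simp add: suminf_mult2[symmetric, OF summ[OF t]])
      finally have "T t = (cis (x * t) + (\<Sum>n. of_real (\<rho> n t) * e n t)) - cis (x * t) * D t"
        by (simp add: algebra_simps)
      then have "T t * inverse (D t) = (cis (x * t) + (\<Sum>n. of_real (\<rho> n t) * e n t)) * inverse (D t) - cis (x * t)"
        using \<open>D t \<noteq> 0\<close> by (simp add: left_diff_distrib)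
      then show "T t * inverse (D t) = periodization \<rho> x t - cis (x * t)"
        unfolding periodization_def D_def e_def distrib_left .
    qed
  qed
qed

section \<open>The ratios that belong to \<open>phi_hat\<close>\<close>

definition ratio_seq :: "real \<Rightarrow> real \<Rightarrow> real \<Rightarrow> nat \<Rightarrow> real \<Rightarrow> real" where
  "ratio_seq a q c n t = period_ratio a q c (int_decode (Suc n)) t"

lemma period_ratio_nonneg: "1 \<le> a \<Longrightarrow> 0 \<le> period_ratio a q c m t"
  using less_imp_le[OF bessel_Psi_pos[of a]] by (auto simp: period_ratio_def)

lemma infsum_int_eq_suminf:
  fixes g :: "int \<Rightarrow> 'a :: banach"
  assumes "summable (\<lambda>n. norm (g (int_decode (Suc n))))"
  shows "(\<Sum>\<^sub>\<infinity>m. g m) = g 0 + (\<Sum>n. g (int_decode (Suc n)))"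
proof -
  have s: "summable (\<lambda>n. norm (g (int_decode n)))"
    using assms by (subst (asm) summable_Suc_iff[of "\<lambda>n. norm (g (int_decode n))"])
  have "(\<Sum>\<^sub>\<infinity>m. g m) = (\<Sum>\<^sub>\<infinity>n. g (int_decode n))"
    by (rule infsum_reindex_bij_betw[symmetric, OF bij_int_decode])
  also have "\<dots> = (\<Sum>n. g (int_decode n))"
    by (rule infsumI, rule norm_summable_imp_has_sum[OF s]) (intro summable_sums summable_norm_cancel[OF s])
  also have "\<dots> = g 0 + (\<Sum>n. g (int_decode (Suc n)))"
    by (subst suminf_split_head[OF summable_norm_cancel[OF s]]) (simp add: int_decode_0)
  finally show ?thesis .
qed

lemma add_2pi_int_neq_0:
  assumes "- pi \<le> t" "t < pi" "t \<noteq> 0"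
  shows "t + 2 * pi * of_int m \<noteq> 0"
proof (cases "m = 0")
  case False
  have "1 \<le> \<bar>real_of_int m\<bar>" using False by linarith
  then have "2 * pi * 1 \<le> 2 * pi * \<bar>real_of_int m\<bar>" by (intro mult_left_mono) auto
  also have "\<dots> = \<bar>2 * pi * of_int m\<bar>" by (simp add: abs_mult)
  finally have "2 * pi \<le> \<bar>2 * pi * of_int m\<bar>" by simp
  moreover have "\<bar>t\<bar> \<le> pi" using assms by auto
  ultimately show ?thesis using pi_gt_zero by linarith
qed (use assms in simp)

text \<open>Numerator and denominator are both divided by \<open>phi_hat\<close> at t. Shifting the
  summation index by m shows that the denominator is common to all translates, and for nonzero t
  none of them is a multiple of \<open>2 * pi\<close>, so the limit in \<open>L_hat\<close> does not
  occur.\<close>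

lemma L_hat_eq_period_ratio:
  fixes \<alpha> c t :: real
  defines "a \<equiv> \<bar>\<alpha> + 1 / 2\<bar>" and "q \<equiv> \<alpha> + 1 / 2 + \<bar>\<alpha> + 1 / 2\<bar>"
  assumes \<alpha>: "\<alpha> \<notin> \<nat>" "1 \<le> a" and c: "c > 0" and t: "- pi \<le> t" "t < pi" "t \<noteq> 0"
    and summ: "summable (\<lambda>n. ratio_seq a q c n t)"
  shows "L_hat \<alpha> c (t + 2 * pi * of_int m) = period_ratio a q c m t / (1 + (\<Sum>n. ratio_seq a q c n t))"
proof -
  define \<kappa> where "\<kappa> = 2 powr (1 + \<alpha>) / Gamma (- \<alpha>) * c powr (\<alpha> + 1 / 2 - a) * 2 powr a / 2"
  \<comment> \<open>At its poles \<open>Gamma\<close> is 0 by convention; there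
    \<open>phi_hat\<close> would be identically 0.\<close>
  have "Gamma (- \<alpha>) \<noteq> 0"
  proof
    assume "Gamma (- \<alpha>) = 0"
    then have "- \<alpha> \<in> \<int>\<^sub>\<le>\<^sub>0" by (simp add: Gamma_eq_zero_iff)
    then show False using \<alpha>(1) by (auto elim!: nonpos_Ints_cases' simp: Nats_def)
  qed
  then have \<kappa>: "\<kappa> \<noteq> 0" using c by (simp add: \<kappa>_def)
  have phi: "phi_hat \<alpha> c \<xi> = \<kappa> * (\<bar>\<xi>\<bar> powr - q * bessel_Psi a 0 (c * \<xi>))" if "\<xi> \<noteq> 0" for \<xi>
    unfolding \<kappa>_def a_def q_def by (rule phi_hat_eq_bessel_Psi) (use c that \<alpha>(2) in \<open>auto simp: a_def\<close>)
  have Psi: "bessel_Psi a 0 y > 0" for y by (rule bessel_Psi_pos[OF \<alpha>(2)])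
  have ph0: "phi_hat \<alpha> c t \<noteq> 0" using phi[OF t(3)] \<kappa> Psi[of "c * t"] t by simp
  have ph: "phi_hat \<alpha> c (t + 2 * pi * of_int j) = phi_hat \<alpha> c t * period_ratio a q c j t" for j
  proof (cases "j = 0")
    case False
    have "(if q = 0 then 1 else \<bar>t\<bar> powr q) = \<bar>t\<bar> powr q" using t by simp
    moreover have "\<bar>t\<bar> powr - q * \<bar>t\<bar> powr q = 1" using t by (simp flip: powr_add)
    ultimately show ?thesis
      unfolding phi[OF add_2pi_int_neq_0[OF t]] phi[OF t(3)] period_ratio_def
      using False Psi[of "c * t"] by (simp add: field_simps)
  qed (simp add: period_ratio_def)
  have "(\<Sum>\<^sub>\<infinity>j. phi_hat \<alpha> c (t + 2 * pi * of_int m + 2 * pi * of_int j)) = (\<Sum>\<^sub>\<infinity>j. phi_hat \<alpha> c (t + 2 * pi * of_int (m + j)))"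
    by (intro infsum_cong) (simp add: algebra_simps)
  also have "\<dots> = (\<Sum>\<^sub>\<infinity>j. phi_hat \<alpha> c (t + 2 * pi * of_int j))"
    by (rule infsum_reindex_bij_betw[of "(+) m" UNIV UNIV "\<lambda>j. phi_hat \<alpha> c (t + 2 * pi * of_int j)"]) (rule bij_plus)
  also have "\<dots> = phi_hat \<alpha> c t * (\<Sum>\<^sub>\<infinity>j. period_ratio a q c j t)"
    unfolding ph by (rule infsum_cmult_right')
  also have "(\<Sum>\<^sub>\<infinity>j. period_ratio a q c j t) = 1 + (\<Sum>n. ratio_seq a q c n t)"
    using infsum_int_eq_suminf[of "\<lambda>j. period_ratio a q c j t"] period_ratio_nonneg[OF \<alpha>(2)] summ
    by (simp add: ratio_seq_def abs_of_nonneg period_ratio_def[of _ _ _ 0])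
  finally have "L_hat_quotient \<alpha> c (t + 2 * pi * of_int m) = period_ratio a q c m t / (1 + (\<Sum>n. ratio_seq a q c n t))"
    unfolding L_hat_quotient_def ph using ph0 by simp
  moreover have "\<not> (\<exists>j::int. t + 2 * pi * of_int m = 2 * pi * of_int j)"
  proof
    assume "\<exists>j::int. t + 2 * pi * of_int m = 2 * pi * of_int j"
    then obtain j :: int where "t + 2 * pi * of_int m = 2 * pi * of_int j" ..
    then have "t + 2 * pi * of_int (m - j) = 0" by (simp add: algebra_simps)
    then show False using add_2pi_int_neq_0[OF t] by blast
  qed
  ultimately show ?thesis unfolding L_hat_def by simp
qed

text \<open>For fixed c only summability is needed, so d = 1/2 will do even if the exponent makes
  the bound grow with c. This is the version that reaches beyond pi. The exponent q is
  \<open>2 * a\<close> or 0 according to the sign of \<open>\<alpha> + 1 / 2\<close>.\<close>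

lemma ratio_seq_bounds:
  fixes N :: nat and \<alpha> c :: real
  defines "a \<equiv> \<bar>\<alpha> + 1 / 2\<bar>" and "q \<equiv> \<alpha> + 1 / 2 + \<bar>\<alpha> + 1 / 2\<bar>"
  assumes a: "1 \<le> a" "real N < 2 * a" and c: "1 \<le> c" and A: "0 < A" "A < 2 * pi"
  shows "\<exists>B. summable B \<and> (\<forall>n. jet_bounded N {- A<..<A} (\<lambda>_. B n) (\<lambda>t. of_real (ratio_seq a q c n t)))"
proof -
  have q: "q = 0 \<or> real N < q" using a by (cases "0 \<le> \<alpha> + 1 / 2") (simp_all add: a_def q_def)
  define p where "p = (2::nat) ^ N - 1"
  obtain M where M: "\<And>c n. 1 \<le> c \<Longrightarrow> jet_bounded N {- A<..<A}
    (\<lambda>_. M * c ^ (N * Suc p) * exp (- (c * (2 * pi * (1 - 1/2) - (2 - 1/2 + 1/2 * p) * A))) *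
      exp (1 - \<bar>real_of_int (int_decode (Suc n))\<bar>))
    (\<lambda>t. of_real (period_ratio a q c (int_decode (Suc n)) t))"
    using jet_bounded_period_ratio_summable[OF a q A, of "1/2"] unfolding p_def by auto
  show ?thesis
    unfolding ratio_seq_def
    by (rule exI, rule conjI[rotated], rule allI, rule M[OF c]) (intro summable_mult summable_exp_int_decode)
qed

lemma ratio_seq_bounds_tendsto_0:
  fixes N :: nat and \<alpha> A :: real
  defines "a \<equiv> \<bar>\<alpha> + 1 / 2\<bar>" and "q \<equiv> \<alpha> + 1 / 2 + \<bar>\<alpha> + 1 / 2\<bar>"
  assumes a: "1 \<le> a" "real N < 2 * a" and A: "0 < A" "A < pi"
  shows "\<exists>B. (\<forall>c\<ge>1. summable (B c) \<and>
      (\<forall>n. jet_bounded N {- A<..<A} (\<lambda>_. B c n) (\<lambda>t. of_real (ratio_seq a q c n t)))) \<and>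
    ((\<lambda>c. suminf (B c)) \<longlongrightarrow> 0) at_top"
proof -
  have q: "q = 0 \<or> real N < q" using a by (cases "0 \<le> \<alpha> + 1 / 2") (simp_all add: a_def q_def)
  have A': "A < 2 * pi" using A by simp
  define p where "p = (2::nat) ^ N - 1"
  \<comment> \<open>The rate \<kappa> below equals
    \<open>2 * (pi - A) - d * (2 * pi + (1 + p) * A) + 2 * d * A\<close>; this choice bounds the
    subtracted term by \<open>pi - A\<close>.\<close>
  define d where "d = min (1 / 2) ((pi - A) / (2 * pi + (1 + p) * A))"
  have den: "0 < 2 * pi + (1 + p) * A" using A by (intro add_pos_nonneg) auto
  have d: "0 < d" "d \<le> 1 / 2" using A den by (simp add: d_def, simp only: d_def min.cobounded1)
  define \<kappa> where "\<kappa> = 2 * pi * (1 - d) - (2 - d + d * p) * A"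
  have "\<kappa> > 0"
  proof -
    have pos: "0 < k" if "X \<le> pi - A" "k = 2 * pi - 2 * A - X + 2 * Y" "0 < Y" for k X Y
      using that A by linarith
    have "d * (2 * pi + (1 + p) * A) \<le> pi - A"
      unfolding pos_le_divide_eq[OF den, symmetric] d_def by (rule min.cobounded2)
    moreover have "\<kappa> = 2 * pi - 2 * A - d * (2 * pi + (1 + p) * A) + 2 * (d * A)"
      by (simp add: \<kappa>_def algebra_simps)
    moreover have "0 < d * A" using d A by simp
    ultimately show ?thesis by (rule pos)
  qed
  obtain M where M: "\<And>c n. 1 \<le> c \<Longrightarrow> jet_bounded N {- A<..<A}
    (\<lambda>_. M * c ^ (N * Suc p) * exp (- (c * \<kappa>)) * exp (1 - \<bar>real_of_int (int_decode (Suc n))\<bar>))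
    (\<lambda>t. of_real (period_ratio a q c (int_decode (Suc n)) t))"
    using jet_bounded_period_ratio_summable[OF a q A(1) A', of d] d unfolding p_def \<kappa>_def by auto
  define B where "B c n = M * c ^ (N * Suc p) * exp (- (c * \<kappa>)) * exp (1 - \<bar>real_of_int (int_decode (Suc n))\<bar>)" for c n
  have sB: "summable (B c)" for c
    unfolding B_def by (intro summable_mult summable_exp_int_decode)
  have lim: "((\<lambda>c. c ^ (N * Suc p) * exp (- (c * \<kappa>))) \<longlongrightarrow> 0) at_top"
  proof -
    have "((\<lambda>y::real. y ^ (N * Suc p) / exp y) \<longlongrightarrow> 0) at_top" by (rule tendsto_power_div_exp_0)
    moreover have "filterlim (\<lambda>c. \<kappa> * c) at_top at_top"
      by (rule filterlim_tendsto_pos_mult_at_top[OF tendsto_const \<open>\<kappa> > 0\<close> filterlim_ident])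
    ultimately have "((\<lambda>c. (\<kappa> * c) ^ (N * Suc p) / exp (\<kappa> * c)) \<longlongrightarrow> 0) at_top"
      by (rule filterlim_compose)
    then have "((\<lambda>c. inverse (\<kappa> ^ (N * Suc p)) * ((\<kappa> * c) ^ (N * Suc p) / exp (\<kappa> * c))) \<longlongrightarrow> 0) at_top"
      by (rule tendsto_mult_right_zero)
    moreover have "inverse (\<kappa> ^ (N * Suc p)) * ((\<kappa> * c) ^ (N * Suc p) / exp (\<kappa> * c)) = c ^ (N * Suc p) * exp (- (c * \<kappa>))" for c
      using \<open>\<kappa> > 0\<close> by (simp add: power_mult_distrib exp_minus divide_inverse mult.commute[of c \<kappa>])
    ultimately show ?thesis by (simp only:)
  qed
  have "suminf (B c) = M * (\<Sum>n. exp (1 - \<bar>real_of_int (int_decode (Suc n))\<bar>)) * (c ^ (N * Suc p) * exp (- (c * \<kappa>)))" for c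
    unfolding B_def by (subst suminf_mult[OF summable_exp_int_decode]) (simp only: mult_ac)
  then have "((\<lambda>c. suminf (B c)) \<longlongrightarrow> 0) at_top"
    using tendsto_mult_right_zero[OF lim] by (simp only:)
  moreover have "jet_bounded N {- A<..<A} (\<lambda>_. B c n) (\<lambda>t. of_real (ratio_seq a q c n t))" if "1 \<le> c" for c n
    unfolding B_def ratio_seq_def by (rule M[OF that])
  ultimately show ?thesis using sB by (intro exI[of _ B]) simp
qed

text \<open>Poisson summation: the values \<open>L (x - j)\<close> are Fourier coefficients of the periodization.\<close>

lemma fcoeff_periodization:
  fixes \<alpha> c :: real
  defines "a \<equiv> \<bar>\<alpha> + 1 / 2\<bar>" and "q \<equiv> \<alpha> + 1 / 2 + \<bar>\<alpha> + 1 / 2\<bar>"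
  assumes \<alpha>: "\<alpha> \<notin> \<nat>" and a: "1 \<le> a" and c: "1 \<le> c"
  shows "fcoeff (periodization (ratio_seq a q c) x) j = fundamental_function \<alpha> c (x - of_int j)"
proof -
  define \<rho> where "\<rho> = ratio_seq a q c"
  \<comment> \<open>Any half-width strictly between pi and \<open>2 * pi\<close> would serve: the
    open interval has to contain the closed period.\<close>
  define S where "S = {- (3/2 * pi)<..<3/2 * pi}"
  have sub: "{-pi..pi} \<subseteq> S" 
  proof
    fix t assume "t \<in> {-pi..pi}"
    then have "- pi \<le> t" "t \<le> pi" by auto
    then have "- (3/2 * pi) < t" "t < 3/2 * pi" using pi_gt_zero by linarith+
    then show "t \<in> S" unfolding S_def by simp
  qed
  obtain B where B: "summable B" "\<And>n. jet_bounded 0 S (\<lambda>_. B n) (\<lambda>t. of_real (\<rho> n t))"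
    using ratio_seq_bounds[of \<alpha> 0 c "3/2 * pi"] a c unfolding a_def q_def \<rho>_def S_def by auto
  have \<rho>0: "0 \<le> \<rho> n t" for n t unfolding \<rho>_def ratio_seq_def by (rule period_ratio_nonneg[OF a])
  have \<rho>B: "\<rho> n t \<le> B n" if "t \<in> {-pi..pi}" for n t
    using jet_bounded_le[OF B(2), of t n] that sub by auto
  have summ: "summable (\<lambda>n. \<rho> n t)" if "t \<in> {-pi..pi}" for t
    by (rule summable_comparison_test'[OF B(1)]) (use \<rho>0 \<rho>B[OF that] in auto)
  define R where "R t = 1 + (\<Sum>n. \<rho> n t)" for t
  have R: "1 \<le> R t" if "t \<in> {-pi..pi}" for t
    unfolding R_def using suminf_nonneg[OF summ[OF that]] \<rho>0 by simp
  have c\<rho>: "continuous_on {-pi..pi} (\<rho> n)" for n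
  proof -
    have "continuous_on S (\<lambda>t. Re (of_real (\<rho> n t)))"
      by (rule continuous_on_Re[OF jet_bounded_continuous_on[OF B(2)]])
    then show ?thesis using sub by (auto intro: continuous_on_subset)
  qed
  have cR: "continuous_on {-pi..pi} R"
  proof -
    have "uniform_limit {-pi..pi} (\<lambda>n t. \<Sum>i<n. \<rho> i t) (\<lambda>t. \<Sum>n. \<rho> n t) sequentially"
      by (rule Weierstrass_m_test[OF _ B(1)]) (use \<rho>0 \<rho>B in auto)
    then have "continuous_on {-pi..pi} (\<lambda>t. \<Sum>n. \<rho> n t)"
      by (rule uniform_limit_theorem[rotated]) (auto intro!: always_eventually continuous_on_sum c\<rho>)
    then show ?thesis unfolding R_def by (intro continuous_intros)
  qed
  define r where "r n t = period_ratio a q c (int_decode n) t" for n t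
  have r_Suc: "r (Suc n) = \<rho> n" and r_0: "r 0 t = 1" for n t
    by (auto simp: r_def \<rho>_def ratio_seq_def period_ratio_def int_decode_0)
  have r0: "0 \<le> r n t" for n t unfolding r_def by (rule period_ratio_nonneg[OF a])
  have cr: "continuous_on {-pi..pi} (r n)" for n
    using c\<rho> by (cases n) (auto simp: r_Suc r_0[abs_def] continuous_on_const cong: continuous_on_cong)
  define B' where "B' n = (case n of 0 \<Rightarrow> 1 | Suc m \<Rightarrow> B m)" for n
  have rB: "r n t \<le> B' n" if "t \<in> {-pi..pi}" for n t
    using \<rho>B[OF that] by (cases n) (auto simp: r_Suc r_0 B'_def)
  have B': "summable B'"
    using B(1) summable_Suc_iff[of B'] by (simp add: B'_def)
  define F where "F \<xi> = of_real (L_hat \<alpha> c \<xi>) * exp (\<i> * of_real ((x - of_int j) * \<xi>))" for \<xi>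
  define H where "H n t = of_real (r n t / R t) * cis ((x - of_int j) * (t + 2 * pi * of_int (int_decode n)))" for n t
  have "(LINT \<xi>|lborel. F \<xi>) = integral {-pi..pi} (\<lambda>t. \<Sum>n. H n t)"
  proof (rule integral_unfold_periods[OF _ _ B'])
    show "continuous_on {-pi..pi} (H n)" for n
      unfolding H_def by (intro continuous_intros cr cR) (use R in force)
    show "norm (H n t) \<le> B' n" if t: "t \<in> {-pi..pi}" for n t
    proof -
      have "norm (H n t) = r n t / R t" using r0[of n t] R[OF t] by (simp add: H_def norm_mult norm_divide)
      also have "\<dots> \<le> r n t / 1" using r0[of n t] R[OF t] by (intro divide_left_mono) auto
      finally show ?thesis using rB[OF t, of n] by simp
    qed
    show "F (t + 2 * pi * of_int (int_decode n)) = H n t" if t: "- pi \<le> t" "t < pi" "t \<noteq> 0" for n t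
    proof -
      have "L_hat \<alpha> c (t + 2 * pi * of_int (int_decode n)) = r n t / R t"
        unfolding r_def R_def \<rho>_def a_def q_def
        by (rule L_hat_eq_period_ratio) (use \<alpha> a c t summ in \<open>auto simp: a_def q_def \<rho>_def\<close>)
      then show ?thesis by (simp add: F_def H_def cis_conv_exp)
    qed
  qed
  also have "\<dots> = integral {-pi..pi} (\<lambda>t. periodization \<rho> x t * cis (- of_int j * t))"
  proof (rule integral_cong)
    fix t assume t: "t \<in> {-pi..pi}"
    \<comment> \<open>An integer frequency does not notice a shift by a multiple of
      \<open>2 * pi\<close>, so the factor with j comes out of the sum over translates.\<close>
    have cis_eq: "cis ((x - of_int j) * (t + 2 * pi * of_int m)) = cis (x * (t + 2 * pi * of_int m)) * cis (- of_int j * t)" for m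
    proof -
      have "cis ((x - of_int j) * (t + 2 * pi * of_int m)) =
        cis (x * (t + 2 * pi * of_int m) + - of_int j * t + 2 * pi * of_int (- j * m))"
        by (rule arg_cong[where f = cis]) (simp add: algebra_simps)
      also have "\<dots> = cis (x * (t + 2 * pi * of_int m)) * cis (- of_int j * t) * cis (2 * pi * of_int (- j * m))"
        by (simp only: cis_mult)
      also have "cis (2 * pi * of_int (- j * m)) = 1" by (rule cis_multiple_2pi) simp
      finally show ?thesis by simp
    qed
    have sH: "summable (\<lambda>n. H n t)"
    proof (rule summable_comparison_test'[OF B'])
      fix n
      have "norm (H n t) = r n t / R t" using r0[of n t] R[OF t] by (simp add: H_def norm_mult norm_divide)
      also have "\<dots> \<le> r n t / 1" using r0[of n t] R[OF t] by (intro divide_left_mono) auto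
      finally show "norm (H n t) \<le> B' n" using rB[OF t, of n] by simp
    qed
    have RC: "1 + (\<Sum>n. complex_of_real (\<rho> n t)) = of_real (R t)"
      unfolding R_def by (simp add: suminf_of_real[OF summ[OF t]])
    define e where "e n = cis (x * (t + 2 * pi * of_int (int_decode n)))" for n
    have He: "H n t = (of_real (r n t) * e n) * (inverse (of_real (R t)) * cis (- of_int j * t))" for n
      unfolding H_def cis_eq e_def by (simp add: divide_inverse mult_ac)
    have se: "summable (\<lambda>n. of_real (\<rho> n t) * e (Suc n))"
      by (rule summable_comparison_test'[OF B(1)]) (use \<rho>0 \<rho>B[OF t] in \<open>auto simp: norm_mult e_def\<close>)
    have "(\<Sum>n. H n t) = H 0 t + (\<Sum>n. H (Suc n) t)"
      by (simp add: suminf_split_head[OF sH])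
    also have "\<dots> = (e 0 + (\<Sum>n. of_real (\<rho> n t) * e (Suc n))) * (inverse (of_real (R t)) * cis (- of_int j * t))"
      unfolding He r_Suc r_0 distrib_right suminf_mult2[OF se] by simp
    also have "\<dots> = periodization \<rho> x t * cis (- of_int j * t)"
      unfolding periodization_def RC by (simp add: e_def int_decode_0 mult_ac)
    finally show "(\<Sum>n. H n t) = periodization \<rho> x t * cis (- of_int j * t)" .
  qed
  finally show ?thesis
    unfolding fcoeff_def fundamental_function_def F_def \<rho>_def by simp
qed

section \<open>Iterated vector derivatives\<close>

lemma vderiv_cong:
  assumes "open U" "\<And>x. x \<in> U \<Longrightarrow> f x = g x" "x \<in> U"
  shows "vderiv f x = vderiv g x"
proof -
  have "(f has_vector_derivative d) (at x) \<longleftrightarrow> (g has_vector_derivative d) (at x)" for d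
    using has_vector_derivative_cong_open[of U f g, OF assms(1) _ assms(3)] has_vector_derivative_cong_open[of U g f, OF assms(1) _ assms(3)]
      assms(2) by auto
  then show ?thesis unfolding vderiv_def vector_derivative_def by simp
qed

lemma vderiv_funpow_cong:
  assumes "open U"
  shows "(\<And>x. x \<in> U \<Longrightarrow> f x = g x) \<Longrightarrow> x \<in> U \<Longrightarrow> (vderiv ^^ n) f x = (vderiv ^^ n) g x"
proof (induction n arbitrary: x)
  case (Suc n)
  then show ?case using vderiv_cong[OF assms, of "(vderiv ^^ n) f" "(vderiv ^^ n) g"] by simp
qed simp

text \<open>\<open>vector_derivative\<close> is a choice from the set of derivatives, so equality of
  these sets is enough and no differentiability has to be assumed.\<close>

lemma vderiv_shift: "vderiv (\<lambda>t. g (t + d)) = (\<lambda>t. vderiv g (t + d))"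
proof
  fix t
  have "((\<lambda>t. g (t + d)) has_vector_derivative D) (at t) \<longleftrightarrow> (g has_vector_derivative D) (at (t + d))" for D
    unfolding has_vector_derivative_at_iff_tendsto
  proof
    assume "((\<lambda>s. (g (s + d) - g (t + d)) / of_real (s - t)) \<longlongrightarrow> D) (at t)"
    from LIM_offset[OF this, of "- d"]
    show "((\<lambda>s. (g s - g (t + d)) / of_real (s - (t + d))) \<longlongrightarrow> D) (at (t + d))"
      by (simp add: diff_diff_eq add.commute)
  next
    assume "((\<lambda>s. (g s - g (t + d)) / of_real (s - (t + d))) \<longlongrightarrow> D) (at (t + d))"
    from LIM_offset[OF this, of d]
    show "((\<lambda>s. (g (s + d) - g (t + d)) / of_real (s - t)) \<longlongrightarrow> D) (at t)"
      by simp
  qed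
  then show "vderiv (\<lambda>t. g (t + d)) t = vderiv g (t + d)" unfolding vderiv_def vector_derivative_def by simp
qed

lemma vderiv_funpow_shift: "(vderiv ^^ n) (\<lambda>t. g (t + d)) = (\<lambda>t. (vderiv ^^ n) g (t + d))"
  by (induction n) (simp_all add: vderiv_shift[of "(vderiv ^^ _) g"])

lemma vderiv_funpow_cis: "(vderiv ^^ n) (\<lambda>t. cis (x * t)) = (\<lambda>t. (\<i> * of_real x) ^ n * cis (x * t))"
proof (induction n)
  case (Suc n)
  have "((\<lambda>t. (\<i> * of_real x) ^ n * cis (x * t)) has_vector_derivative (\<i> * of_real x) ^ n * (\<i> * of_real x * cis (x * t))) (at t)" for t
    using has_vector_derivative_cis_affine[of x 0] by (intro has_vector_derivative_mult_right) simp
  from vderiv_eq[OF this] Suc show ?case by (auto simp: mult_ac)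
qed simp

lemma vderiv_funpow_diff:
  assumes S: "open S"
  shows "jet_bounded n S b f \<Longrightarrow> jet_bounded n S b' g \<Longrightarrow> t \<in> S \<Longrightarrow>
    (vderiv ^^ n) (\<lambda>x. f x - g x) t = (vderiv ^^ n) f t - (vderiv ^^ n) g t"
proof (induction n arbitrary: f g)
  case (Suc n)
  have "vderiv (\<lambda>x. f x - g x) s = vderiv f s - vderiv g s" if "s \<in> S" for s
    by (rule vderiv_eq) (use Suc.prems that in \<open>auto intro!: has_vector_derivative_diff has_vector_derivative_vderiv\<close>)
  then have "(vderiv ^^ n) (vderiv (\<lambda>x. f x - g x)) t = (vderiv ^^ n) (\<lambda>x. vderiv f x - vderiv g x) t"
    using Suc.prems(3) by (intro vderiv_funpow_cong[OF S]) auto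
  also have "\<dots> = (vderiv ^^ n) (vderiv f) t - (vderiv ^^ n) (vderiv g) t"
    by (rule Suc.IH) (use Suc.prems in auto)
  finally show ?case by (simp only: funpow_Suc_right o_apply)
qed simp

text \<open>Numerator and denominator of the periodization are sums over all integers m, the latter
  being the former for frequency 0. A shift by \<open>2 * pi\<close> moves m by one and multiplies
  both by the same \<open>z = W t / W (t + 2 * pi)\<close>, which cancels.\<close>

lemma periodization_shift:
  fixes a q c :: real
  defines "\<rho> \<equiv> ratio_seq a q c"
  assumes a: "1 \<le> a" and t: "t \<noteq> 0" "t + 2 * pi \<noteq> 0"
    and s: "summable (\<lambda>n. \<rho> n t)" "summable (\<lambda>n. \<rho> n (t + 2 * pi))"
  shows "periodization \<rho> x (t + 2 * pi) = periodization \<rho> x t"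
proof -
  define W where "W \<xi> = \<bar>\<xi>\<bar> powr - q * bessel_Psi a 0 (c * \<xi>)" for \<xi>
  define h where "h y m s = complex_of_real (period_ratio a q c m s) * cis (y * (s + 2 * pi * of_int m))" for y m s
  have pr: "period_ratio a q c m s = W (s + 2 * pi * of_int m) / W s" and W: "W s > 0" if "s \<noteq> 0" for m s
  proof -
    show "W s > 0" unfolding W_def using that bessel_Psi_pos[OF a] by simp
    have "\<bar>s\<bar> powr - q * \<bar>s\<bar> powr q = 1" using that by (simp flip: powr_add)
    then have inv: "\<bar>s\<bar> powr q = 1 / \<bar>s\<bar> powr - q" using that by (simp add: nonzero_eq_divide_eq mult.commute)
    have "(if q = 0 then 1 else \<bar>s\<bar> powr q) = \<bar>s\<bar> powr q" using that by simp
    then show "period_ratio a q c m s = W (s + 2 * pi * of_int m) / W s"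
    proof (cases "m = 0")
      case True
      then show ?thesis using \<open>W s > 0\<close> by (simp add: period_ratio_def)
    next
      case False
      then show ?thesis
        using \<open>W s > 0\<close> that unfolding period_ratio_def \<open>(if q = 0 then _ else _) = _\<close> inv by (simp add: W_def)
    qed
  qed
  have num: "cis (y * s) + (\<Sum>n. of_real (\<rho> n s) * cis (y * (s + 2 * pi * of_int (int_decode (Suc n))))) = (\<Sum>\<^sub>\<infinity>m. h y m s)"
    if "summable (\<lambda>n. \<rho> n s)" for y s
  proof -
    have "norm (h y m s) = period_ratio a q c m s" for m
      using period_ratio_nonneg[OF a, of q c m s] by (simp add: h_def norm_mult)
    then have "summable (\<lambda>n. norm (h y (int_decode (Suc n)) s))"
      using that by (simp add: \<rho>_def ratio_seq_def)
    from infsum_int_eq_suminf[OF this] show ?thesis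
      by (simp add: h_def \<rho>_def ratio_seq_def period_ratio_def[of _ _ _ 0])
  qed
  have per: "periodization \<rho> x s = (\<Sum>\<^sub>\<infinity>m. h x m s) * inverse (\<Sum>\<^sub>\<infinity>m. h 0 m s)" if "summable (\<lambda>n. \<rho> n s)" for s
    unfolding periodization_def num[OF that, symmetric] by simp
  define z where "z = complex_of_real (W t / W (t + 2 * pi))"
  have z: "z \<noteq> 0" using W[OF t(1)] W[OF t(2)] by (simp add: z_def)
  have "(\<Sum>\<^sub>\<infinity>m. h y m (t + 2 * pi)) = z * (\<Sum>\<^sub>\<infinity>m. h y m t)" for y
  proof -
    have "h y m (t + 2 * pi) = z * h y (m + 1) t" for m
    proof -
      have e: "t + 2 * pi + 2 * pi * of_int m = t + 2 * pi * of_int (m + 1)" by (simp add: algebra_simps)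
      show ?thesis
        unfolding h_def pr[OF t(1)] pr[OF t(2)] e z_def using W[OF t(1)] W[OF t(2)]
        by (simp add: field_simps)
    qed
    then have "(\<Sum>\<^sub>\<infinity>m. h y m (t + 2 * pi)) = z * (\<Sum>\<^sub>\<infinity>m. h y (m + 1) t)"
      by (simp add: infsum_cmult_right')
    also have "(\<Sum>\<^sub>\<infinity>m. h y (m + 1) t) = (\<Sum>\<^sub>\<infinity>m. h y m t)"
      using infsum_reindex_bij_betw[OF bij_plus[of 1], of "\<lambda>m. h y m t"] by (simp add: add.commute)
    finally show ?thesis .
  qed
  then show ?thesis unfolding per[OF s(1)] per[OF s(2)] using z by (simp add: field_simps)
qed

lemma jet_bounded_periodization:
  assumes "open S" "convex S" "\<And>n. jet_bounded N S (\<lambda>_. B n) (\<lambda>t. of_real (\<rho> n t))" "summable B"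
    "\<And>n t. 0 \<le> \<rho> n t"
  shows "\<exists>C. jet_bounded N S (\<lambda>_. C) (periodization \<rho> x)"
proof -
  obtain K where K: "K \<ge> 0" and H: "\<forall>S \<rho> B x. open S \<longrightarrow> convex S \<longrightarrow>
     (\<forall>n. jet_bounded N S (\<lambda>_. B n) (\<lambda>t. of_real (\<rho> n t))) \<longrightarrow> summable B \<longrightarrow>
     (\<forall>n. \<forall>t\<in>S. 0 \<le> \<rho> n t) \<longrightarrow>
     jet_bounded N S (\<lambda>_. K * suminf B * (1 + suminf B) ^ (2 ^ N - 1) * (1 + \<bar>x\<bar>) ^ N)
       (\<lambda>t. periodization \<rho> x t - cis (x * t))"
    using jet_bounded_periodization_diff[of N] by (elim exE conjE) (rule that)
  have "jet_bounded N S (\<lambda>_. K * suminf B * (1 + suminf B) ^ (2 ^ N - 1) * (1 + \<bar>x\<bar>) ^ N)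
       (\<lambda>t. periodization \<rho> x t - cis (x * t))"
    by (rule H[rule_format, OF assms])
  from jet_bounded_add[OF assms(1) this jet_bounded_cis[OF assms(1), of N x 0]]
  show ?thesis by auto
qed

text \<open>The factor \<open>(\<i> * j) ^ k\<close> belongs to the coefficients of the k-th
  derivative; one derivative more makes these absolutely summable, hence \<open>Suc k\<close>.
  Integration by parts needs the derivatives to agree at both ends of the period, which follows from
  periodicity near \<open>- pi\<close>.\<close>

lemma periodization_fourier_series:
  fixes \<alpha> c x :: real and k :: nat
  defines "a \<equiv> \<bar>\<alpha> + 1 / 2\<bar>" and "q \<equiv> \<alpha> + 1 / 2 + \<bar>\<alpha> + 1 / 2\<bar>"
  assumes \<alpha>: "\<alpha> \<notin> \<nat>" and a: "1 \<le> a" "real (Suc k) < 2 * a" and c: "1 \<le> c"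
  shows "(\<lambda>j. norm ((\<i> * of_int j) ^ k * fundamental_function \<alpha> c (x - of_int j))) summable_on UNIV"
    and "- pi < t \<Longrightarrow> t < pi \<Longrightarrow>
      (\<Sum>\<^sub>\<infinity>j. (\<i> * of_int j) ^ k * fundamental_function \<alpha> c (x - of_int j) * cis (of_int j * t)) =
      (vderiv ^^ k) (periodization (ratio_seq a q c) x) t"
proof -
  define S where "S = {- (3/2 * pi)<..<3/2 * pi}"
  define Q where "Q = periodization (ratio_seq a q c) x"
  have S: "open S" "convex S" by (auto simp: S_def)
  have sub: "{-pi..pi} \<subseteq> S"
  proof
    fix t assume "t \<in> {-pi..pi}"
    then have "- pi \<le> t" "t \<le> pi" by auto
    then have "- (3/2 * pi) < t" "t < 3/2 * pi" using pi_gt_zero by linarith+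
    then show "t \<in> S" unfolding S_def by simp
  qed
  obtain B where B: "summable B" "\<And>n. jet_bounded (Suc k) S (\<lambda>_. B n) (\<lambda>t. of_real (ratio_seq a q c n t))"
    using ratio_seq_bounds[of \<alpha> "Suc k" c "3/2 * pi"] a c unfolding a_def q_def S_def by auto
  have \<rho>0: "0 \<le> ratio_seq a q c n t" for n t unfolding ratio_seq_def by (rule period_ratio_nonneg[OF a(1)])
  have summ: "summable (\<lambda>n. ratio_seq a q c n t)" if "t \<in> S" for t
    by (rule summable_comparison_test'[OF B(1)]) (use jet_bounded_le[OF B(2) that] in auto)
  obtain C where C: "jet_bounded (Suc k) S (\<lambda>_. C) Q"
    using jet_bounded_periodization[OF S B(2,1) \<rho>0] unfolding Q_def by blast
  have J: "jet_bounded (Suc (k - i)) S (\<lambda>_. C) ((vderiv ^^ i) Q)" if "i \<le> k" for i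
    using jet_bounded_nth[OF C, of i] that by (simp add: Suc_diff_le del: jet_bounded.simps)
  have D: "((vderiv ^^ i) Q has_vector_derivative (vderiv ^^ Suc i) Q t) (at t)" if "i \<le> k" "t \<in> {-pi..pi}" for i t
    using J[OF that(1)] sub that(2) by (auto intro!: has_vector_derivative_vderiv)
  have cont: "continuous_on {-pi..pi} ((vderiv ^^ Suc i) Q)" if "i \<le> k" for i
    using jet_bounded_continuous_on[of "k - i" S "\<lambda>_. C" "(vderiv ^^ Suc i) Q"] J[OF that] sub
    by (auto intro: continuous_on_subset)
  have ends: "(vderiv ^^ i) Q (- pi) = (vderiv ^^ i) Q pi" for i
  proof -
    \<comment> \<open>A neighbourhood of \<open>- pi\<close> such that both it and its translate by
      \<open>2 * pi\<close> lie in S and avoid 0.\<close>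
    define U where "U = {- (3/2 * pi)<..<- (pi / 2)}"
    have "(vderiv ^^ i) (\<lambda>t. Q (t + 2 * pi)) (- pi) = (vderiv ^^ i) Q (- pi)"
    proof (rule vderiv_funpow_cong[of U])
      show "open U" "- pi \<in> U" using pi_gt_zero by (auto simp: U_def)
      fix t assume "t \<in> U"
      then have t: "- (3/2 * pi) < t" "t < - (pi / 2)" by (auto simp: U_def)
      then have t0: "t < 0" "0 < t + 2 * pi" using pi_gt_zero by linarith+
      have tS: "t \<in> S" "t + 2 * pi \<in> S" using t pi_gt_zero unfolding S_def greaterThanLessThan_iff by linarith+
      show "Q (t + 2 * pi) = Q t"
        unfolding Q_def by (rule periodization_shift[OF a(1)]) (use t0 summ[OF tS(1)] summ[OF tS(2)] in auto)
    qed
    then show ?thesis by (simp add: vderiv_funpow_shift)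
  qed
  have fc: "fcoeff ((vderiv ^^ i) Q) j = (\<i> * of_int j) ^ i * fundamental_function \<alpha> c (x - of_int j)" if "i \<le> k" for i j
    using that
  proof (induction i)
    case 0
    show ?case
      using fcoeff_periodization[of \<alpha> c x j] \<alpha> a c unfolding Q_def a_def q_def by simp
  next
    case (Suc i)
    have "fcoeff ((vderiv ^^ Suc i) Q) j = \<i> * of_int j * fcoeff ((vderiv ^^ i) Q) j"
      by (rule fcoeff_deriv[OF D cont ends]) (use Suc.prems in auto)
    then show ?case using Suc by (simp add: mult_ac)
  qed
  show "(\<lambda>j. norm ((\<i> * of_int j) ^ k * fundamental_function \<alpha> c (x - of_int j))) summable_on UNIV"
    using fcoeff_summable[OF D cont ends, of k] by (simp add: fc)
  show "(\<Sum>\<^sub>\<infinity>j. (\<i> * of_int j) ^ k * fundamental_function \<alpha> c (x - of_int j) * cis (of_int j * t)) =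
      (vderiv ^^ k) (periodization (ratio_seq a q c) x) t" if "- pi < t" "t < pi"
    using fourier_series_eq[OF D cont ends that, of k] unfolding Q_def[symmetric] by (simp add: fc)
qed

text \<open>The dependence on x is kept as the explicit factor
  \<open>(1 + \<bar>x\<bar>) ^ k\<close>: it is bounded on compact sets, and equal to 1 for k = 0,
  which accounts for both modes of convergence.\<close>

lemma vderiv_periodization_error:
  fixes \<alpha> A :: real and k :: nat
  defines "a \<equiv> \<bar>\<alpha> + 1 / 2\<bar>" and "q \<equiv> \<alpha> + 1 / 2 + \<bar>\<alpha> + 1 / 2\<bar>"
  assumes a: "1 \<le> a" "real k < 2 * a" and A: "0 < A" "A < pi"
  shows "\<exists>\<beta>. (\<beta> \<longlongrightarrow> 0) at_top \<and> (\<forall>c\<ge>1. 0 \<le> \<beta> c \<and> (\<forall>x. \<forall>t\<in>{- A<..<A}.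
    norm ((vderiv ^^ k) (periodization (ratio_seq a q c) x) t - (\<i> * of_real x) ^ k * cis (x * t)) \<le> \<beta> c * (1 + \<bar>x\<bar>) ^ k))"
proof -
  define S where "S = {- A<..<A}"
  have S: "open S" "convex S" "0 \<in> S" using A by (auto simp: S_def)
  obtain B where B: "\<And>c. 1 \<le> c \<Longrightarrow> summable (B c)"
    "\<And>c n. 1 \<le> c \<Longrightarrow> jet_bounded k S (\<lambda>_. B c n) (\<lambda>t. of_real (ratio_seq a q c n t))"
    "((\<lambda>c. suminf (B c)) \<longlongrightarrow> 0) at_top"
    using ratio_seq_bounds_tendsto_0[of \<alpha> k A] a A unfolding a_def q_def S_def by auto
  have \<rho>0: "0 \<le> ratio_seq a q c n t" for c n t unfolding ratio_seq_def by (rule period_ratio_nonneg[OF a(1)])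
  obtain K where K: "K \<ge> 0" and H: "\<forall>S \<rho> B x. open S \<longrightarrow> convex S \<longrightarrow>
     (\<forall>n. jet_bounded k S (\<lambda>_. B n) (\<lambda>t. of_real (\<rho> n t))) \<longrightarrow> summable B \<longrightarrow>
     (\<forall>n. \<forall>t\<in>S. 0 \<le> \<rho> n t) \<longrightarrow>
     jet_bounded k S (\<lambda>_. K * suminf B * (1 + suminf B) ^ (2 ^ k - 1) * (1 + \<bar>x\<bar>) ^ k)
       (\<lambda>t. periodization \<rho> x t - cis (x * t))"
    using jet_bounded_periodization_diff[of k] by (elim exE conjE) (rule that)
  have JK: "jet_bounded k S (\<lambda>_. K * suminf (B c) * (1 + suminf (B c)) ^ (2 ^ k - 1) * (1 + \<bar>x\<bar>) ^ k)
       (\<lambda>t. periodization (ratio_seq a q c) x t - cis (x * t))" if "1 \<le> c" for c x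
    by (rule H[rule_format, OF S(1,2) B(2)[OF that] B(1)[OF that] \<rho>0])
  define \<beta> where "\<beta> c = K * suminf (B c) * (1 + suminf (B c)) ^ (2 ^ k - 1)" for c
  have "(\<beta> \<longlongrightarrow> K * 0 * (1 + 0) ^ (2 ^ k - 1)) at_top"
    unfolding \<beta>_def by (intro tendsto_intros B(3))
  then have "(\<beta> \<longlongrightarrow> 0) at_top" by simp
  moreover have "0 \<le> \<beta> c" if c: "1 \<le> c" for c
  proof -
    have "0 \<le> B c n" for n using jet_bounded_le[OF B(2)[OF c] S(3), of n] by (auto intro: order.trans[OF norm_ge_zero])
    then have "0 \<le> suminf (B c)" using B(1)[OF c] by (intro suminf_nonneg) auto
    then show ?thesis using K by (simp add: \<beta>_def)
  qed
  moreover have "norm ((vderiv ^^ k) (periodization (ratio_seq a q c) x) t - (\<i> * of_real x) ^ k * cis (x * t)) \<le> \<beta> c * (1 + \<bar>x\<bar>) ^ k"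
    if c: "1 \<le> c" and t: "t \<in> S" for c x t
  proof -
    \<comment> \<open>\<open>C\<close> may depend on c and x; it only certifies the
      differentiability needed to split the derivative of the difference.\<close>
    obtain C where C: "jet_bounded k S (\<lambda>_. C) (periodization (ratio_seq a q c) x)"
      using jet_bounded_periodization[OF S(1,2) B(2,1)[OF c] \<rho>0] by blast
    have "jet_bounded (k - k) S (\<lambda>_. \<beta> c * (1 + \<bar>x\<bar>) ^ k) ((vderiv ^^ k) (\<lambda>t. periodization (ratio_seq a q c) x t - cis (x * t)))"
      unfolding \<beta>_def by (rule jet_bounded_nth[OF JK[OF c]]) simp
    from jet_bounded_le[OF this t]
    show ?thesis
      using vderiv_funpow_diff[OF S(1) C jet_bounded_cis[OF S(1), of k x 0, simplified] t] by (simp add: vderiv_funpow_cis)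
  qed
  ultimately show ?thesis unfolding S_def by blast
qed

text \<open>Absolute summability of T and finiteness of M justify the interchange. It also shows
  that the series obtained, which will be the one in the interpolant, converges
  unconditionally.\<close>

lemma finite_measure_series_integral:
  fixes T :: "int \<Rightarrow> complex" and M :: "real measure"
  assumes M: "finite_measure M" "sets M = sets (restrict_space borel S)"
    and T: "(\<lambda>j. norm (T j)) summable_on UNIV"
  shows "((\<lambda>j. T j * (LINT t|M. cis (- of_int j * t))) has_sum (LINT t|M. (\<Sum>\<^sub>\<infinity>j. T j * cis (- of_int j * t)))) UNIV"
    and "integrable M (\<lambda>t. \<Sum>\<^sub>\<infinity>j. T j * cis (- of_int j * t))"
proof -
  interpret finite_measure M by (rule M)
  have meas: "g \<in> borel_measurable M" if "g \<in> borel_measurable borel" for g :: "real \<Rightarrow> complex"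
    using measurable_restrict_space1[OF that] measurable_cong_sets[OF M(2) refl] by blast
  have cm: "(\<lambda>t. cis (y * t)) \<in> borel_measurable borel" for y
    by (intro borel_measurable_continuous_onI continuous_intros)
  define g where "g n t = T (int_decode n) * cis (- of_int (int_decode n) * t)" for n t
  have g_int: "integrable M (g n)" for n
  proof (rule integrable_const_bound[where B = "norm (T (int_decode n))"])
    show "g n \<in> borel_measurable M"
      unfolding g_def[abs_def] by (intro meas borel_measurable_times borel_measurable_const cm)
  qed (simp add: g_def norm_mult)
  have T': "summable (\<lambda>n. norm (T (int_decode n)))"
  proof -
    have "(\<lambda>n. norm (T (int_decode n))) summable_on UNIV"
      using T summable_on_reindex_bij_betw[OF bij_int_decode, of "\<lambda>j. norm (T j)"] by simp
    then show ?thesis by (rule summable_on_imp_summable)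
  qed
  have inf_eq: "(\<Sum>\<^sub>\<infinity>j. T j * cis (- of_int j * t)) = (\<Sum>n. g n t)" for t
  proof -
    have "(\<Sum>\<^sub>\<infinity>j. T j * cis (- of_int j * t)) = (\<Sum>\<^sub>\<infinity>n. g n t)"
      unfolding g_def by (rule infsum_reindex_bij_betw[symmetric, OF bij_int_decode])
    also have "\<dots> = (\<Sum>n. g n t)"
    proof (rule infsumI, rule norm_summable_imp_has_sum)
      show s: "summable (\<lambda>n. norm (g n t))" using T' by (simp add: g_def norm_mult)
      show "(\<lambda>n. g n t) sums (\<Sum>n. g n t)" by (intro summable_sums summable_norm_cancel[OF s])
    qed
    finally show ?thesis .
  qed
  have ae: "AE t in M. summable (\<lambda>n. norm (g n t))" using T' by (simp add: g_def norm_mult)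
  have sn: "summable (\<lambda>n. LINT t|M. norm (g n t))"
    using summable_mult[OF T', of "measure M (space M)"] by (simp add: g_def norm_mult)
  show "integrable M (\<lambda>t. \<Sum>\<^sub>\<infinity>j. T j * cis (- of_int j * t))"
    unfolding inf_eq by (rule integrable_suminf[OF g_int ae sn])
  have "(\<lambda>n. integral\<^sup>L M (g n)) sums (LINT t|M. (\<Sum>n. g n t))"
    by (rule sums_integral[OF g_int ae sn])
  moreover have "summable (\<lambda>n. norm (integral\<^sup>L M (g n)))"
    by (rule summable_comparison_test'[OF sn]) (use integral_norm_bound in auto)
  ultimately have "((\<lambda>n. integral\<^sup>L M (g n)) has_sum (LINT t|M. (\<Sum>n. g n t))) UNIV"
    by (rule norm_summable_imp_has_sum[rotated])
  then have "((\<lambda>n. T (int_decode n) * (LINT t|M. cis (- of_int (int_decode n) * t))) has_sum (LINT t|M. (\<Sum>n. g n t))) UNIV"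
    unfolding g_def by simp
  then show "((\<lambda>j. T j * (LINT t|M. cis (- of_int j * t))) has_sum (LINT t|M. (\<Sum>\<^sub>\<infinity>j. T j * cis (- of_int j * t)))) UNIV"
    unfolding inf_eq using has_sum_reindex_bij_betw[OF bij_int_decode, of "\<lambda>j. T j * (LINT t|M. cis (- of_int j * t))"] by simp
qed

section \<open>Convergence of the interpolants\<close>

lemma finite_measure_interpolation_error:
  fixes T :: "int \<Rightarrow> complex" and M :: "real measure"
  assumes M: "finite_measure M" "sets M = sets (restrict_space borel S)"
    and T: "(\<lambda>j. norm (T j)) summable_on UNIV"
    and err: "AE t in M. norm ((\<Sum>\<^sub>\<infinity>j. T j * cis (- of_int j * t)) - z * cis (- x * t)) \<le> \<delta>"
  shows "norm ((LINT t|M. (\<Sum>\<^sub>\<infinity>j. T j * cis (- of_int j * t))) - z * (LINT t|M. cis (- x * t))) \<le> \<delta> * measure M (space M)"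
proof -
  interpret finite_measure M by (rule M)
  have cm: "(\<lambda>t. cis (- x * t)) \<in> borel_measurable borel"
    by (intro borel_measurable_continuous_onI continuous_intros)
  have "(\<lambda>t. cis (- x * t)) \<in> borel_measurable M"
    using measurable_restrict_space1[OF cm] measurable_cong_sets[OF M(2) refl] by blast
  then have ci: "integrable M (\<lambda>t. cis (- x * t))"
    by (rule integrable_const_bound[where B = 1, rotated]) simp
  define G where "G t = (\<Sum>\<^sub>\<infinity>j. T j * cis (- of_int j * t))" for t
  have Gi: "integrable M G"
    using finite_measure_series_integral(2)[OF M T] unfolding G_def .
  have Di: "integrable M (\<lambda>t. G t - z * cis (- x * t))"
    by (intro Bochner_Integration.integrable_diff Gi integrable_mult_right ci)
  have "integral\<^sup>L M G - z * (LINT t|M. cis (- x * t)) = (LINT t|M. G t - z * cis (- x * t))"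
    using Gi ci by simp
  also have "norm \<dots> \<le> (LINT t|M. norm (G t - z * cis (- x * t)))" by (rule integral_norm_bound)
  also have "\<dots> \<le> (LINT t|M. \<delta>)"
    by (rule integral_mono_AE) (use err Di in \<open>auto simp: G_def\<close>)
  also have "\<dots> = \<delta> * measure M (space M)" by simp
  finally show ?thesis unfolding G_def .
qed

text \<open>In \<open>f j\<close> the factor \<open>(\<i> * j) ^ k\<close> is moved to the values of
  L, and the sum over j is taken under the integral, where it is a Fourier series at
  \<open>- t\<close>. The four variations of \<mu> are treated separately, so their masses add up to
  \<open>tot\<close>.\<close>

lemma cardinal_interpolant_error:
  fixes \<alpha> \<epsilon> :: real and k :: nat and \<mu> :: "real set \<Rightarrow> complex" and f :: "real \<Rightarrow> complex"
  assumes \<alpha>: "\<alpha> \<notin> \<nat>" "1 \<le> \<bar>\<alpha> + 1 / 2\<bar>" "real (Suc k) < 2 * \<bar>\<alpha> + 1 / 2\<bar>"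
    and \<mu>: "\<mu> \<in> periodic_complex_measures"
    and \<epsilon>: "0 < \<epsilon>" "\<epsilon> < 1"
    and supp: "measure_support \<mu> \<inter> {-pi..<pi} \<subseteq> {-pi * (1 - \<epsilon>)..pi * (1 - \<epsilon>)}"
    and f: "\<And>x. f x = (\<i> * of_real x) ^ k *
           complex_measure_integral \<mu> {-pi..<pi} (\<lambda>t. exp (- \<i> * of_real (x * t)))"
  shows "\<exists>\<beta>. (\<beta> \<longlongrightarrow> 0) at_top \<and>
    (\<forall>c\<ge>1. \<forall>x. norm (cardinal_interpolant \<alpha> c f x - f x) \<le> \<beta> c * (1 + \<bar>x\<bar>) ^ k)"
proof -
  define S where "S = {-pi..<pi}"
  define J where "J = {-pi * (1 - \<epsilon>)..pi * (1 - \<epsilon>)}"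
  \<comment> \<open>Halfway between \<open>pi * (1 - \<epsilon>)\<close> and pi, so that the closed
    interval J and its reflection lie inside \<open>{- A<..<A}\<close>.\<close>
  define A where "A = pi * (1 - \<epsilon> / 2)"
  have S: "S \<in> sets borel" "bounded S" by (simp_all add: S_def)
  have "pi * (1 - \<epsilon>) < A" "A < pi" "0 < A" using \<epsilon> by (simp_all add: A_def)
  then have A: "0 < A" "A < pi" and JA: "\<And>t. t \<in> J \<Longrightarrow> - t \<in> {- A<..<A}" by (auto simp: J_def)
  define a where "a = \<bar>\<alpha> + 1 / 2\<bar>"
  define q where "q = \<alpha> + 1 / 2 + \<bar>\<alpha> + 1 / 2\<bar>"
  have "real k < 2 * \<bar>\<alpha> + 1 / 2\<bar>" using \<alpha>(3) by simp
  then obtain \<beta> where \<beta>: "(\<beta> \<longlongrightarrow> 0) at_top" "\<And>c. 1 \<le> c \<Longrightarrow> 0 \<le> \<beta> c"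
    "\<And>c x t. 1 \<le> c \<Longrightarrow> t \<in> {- A<..<A} \<Longrightarrow>
      norm ((vderiv ^^ k) (periodization (ratio_seq a q c) x) t - (\<i> * of_real x) ^ k * cis (x * t)) \<le> \<beta> c * (1 + \<bar>x\<bar>) ^ k"
    using vderiv_periodization_error[OF \<alpha>(2) _ A, of k] unfolding a_def q_def by blast
  have ca: "bounded_countably_additive \<mu>"
    using \<mu> by (simp add: periodic_complex_measures_def bounded_countably_additive_def)
  have zero: "\<mu> B = 0" if "B \<in> sets borel" "B \<subseteq> S - J" for B
  proof (rule measure_eq_0_outside_support[OF ca that(1)])
    show "bounded B" using that S(2) by (auto intro: bounded_subset)
    show "B \<inter> measure_support \<mu> = {}" using that supp unfolding S_def J_def by blast
  qed
  define good where "good M \<longleftrightarrow> finite_measure M \<and> sets M = sets (restrict_space borel S) \<and> (AE t in M. t \<in> J)" for M :: "real measure"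
  \<comment> \<open>The real and imaginary parts vanish wherever \<mu> does, so all four variations
    are concentrated on J.\<close>
  have goodI: "good (upper_variation S \<sigma>)"
    if "bounded_countably_additive \<sigma>" "\<And>B. \<mu> B = 0 \<Longrightarrow> \<sigma> B = 0" for \<sigma>
    unfolding good_def
    by (intro conjI finite_measure_upper_variation sets_upper_variation AE_upper_variation that S)
       (use zero in \<open>auto simp: J_def\<close>)
  define M1 where "M1 = upper_variation S (\<lambda>A. Re (\<mu> A))"
  define M2 where "M2 = upper_variation S (\<lambda>A. - Re (\<mu> A))"
  define M3 where "M3 = upper_variation S (\<lambda>A. Im (\<mu> A))"
  define M4 where "M4 = upper_variation S (\<lambda>A. - Im (\<mu> A))"
  have good: "good M1" "good M2" "good M3" "good M4"
    unfolding M1_def M2_def M3_def M4_def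
    by (auto intro!: goodI bounded_countably_additive_Re_Im[OF ca])
  define I where "I M x = (LINT t|M. cis (- x * t))" for M :: "real measure" and x
  have f_eq: "f x = (\<i> * of_real x) ^ k * ((I M1 x - I M2 x) + \<i> * (I M3 x - I M4 x))" for x
    unfolding f complex_measure_integral_def I_def M1_def M2_def M3_def M4_def S_def
    by (simp add: cis_conv_exp)
  define tot where "tot = measure M1 (space M1) + measure M2 (space M2) + (measure M3 (space M3) + measure M4 (space M4))"
  have "norm (cardinal_interpolant \<alpha> c f x - f x) \<le> (\<beta> c * tot) * (1 + \<bar>x\<bar>) ^ k" if c: "1 \<le> c" for c x
  proof -
    define T where "T j = (\<i> * of_int j) ^ k * fundamental_function \<alpha> c (x - of_int j)" for j
    define P where "P M = (LINT t|M. (\<Sum>\<^sub>\<infinity>j. T j * cis (- of_int j * t)))" for M :: "real measure"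
    define z where "z = (\<i> * complex_of_real x) ^ k"
    have T: "(\<lambda>j. norm (T j)) summable_on UNIV"
      unfolding T_def by (rule periodization_fourier_series(1)) (use \<alpha> c in auto)
    have hs: "((\<lambda>j. T j * I M (of_int j)) has_sum P M) UNIV" if "good M" for M
      using finite_measure_series_integral(1)[of M S T] that T unfolding good_def I_def P_def by auto
    have hs_diff: "((\<lambda>j. T j * I M (of_int j) - T j * I M' (of_int j)) has_sum (P M - P M')) UNIV"
      if "good M" "good M'" for M M'
      using has_sum_add[OF hs[OF that(1)] has_sum_cmult_right[OF hs[OF that(2)], of "- 1"]] by simp
    have er: "norm (P M - z * I M x) \<le> \<beta> c * (1 + \<bar>x\<bar>) ^ k * measure M (space M)" if M: "good M" for M
      unfolding P_def I_def
    proof (rule finite_measure_interpolation_error[where S = S])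
      have "AE t in M. t \<in> J" using M by (simp add: good_def)
      then show "AE t in M. norm ((\<Sum>\<^sub>\<infinity>j. T j * cis (- of_int j * t)) - z * cis (- x * t)) \<le> \<beta> c * (1 + \<bar>x\<bar>) ^ k"
      proof eventually_elim
        case (elim t)
        have t: "- t \<in> {- A<..<A}" by (rule JA[OF elim])
        have "(\<Sum>\<^sub>\<infinity>j. T j * cis (- of_int j * t)) = (\<Sum>\<^sub>\<infinity>j. T j * cis (of_int j * - t))" by simp
        also have "\<dots> = (vderiv ^^ k) (periodization (ratio_seq a q c) x) (- t)"
          unfolding T_def a_def q_def
          by (rule periodization_fourier_series(2)) (use \<alpha> c t A in auto)
        finally show ?case using \<beta>(3)[OF c t, of x] by (simp add: z_def)
      qed
    qed (use M T in \<open>auto simp: good_def\<close>)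
    have "((\<lambda>j. (T j * I M1 (of_int j) - T j * I M2 (of_int j)) + \<i> * (T j * I M3 (of_int j) - T j * I M4 (of_int j)))
      has_sum ((P M1 - P M2) + \<i> * (P M3 - P M4))) UNIV"
      by (intro has_sum_add has_sum_cmult_right hs_diff good)
    moreover have "(T j * I M1 (of_int j) - T j * I M2 (of_int j)) + \<i> * (T j * I M3 (of_int j) - T j * I M4 (of_int j)) =
      f (of_int j) * fundamental_function \<alpha> c (x - of_int j)" for j
      unfolding f_eq T_def by (simp add: algebra_simps)
    ultimately have "cardinal_interpolant \<alpha> c f x = (P M1 - P M2) + \<i> * (P M3 - P M4)"
      unfolding cardinal_interpolant_def by (intro infsumI) simp
    then have "cardinal_interpolant \<alpha> c f x - f x =
      ((P M1 - z * I M1 x) - (P M2 - z * I M2 x)) + \<i> * ((P M3 - z * I M3 x) - (P M4 - z * I M4 x))"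
      unfolding f_eq z_def by (simp add: algebra_simps)
    also have "norm \<dots> \<le> (norm (P M1 - z * I M1 x) + norm (P M2 - z * I M2 x)) + (norm (P M3 - z * I M3 x) + norm (P M4 - z * I M4 x))"
    proof (rule norm_triangle_mono)
      show "norm (\<i> * ((P M3 - z * I M3 x) - (P M4 - z * I M4 x))) \<le> norm (P M3 - z * I M3 x) + norm (P M4 - z * I M4 x)"
        unfolding norm_mult norm_ii mult_1 by (rule norm_triangle_ineq4)
    qed (rule norm_triangle_ineq4)
    also have "\<dots> \<le> (\<beta> c * tot) * (1 + \<bar>x\<bar>) ^ k"
    proof -
      have "(\<beta> c * tot) * (1 + \<bar>x\<bar>) ^ k = (\<beta> c * (1 + \<bar>x\<bar>) ^ k * measure M1 (space M1) + \<beta> c * (1 + \<bar>x\<bar>) ^ k * measure M2 (space M2)) +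
        (\<beta> c * (1 + \<bar>x\<bar>) ^ k * measure M3 (space M3) + \<beta> c * (1 + \<bar>x\<bar>) ^ k * measure M4 (space M4))"
        by (simp add: tot_def algebra_simps)
      then show ?thesis using er[OF good(1)] er[OF good(2)] er[OF good(3)] er[OF good(4)] by (simp only:)
    qed
    finally show ?thesis .
  qed
  moreover have "((\<lambda>c. \<beta> c * tot) \<longlongrightarrow> 0) at_top"
    using tendsto_mult_left_zero[OF \<beta>(1)] .
  ultimately show ?thesis by (intro exI[of _ "\<lambda>c. \<beta> c * tot"]) auto
qed

theorem theorem28:
  fixes \<alpha> \<epsilon> :: real and k :: nat and \<mu> :: "real set \<Rightarrow> complex" and f :: "real \<Rightarrow> complex"
  assumes "(\<alpha> \<ge> 1 / 2 \<and> \<alpha> \<notin> \<nat> \<and> int k \<in> {0..\<lfloor>2 * \<alpha> + 1\<rfloor> - 2}) \<or>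
           (\<alpha> < - (3 / 2) \<and> int k \<in> {0..\<lceil>2 * \<bar>\<alpha>\<bar> - 2\<rceil> - 2})"
    and "\<mu> \<in> periodic_complex_measures"
    and "0 < \<epsilon>" and "\<epsilon> < 1"
    and "measure_support \<mu> \<inter> {-pi..<pi} \<subseteq> {-pi * (1 - \<epsilon>)..pi * (1 - \<epsilon>)}"
    and "\<And>x. f x = (\<i> * of_real x) ^ k *
           complex_measure_integral \<mu> {-pi..<pi} (\<lambda>t. exp (- \<i> * of_real (x * t)))"
  shows "(\<forall>x. ((\<lambda>c. cardinal_interpolant \<alpha> c f x) \<longlongrightarrow> f x) at_top) \<and>
    (\<forall>K. compact K \<longrightarrow> uniform_limit K (\<lambda>c. cardinal_interpolant \<alpha> c f) f at_top) \<and>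
    (k = 0 \<longrightarrow> uniform_limit UNIV (\<lambda>c. cardinal_interpolant \<alpha> c f) f at_top)"
proof -
  \<comment> \<open>With \<open>a = \<bar>\<alpha> + 1 / 2\<bar>\<close>, the first range says
    \<open>k + 2 \<le> 2 * a\<close>, as \<open>2 * a = 2 * \<alpha> + 1\<close>, and the second
    \<open>k + 2 < 2 * a\<close>, as \<open>2 * a = 2 * \<bar>\<alpha>\<bar> - 1\<close>. A negative
    \<alpha> is not a natural number.\<close>
  have \<alpha>: "\<alpha> \<notin> \<nat> \<and> 1 \<le> \<bar>\<alpha> + 1 / 2\<bar> \<and> real (Suc k) < 2 * \<bar>\<alpha> + 1 / 2\<bar>"
    using assms(1)
  proof
    assume h: "\<alpha> \<ge> 1 / 2 \<and> \<alpha> \<notin> \<nat> \<and> int k \<in> {0..\<lfloor>2 * \<alpha> + 1\<rfloor> - 2}"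
    then have "int (k + 2) \<le> \<lfloor>2 * \<alpha> + 1\<rfloor>" by simp
    then have "real (k + 2) \<le> 2 * \<alpha> + 1" by (simp only: le_floor_iff of_int_of_nat_eq)
    then show ?thesis using h by simp
  next
    assume h: "\<alpha> < - (3 / 2) \<and> int k \<in> {0..\<lceil>2 * \<bar>\<alpha>\<bar> - 2\<rceil> - 2}"
    then have "int k \<le> \<lceil>2 * \<bar>\<alpha>\<bar> - 2\<rceil> - 2" by (simp only: atLeastAtMost_iff)
    then have "int (k + 1) < \<lceil>2 * \<bar>\<alpha>\<bar> - 2\<rceil>" by linarith
    then have "real (k + 1) < 2 * \<bar>\<alpha>\<bar> - 2" by (simp only: less_ceiling_iff of_int_of_nat_eq)
    moreover have "\<alpha> \<notin> \<nat>" using h by (auto elim!: Nats_cases)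
    ultimately show ?thesis using h by simp
  qed
  then obtain \<beta> where \<beta>: "(\<beta> \<longlongrightarrow> 0) at_top"
    "\<And>c x. 1 \<le> c \<Longrightarrow> norm (cardinal_interpolant \<alpha> c f x - f x) \<le> \<beta> c * (1 + \<bar>x\<bar>) ^ k"
    using cardinal_interpolant_error[OF _ _ _ assms(2-6)] by blast
  have lim: "uniform_limit X (\<lambda>c. cardinal_interpolant \<alpha> c f) f at_top"
    if X: "\<And>x. x \<in> X \<Longrightarrow> (1 + \<bar>x\<bar>) ^ k \<le> D" for X D
  proof (rule uniform_limitI)
    fix e :: real assume e: "e > 0"
    \<comment> \<open>The absolute value makes the coefficient nonnegative, as monotonicity in the
      factor bounded by D requires.\<close>
    have "((\<lambda>c. \<bar>\<beta> c\<bar> * D) \<longlongrightarrow> 0) at_top"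
      using tendsto_mult_left_zero[OF tendsto_rabs_zero[OF \<beta>(1)]] .
    then have "\<forall>\<^sub>F c in at_top. \<bar>\<beta> c\<bar> * D < e" using e by (rule order_tendstoD(2))
    then show "\<forall>\<^sub>F c in at_top. \<forall>x\<in>X. dist (cardinal_interpolant \<alpha> c f x) (f x) < e"
      using eventually_ge_at_top[of 1]
    proof eventually_elim
      case (elim c)
      show ?case
      proof
        fix x assume "x \<in> X"
        have "dist (cardinal_interpolant \<alpha> c f x) (f x) \<le> \<beta> c * (1 + \<bar>x\<bar>) ^ k"
          unfolding dist_norm by (rule \<beta>(2)[OF elim(2)])
        also have "\<dots> \<le> \<bar>\<beta> c\<bar> * D"
          by (rule mult_mono[OF abs_ge_self X[OF \<open>x \<in> X\<close>]]) auto
        finally show "dist (cardinal_interpolant \<alpha> c f x) (f x) < e" using elim(1) by simp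
      qed
    qed
  qed
  have cpt: "uniform_limit K (\<lambda>c. cardinal_interpolant \<alpha> c f) f at_top" if K: "compact K" for K
  proof -
    obtain R where R: "\<And>x. x \<in> K \<Longrightarrow> \<bar>x\<bar> \<le> R"
      using compact_imp_bounded[OF K] by (auto simp: bounded_iff)
    show ?thesis
      by (rule lim[of _ "(1 + R) ^ k"]) (use R in \<open>auto intro!: power_mono\<close>)
  qed
  have "((\<lambda>c. cardinal_interpolant \<alpha> c f x) \<longlongrightarrow> f x) at_top" for x
    using tendsto_uniform_limitI[OF cpt[of "{x}"]] by simp
  moreover have "uniform_limit UNIV (\<lambda>c. cardinal_interpolant \<alpha> c f) f at_top" if "k = 0"
    by (rule lim[of _ 1]) (simp add: that)
  ultimately show ?thesis using cpt by blast
qed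

end
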